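(* Let $h:[0,1)\to\mathbb{R}$ and $\sigma:[0,1)\to(0,\infty)$ be continuous functions, let $B$ be a standard Brownian motion, and for $x,y\in\mathbb{R}$ let $(X^{xy}_t)_{t\in[0,1)}$ be the unique strong solution of $$dX_t = h(t)(y-X_t)\,dt+\sigma(t)\,dB_t,\quad t\in[0,1),\qquad X_0=x.$$ Assume that $\{X^{xy},\,x,y\in\mathbb{R}\}$ is a family of pinned diffusions, i.e. $\mathbf{P}(\lim_{t\to1}X^{xy}_t=y)=1$ for all $x,y\in\mathbb{R}$ (this holds e.g. if $h$ is bounded from below, $\lim_{t\to1}\int_0^t h(r)\,dr=+\infty$ and $\lim_{t\to1}\int_0^t\sigma^2(r)\,dr<+\infty$). Then the processes $\{X^{xy},\,x,y\in\mathbb{R}\}$ correspond to the bridges of a non-degenerate continuous Gaussian Markov process $Z=(Z_t)_{t\in[0,1]}$ if and only if $$\Sigma:=\lim_{t\to1}\int_0^t\sigma^2(r)\,dr<+\infty$$ and the function $h$ is related to $\sigma$ as follows: $$h(t)=\frac{\sigma^2(t)}{\Sigma-\int_0^t\sigma^2(r)\,dr},\quad t\in[0,1).$$ In this case the original process $Z$ follows the dynamic $dZ_t=\sigma(t)\,dB_t$.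
   Context: All processes live on a filtered probability space $(\Omega,\mathscr{F},(\mathscr{F}_t)_{t\in[0,1]},\mathbf{P})$ satisfying the usual conditions, and $B$ is a standard Brownian motion with respect to $(\mathscr{F}_t)$. For a continuous Markov process $Z$ on $[0,1]$ and $x\in\mathbb{R}$, $Z^x$ denotes the process $Z$ started in $x$ at time $0$. $Z$ is a non-degenerate continuous Gaussian Markov process if it is a Markov process with continuous paths such that, for every $x\in\mathbb{R}$, $Z^x$ is a Gaussian process with $\mathbf{Var}(Z^x_t)>0$ for all $t\in(0,1]$. The bridge $Z^{xy}$ of $Z$ between $x$ and $y$ is the process $(Z^x_t)_{t\in[0,1)}$ conditioned on $Z_1=y$. When $Z$ has a transition density $p(s,u;t,v)$, the bridge is the Markov process started in $x$ with transition density $p^y(s,u;t,v)=\dfrac{p(s,u;t,v)\,p(t,v;1,y)}{p(s,u;1,y)}$, $0\le s<t<1$, $u,v\in\mathbb{R}$. When $Z$ is a non-degenerate continuous Gaussian Markov process, with $m(t)=\mathbf{E}(Z^x_t)$ and $c(s,t)=\mathbf{Cov}(Z^x_s,Z^x_t)$, the bridge $Z^{xy}$ is the Gaussian process with mean $m(t)+\frac{c(t,1)}{c(1,1)}(y-m(1))$ and covariance $c(s,t)-\frac{c(s,1)c(t,1)}{c(1,1)}$. The family $\{X^{xy},\,x,y\in\mathbb{R}\}$ "corresponds to the bridges of $Z$" means that for all $x,y\in\mathbb{R}$ the law of $(X^{xy}_t)_{t\in[0,1)}$ equals the law of the bridge $Z^{xy}$.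
   Formalization: The last sentence is proved as "Z can be chosen with dZ = σ dB": not every Z with these bridges has this dynamic (for σ = 1, h(t) = 1/(1−t), the process x + μt + B_t has the same bridges for every μ). *)

theory Defs
  imports "HOL-Probability.Probability"
begin

text \<open>A filtered probability space over the time interval [0,1] satisfying the usual conditions.
  Only the sigma-algebras \<open>sets (F t)\<close> are used; the values of \<open>F\<close> outside [0,1] and the
  measures carried by the \<open>F t\<close> play no role.\<close>

locale filtered_prob_space = prob_space M
  for M :: "'w measure" and F :: "real \<Rightarrow> 'w measure" +
  assumes subalg: "\<And>t. t \<in> {0..1} \<Longrightarrow> subalgebra M (F t)"
    and filt_mono: "\<And>s t. 0 \<le> s \<Longrightarrow> s \<le> t \<Longrightarrow> t \<le> 1 \<Longrightarrow> sets (F s) \<subseteq> sets (F t)"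
    and right_continuous: "\<And>t. t \<in> {0..<1} \<Longrightarrow> sets (F t) = (\<Inter>u\<in>{t<..1}. sets (F u))"
    and null_sets_complete: "\<And>A N. N \<in> null_sets M \<Longrightarrow> A \<subseteq> N \<Longrightarrow> A \<in> sets (F 0)"

definition adapted_on :: "real set \<Rightarrow> (real \<Rightarrow> 'w measure) \<Rightarrow> (real \<Rightarrow> 'w \<Rightarrow> real) \<Rightarrow> bool" where
  "adapted_on T F X \<longleftrightarrow> (\<forall>t\<in>T. X t \<in> borel_measurable (F t))"

definition continuous_paths_on :: "real set \<Rightarrow> 'w measure \<Rightarrow> (real \<Rightarrow> 'w \<Rightarrow> real) \<Rightarrow> bool" where
  "continuous_paths_on T M X \<longleftrightarrow> (AE \<omega> in M. continuous_on T (\<lambda>t. X t \<omega>))"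

definition brownian_motion ::
  "'w measure \<Rightarrow> (real \<Rightarrow> 'w measure) \<Rightarrow> (real \<Rightarrow> 'w \<Rightarrow> real) \<Rightarrow> bool" where
  "brownian_motion M F B \<longleftrightarrow>
     adapted_on {0..1} F B \<and>
     continuous_paths_on {0..1} M B \<and>
     (AE \<omega> in M. B 0 \<omega> = 0) \<and>
     (\<forall>s t. 0 \<le> s \<and> s < t \<and> t \<le> 1 \<longrightarrow>
        distributed M lborel (\<lambda>\<omega>. B t \<omega> - B s \<omega>) (normal_density 0 (sqrt (t - s))) \<and>
        prob_space.indep_set M (sets (F s))
          (sets (vimage_algebra (space M) (\<lambda>\<omega>. B t \<omega> - B s \<omega>) borel)))"


text \<open>The Ito integral of a deterministic square-integrable integrand: the \<open>L\<^sup>2\<close>-extension from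
  simple integrands \<open>\<Sum>i<n. \<xi> i * indicator {\<tau> i<..\<tau> (Suc i)}\<close>, where \<open>\<xi> i\<close> is bounded and
  measurable with respect to \<open>F (\<tau> i)\<close>.\<close>

definition simple_integrand ::
  "'w measure \<Rightarrow> (real \<Rightarrow> 'w measure) \<Rightarrow> real \<Rightarrow> nat \<Rightarrow> (nat \<Rightarrow> real) \<Rightarrow> (nat \<Rightarrow> 'w \<Rightarrow> real) \<Rightarrow> bool" where
  "simple_integrand M F t n \<tau> \<xi> \<longleftrightarrow>
     (\<forall>i<n. 0 \<le> \<tau> i \<and> \<tau> i \<le> \<tau> (Suc i) \<and> \<tau> (Suc i) \<le> t \<and>
            \<xi> i \<in> borel_measurable (F (\<tau> i)) \<and>
            (\<exists>C. \<forall>\<omega>\<in>space M. \<bar>\<xi> i \<omega>\<bar> \<le> C))"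

definition simple_process ::
  "nat \<Rightarrow> (nat \<Rightarrow> real) \<Rightarrow> (nat \<Rightarrow> 'w \<Rightarrow> real) \<Rightarrow> real \<Rightarrow> 'w \<Rightarrow> real" where
  "simple_process n \<tau> \<xi> s \<omega> = (\<Sum>i<n. \<xi> i \<omega> * indicator {\<tau> i<..\<tau> (Suc i)} s)"

definition simple_integral ::
  "(real \<Rightarrow> 'w \<Rightarrow> real) \<Rightarrow> nat \<Rightarrow> (nat \<Rightarrow> real) \<Rightarrow> (nat \<Rightarrow> 'w \<Rightarrow> real) \<Rightarrow> 'w \<Rightarrow> real" where
  "simple_integral B n \<tau> \<xi> \<omega> = (\<Sum>i<n. \<xi> i \<omega> * (B (\<tau> (Suc i)) \<omega> - B (\<tau> i) \<omega>))"

definition is_ito_integral ::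
  "'w measure \<Rightarrow> (real \<Rightarrow> 'w measure) \<Rightarrow> (real \<Rightarrow> 'w \<Rightarrow> real) \<Rightarrow> (real \<Rightarrow> real) \<Rightarrow> real \<Rightarrow> ('w \<Rightarrow> real) \<Rightarrow> bool" where
  "is_ito_integral M F B f t J \<longleftrightarrow>
     set_borel_measurable borel {0..t} f \<and>
     J \<in> borel_measurable M \<and>
     (\<exists>n \<tau> \<xi>. (\<forall>k::nat. simple_integrand M F t (n k) (\<tau> k) (\<xi> k)) \<and>
        (\<lambda>k. \<integral>\<^sup>+\<omega>. (\<integral>\<^sup>+s\<in>{0..t}. ennreal ((simple_process (n k) (\<tau> k) (\<xi> k) s \<omega> - f s)\<^sup>2) \<partial>lborel) \<partial>M)
          \<longlonglongrightarrow> 0 \<and>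
        (\<lambda>k. \<integral>\<^sup>+\<omega>. ennreal ((simple_integral B (n k) (\<tau> k) (\<xi> k) \<omega> - J \<omega>)\<^sup>2) \<partial>M) \<longlonglongrightarrow> 0)"

text \<open>\<open>X\<close> solves \<open>dX = b(t, X) dt + \<sigma>(t) dB\<close> on [0,1) with \<open>X 0 = x\<close>, on the given filtered space
  and with the given Brownian motion \<open>B\<close>.\<close>

definition sde_solution ::
  "'w measure \<Rightarrow> (real \<Rightarrow> 'w measure) \<Rightarrow> (real \<Rightarrow> 'w \<Rightarrow> real) \<Rightarrow> (real \<Rightarrow> real \<Rightarrow> real) \<Rightarrow>
   (real \<Rightarrow> real) \<Rightarrow> real \<Rightarrow> (real \<Rightarrow> 'w \<Rightarrow> real) \<Rightarrow> bool" where
  "sde_solution M F B b \<sigma> x X \<longleftrightarrow>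
     adapted_on {0..<1} F X \<and>
     continuous_paths_on {0..<1} M X \<and>
     (\<exists>I. (\<forall>t\<in>{0..<1}. is_ito_integral M F B \<sigma> t (I t)) \<and>
        (AE \<omega> in M. \<forall>t\<in>{0..<1}.
           (\<lambda>s. b s (X s \<omega>)) absolutely_integrable_on {0..t} \<and>
           X t \<omega> = x + integral {0..t} (\<lambda>s. b s (X s \<omega>)) + I t \<omega>))"

definition pinned :: "'w measure \<Rightarrow> (real \<Rightarrow> real \<Rightarrow> real \<Rightarrow> 'w \<Rightarrow> real) \<Rightarrow> bool" where
  "pinned M X \<longleftrightarrow> (\<forall>x y. AE \<omega> in M. ((\<lambda>t. X x y t \<omega>) \<longlongrightarrow> y) (at_left 1))"


definition mean :: "'w measure \<Rightarrow> ('w \<Rightarrow> real) \<Rightarrow> real" where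
  "mean M X = integral\<^sup>L M X"

definition covariance :: "'w measure \<Rightarrow> ('w \<Rightarrow> real) \<Rightarrow> ('w \<Rightarrow> real) \<Rightarrow> real" where
  "covariance M X Y = (\<integral>\<omega>. (X \<omega> - mean M X) * (Y \<omega> - mean M Y) \<partial>M)"

text \<open>Point masses count as Gaussian; this is needed for the deterministic initial value.\<close>

definition gaussian_variable :: "'w measure \<Rightarrow> ('w \<Rightarrow> real) \<Rightarrow> bool" where
  "gaussian_variable M X \<longleftrightarrow>
     X \<in> borel_measurable M \<and>
     ((\<exists>m. AE \<omega> in M. X \<omega> = m) \<or> (\<exists>m v. 0 < v \<and> distributed M lborel X (normal_density m (sqrt v))))"

definition gaussian_process :: "'w measure \<Rightarrow> real set \<Rightarrow> (real \<Rightarrow> 'w \<Rightarrow> real) \<Rightarrow> bool" where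
  "gaussian_process M T X \<longleftrightarrow>
     (\<forall>J a. finite J \<and> J \<subseteq> T \<longrightarrow> gaussian_variable M (\<lambda>\<omega>. \<Sum>t\<in>J. a t * X t \<omega>))"

definition transition_function :: "(real \<Rightarrow> real \<Rightarrow> real \<Rightarrow> real measure) \<Rightarrow> bool" where
  "transition_function P \<longleftrightarrow>
     (\<forall>s t. 0 \<le> s \<and> s < t \<and> t \<le> 1 \<longrightarrow> P s t \<in> borel \<rightarrow>\<^sub>M prob_algebra borel) \<and>
     (\<forall>s r t u. 0 \<le> s \<and> s < r \<and> r < t \<and> t \<le> 1 \<longrightarrow> P s t u = P s r u \<bind> P r t)"

definition natural_filtration :: "'w measure \<Rightarrow> (real \<Rightarrow> 'w \<Rightarrow> real) \<Rightarrow> real \<Rightarrow> 'w measure" where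
  "natural_filtration M X s =
     vimage_algebra (space M) (\<lambda>\<omega>. \<lambda>r\<in>{0..s}. X r \<omega>) (\<Pi>\<^sub>M r\<in>{0..s}. borel)"

definition markov_process ::
  "'w measure \<Rightarrow> (real \<Rightarrow> real \<Rightarrow> real \<Rightarrow> real measure) \<Rightarrow> (real \<Rightarrow> 'w \<Rightarrow> real) \<Rightarrow> bool" where
  "markov_process M P X \<longleftrightarrow>
     (\<forall>t\<in>{0..1}. X t \<in> borel_measurable M) \<and>
     (\<forall>s t. 0 \<le> s \<and> s < t \<and> t \<le> 1 \<longrightarrow> (\<forall>A\<in>sets borel. AE \<omega> in M.
        real_cond_exp M (natural_filtration M X s) (\<lambda>\<omega>. indicator A (X t \<omega>)) \<omega>
          = measure (P s t (X s \<omega>)) A))"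

text \<open>\<open>Z x\<close> is the process started in \<open>x\<close>; the Markov property refers to one transition function,
  common to all starting points.\<close>

definition nondegenerate_continuous_gaussian_markov ::
  "'w measure \<Rightarrow> (real \<Rightarrow> real \<Rightarrow> 'w \<Rightarrow> real) \<Rightarrow> bool" where
  "nondegenerate_continuous_gaussian_markov M Z \<longleftrightarrow>
     (\<exists>P. transition_function P \<and> (\<forall>x. markov_process M P (Z x))) \<and>
     (\<forall>x. (AE \<omega> in M. Z x 0 \<omega> = x) \<and>
          continuous_paths_on {0..1} M (Z x) \<and>
          gaussian_process M {0..1} (Z x) \<and>
          (\<forall>t\<in>{0<..1}. covariance M (Z x t) (Z x t) > 0))"

text \<open>\<open>Q\<close> is the law, on the product space indexed by [0,1), of the bridge of the Gaussian Markov
  process \<open>Z\<close> (started in a fixed point) to the end point \<open>y\<close>, i.e. of \<open>Z\<close> conditioned on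
  \<open>Z 1 = y\<close>. For Gaussian processes this is the Gaussian law with the mean and covariance below,
  which singles out a version of the conditional law for every \<open>y\<close>.\<close>

definition is_bridge_law ::
  "'w measure \<Rightarrow> (real \<Rightarrow> 'w \<Rightarrow> real) \<Rightarrow> real \<Rightarrow> (real \<Rightarrow> real) measure \<Rightarrow> bool" where
  "is_bridge_law M Z y Q \<longleftrightarrow>
     prob_space Q \<and> sets Q = sets (\<Pi>\<^sub>M t\<in>{0..<1}. borel) \<and>
     gaussian_process Q {0..<1} (\<lambda>t w. w t) \<and>
     (let m = (\<lambda>t. mean M (Z t)); c = (\<lambda>s t. covariance M (Z s) (Z t)) in
       (\<forall>t\<in>{0..<1}. mean Q (\<lambda>w. w t) = m t + c t 1 / c 1 1 * (y - m 1)) \<and>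
       (\<forall>s\<in>{0..<1}. \<forall>t\<in>{0..<1}.
          covariance Q (\<lambda>w. w s) (\<lambda>w. w t) = c s t - c s 1 * c t 1 / c 1 1))"

definition path_law :: "'w measure \<Rightarrow> (real \<Rightarrow> 'w \<Rightarrow> real) \<Rightarrow> (real \<Rightarrow> real) measure" where
  "path_law M X = distr M (\<Pi>\<^sub>M t\<in>{0..<1}. borel) (\<lambda>\<omega>. \<lambda>t\<in>{0..<1}. X t \<omega>)"

definition corresponds_to_bridges ::
  "'w measure \<Rightarrow> (real \<Rightarrow> real \<Rightarrow> real \<Rightarrow> 'w \<Rightarrow> real) \<Rightarrow> (real \<Rightarrow> real \<Rightarrow> 'w \<Rightarrow> real) \<Rightarrow> bool" where
  "corresponds_to_bridges M X Z \<longleftrightarrow> (\<forall>x y. is_bridge_law M (Z x) y (path_law M (X x y)))"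

end

theory Submission
  imports Defs
begin

text \<open>With \<open>H t = \<integral>\<^sub>0\<^sup>t h\<close>, all solutions are obtained from one of them,
  \<open>X x y t = y + (x - y) exp (- H t) + X 0 0 t\<close>, and \<open>N t = exp (H t) X 0 0 t\<close> is the Wiener
  integral of \<open>exp (H r) \<sigma> r\<close>, a Gaussian process with independent increments and variance
  \<open>U t = \<integral>\<^sub>0\<^sup>t exp (2 H r) (\<sigma> r)\<^sup>2 dr\<close>. This gives the mean and the covariance of \<open>X x y\<close>.

  If the \<open>X x y\<close> are the bridges of \<open>Z\<close>, the covariance \<open>c\<close> of \<open>Z\<close> is determined by \<open>H\<close>, \<open>U\<close>
  and \<open>c 1 1\<close>, and the Markov property \<open>c s 1 * c r r = c s r * c r 1\<close> becomes
  \<open>(exp (H s) - 1) U r = (exp (H r) - 1) U s\<close>, so that \<open>exp (H t) = 1 + \<kappa> U t\<close> for a constant \<open>\<kappa>\<close>.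
  Differentiation yields \<open>h t = \<kappa> exp (H t) (\<sigma> t)\<^sup>2\<close> and then \<open>exp (- H t) = 1 - \<kappa> V t\<close> with
  \<open>V t = \<integral>\<^sub>0\<^sup>t (\<sigma> r)\<^sup>2 dr\<close>; pinning forces \<open>exp (- H t) \<rightarrow> 0\<close>, that is \<open>V t \<rightarrow> 1 / \<kappa>\<close>.
  Conversely, take \<open>Z x t = x + \<integral>\<^sub>0\<^sup>t \<sigma> dB\<close>, extended to time 1 by its limit, which exists by
  Kolmogorov's maximal inequality because \<open>V\<close> is bounded.\<close>

section \<open>Deterministic analysis on the half-open unit interval\<close>

text \<open>\<open>is_ito_integral\<close> treats each time separately, as a limit of random
  integrands, and every solution brings its own version of the noise. The isometry, applied to the
  difference between the given integrand and a deterministic step function, lets left-endpoint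
  Riemann sums replace the random ones. Subsequences of these sums converge almost surely, which
  yields adaptedness, uniqueness at each time and the law of the increments. The passage from the
  noise to \<open>N\<close> is then pathwise: summation by parts against a continuous version avoids
  constructing an integral of \<open>exp \<circ> H * \<sigma>\<close>. Independence from a
  sigma-algebra is tested on its events with characteristic functions, so that one-dimensional
  uniqueness suffices throughout. The constant \<kappa> is 1 / \<Sigma> in disguise: it is the slope
  of \<open>exp H\<close> against \<open>U\<close>, and pinning identifies it with the reciprocal of
  the limit of \<open>V\<close>.\<close>

lemma integral_derivative_Ico:
  fixes f :: "real \<Rightarrow> real"
  assumes f: "continuous_on {0..<1} f" and t: "t \<in> {0..<1}"
  shows "((\<lambda>t. integral {0..t} f) has_real_derivative f t) (at t within {0..<1})"
proof -
  \<comment> \<open>The fundamental theorem needs a compact interval; near \<open>t\<close> the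
    intervals \<open>{0..b}\<close> and \<open>{0..<1}\<close> coincide, so the one-sided derivative
    at 0 is covered too.\<close>
  obtain b where b: "t < b" "b < 1" using t dense[of t 1] by auto
  have "((\<lambda>t. integral {0..t} f) has_real_derivative f t) (at t within {0..b})"
    using t b by (intro integral_has_real_derivative continuous_on_subset[OF f]) auto
  moreover have "at t within {0..b} = at t within {0..<1}"
    using t b by (intro at_within_nhd[of _ "{..<b}"]) auto
  ultimately show ?thesis by simp
qed

lemma continuous_on_integral_Ico:
  fixes f :: "real \<Rightarrow> real"
  assumes "continuous_on {0..<1} f"
  shows "continuous_on {0..<1} (\<lambda>t. integral {0..t} f)"
  using integral_derivative_Ico[OF assms] DERIV_continuous_on by blast

lemma integrable_Ico:
  fixes f :: "real \<Rightarrow> real"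
  assumes f: "continuous_on {0..<1} f" and st: "0 \<le> s" "t < 1"
  shows "f integrable_on {s..t}"
  using st by (intro integrable_continuous_interval continuous_on_subset[OF f]) auto

lemma integral_diff_Ico:
  fixes f :: "real \<Rightarrow> real"
  assumes f: "continuous_on {0..<1} f" and st: "0 \<le> s" "s \<le> t" "t < 1"
  shows "integral {s..t} f = integral {0..t} f - integral {0..s} f"
  using Henstock_Kurzweil_Integration.integral_combine[of 0 s t f] integrable_Ico[OF f, of 0 t] st by simp

lemma constant_if_DERIV_zero_Ico:
  fixes f :: "real \<Rightarrow> real"
  assumes "\<And>t. t \<in> {0..<1} \<Longrightarrow> (f has_real_derivative 0) (at t within {0..<1})" and t: "t \<in> {0..<1}"
  shows "f t = f 0"
proof -
  obtain c where "\<And>x. x \<in> {0..<1::real} \<Longrightarrow> f x = c"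
    using has_field_derivative_zero_constant[of "{0..<1::real}" f] assms(1) by auto
  then show ?thesis using t by simp
qed

text \<open>\<open>i\<close> is a path of the noise and only continuous, so \<open>D\<close> itself
  need not be differentiable. The difference \<open>D - i\<close> is, and the integrating factor
  \<open>exp (H t)\<close> is applied to it.\<close>

lemma linear_integral_equation:
  fixes h D i :: "real \<Rightarrow> real"
  defines "H \<equiv> \<lambda>t. integral {0..t} h"
  assumes h: "continuous_on {0..<1} h" and D: "continuous_on {0..<1} D"
    and eq: "\<And>t. t \<in> {0..<1} \<Longrightarrow> D t = a + integral {0..t} (\<lambda>s. h s * (b - D s)) + i t"
    and t: "t \<in> {0..<1}"
  shows "D t = b + (a - b) * exp (- H t) + i t - exp (- H t) * integral {0..t} (\<lambda>s. h s * exp (H s) * i s)"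
proof -
  have hD: "continuous_on {0..<1} (\<lambda>s. h s * (b - D s))"
    by (intro continuous_intros h D)
  have "continuous_on {0..<1} (\<lambda>t. D t - a - integral {0..t} (\<lambda>s. h s * (b - D s)))"
    by (intro continuous_intros D continuous_on_integral_Ico hD)
  then have i: "continuous_on {0..<1} i"
    by (rule continuous_on_eq) (use eq in fastforce)
  have cH: "continuous_on {0..<1} H"
    unfolding H_def by (rule continuous_on_integral_Ico[OF h])
  have chi: "continuous_on {0..<1} (\<lambda>s. h s * exp (H s) * i s)"
    by (intro continuous_intros h i cH)
  \<comment> \<open>The bracket is \<open>D t - i t - b\<close>; the last integral compensates the
    term that \<open>i\<close> contributes to the derivative.\<close>
  define \<Phi> where "\<Phi> t = exp (H t) * (a + integral {0..t} (\<lambda>s. h s * (b - D s)) - b)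
    + integral {0..t} (\<lambda>s. h s * exp (H s) * i s)" for t
  have "(\<Phi> has_real_derivative 0) (at t within {0..<1})" if t: "t \<in> {0..<1}" for t
    unfolding \<Phi>_def H_def
    apply (rule derivative_eq_intros integral_derivative_Ico[OF h t] integral_derivative_Ico[OF hD t]
        integral_derivative_Ico[OF chi[unfolded H_def] t] refl)+
    using eq[OF t] by (simp add: algebra_simps)
  from constant_if_DERIV_zero_Ico[OF this t] have "\<Phi> t = a - b"
    by (simp add: \<Phi>_def H_def)
  then have "exp (H t) * (D t - i t - b) = a - b - integral {0..t} (\<lambda>s. h s * exp (H s) * i s)"
    using eq[OF t] by (simp add: \<Phi>_def algebra_simps)
  then have "D t - i t - b = exp (- H t) * (a - b - integral {0..t} (\<lambda>s. h s * exp (H s) * i s))"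
    by (simp add: exp_minus field_simps)
  then show ?thesis by (simp add: algebra_simps)
qed

section \<open>Uniform partitions and Riemann-Stieltjes sums\<close>

definition upart :: "real \<Rightarrow> real \<Rightarrow> nat \<Rightarrow> nat \<Rightarrow> real" where
  "upart s t n k = s + (t - s) * (real k / real (Suc n))"

lemma upart_0 [simp]: "upart s t n 0 = s"
  and upart_end [simp]: "upart s t n (Suc n) = t"
  by (simp_all add: upart_def del: of_nat_Suc)

lemma upart_mono:
  assumes "s \<le> t" "j \<le> k"
  shows "upart s t n j \<le> upart s t n k"
  unfolding upart_def using assms by (intro add_left_mono mult_left_mono divide_right_mono) auto

lemma upart_bounds:
  assumes "s \<le> t" "k \<le> Suc n"
  shows "s \<le> upart s t n k" "upart s t n k \<le> t"
  using upart_mono[OF assms(1), of 0 k n] upart_mono[OF assms, of n] by simp_all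

lemma upart_step: "upart s t n (Suc k) - upart s t n k = (t - s) / real (Suc n)"
  unfolding upart_def by (simp add: add_divide_distrib algebra_simps)

lemma integral_upart_sum:
  fixes f :: "real \<Rightarrow> real"
  assumes st: "s \<le> t" and f: "continuous_on {s..t} f" and "m \<le> Suc n"
  shows "(\<Sum>k<m. integral {upart s t n k..upart s t n (Suc k)} f) = integral {s..upart s t n m} f"
  using \<open>m \<le> Suc n\<close>
proof (induction m)
  case (Suc m)
  have "f integrable_on {s..upart s t n (Suc m)}"
    using upart_bounds[OF st Suc.prems]
    by (intro integrable_continuous_interval continuous_on_subset[OF f]) auto
  then show ?case
    using Henstock_Kurzweil_Integration.integral_combine[of s "upart s t n m" "upart s t n (Suc m)" f]
      upart_bounds[OF st, of m n] upart_mono[OF st, of m "Suc m" n] Suc by simp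
qed simp

text \<open>Uniform continuity of \<open>i\<close> bounds the error on each block by
  \<open>\<delta>\<close> times the integral of \<open>\<bar>e r\<bar>\<close> over that block,
  whatever the tags. Left tags will serve for variances, right tags for summation by parts.\<close>

lemma riemann_stieltjes_sums:
  fixes i e :: "real \<Rightarrow> real"
  assumes st: "s \<le> t" and i: "continuous_on {s..t} i" and e: "continuous_on {s..t} e"
    and c: "\<And>n k. k \<le> n \<Longrightarrow> c n k \<in> {upart s t n k..upart s t n (Suc k)}"
  shows "(\<lambda>n. \<Sum>k<Suc n. i (c n k) * integral {upart s t n k..upart s t n (Suc k)} e)
    \<longlonglongrightarrow> integral {s..t} (\<lambda>r. i r * e r)"
proof (rule LIMSEQ_I)
  fix \<epsilon> :: real assume "\<epsilon> > 0"
  define L where "L = integral {s..t} (\<lambda>r. \<bar>e r\<bar>)"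
  have ea: "continuous_on {s..t} (\<lambda>r. \<bar>e r\<bar>)" by (intro continuous_intros e)
  have ie: "continuous_on {s..t} (\<lambda>r. i r * e r)" by (intro continuous_intros e i)
  have "L \<ge> 0" unfolding L_def by (intro integral_nonneg integrable_continuous_interval ea) auto
  \<comment> \<open>The summand 1 keeps \<open>\<delta> * L < \<epsilon>\<close> valid when
    \<open>L = 0\<close>.\<close>
  define \<delta> where "\<delta> = \<epsilon> / (L + 1)"
  have "\<delta> > 0" using \<open>\<epsilon> > 0\<close> \<open>L \<ge> 0\<close> by (simp add: \<delta>_def)
  have "\<delta> * L < \<epsilon>" using \<open>\<epsilon> > 0\<close> \<open>L \<ge> 0\<close> by (simp add: \<delta>_def field_simps)
  have "uniformly_continuous_on {s..t} i" using i by (intro compact_uniformly_continuous) auto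
  then obtain d where d: "d > 0" "\<And>x y. x \<in> {s..t} \<Longrightarrow> y \<in> {s..t} \<Longrightarrow> dist y x < d \<Longrightarrow> dist (i y) (i x) < \<delta>"
    using \<open>\<delta> > 0\<close> unfolding uniformly_continuous_on_def by blast
  obtain n0 where n0: "(t - s) / d < real n0" using reals_Archimedean2 by blast
  show "\<exists>no. \<forall>n\<ge>no. norm ((\<Sum>k<Suc n. i (c n k) * integral {upart s t n k..upart s t n (Suc k)} e)
     - integral {s..t} (\<lambda>r. i r * e r)) < \<epsilon>"
  proof (intro exI allI impI)
    fix n assume "n \<ge> n0"
    define p where "p = upart s t n"
    have mesh: "(t - s) / real (Suc n) < d"
    proof -
      have "(t - s) / d < real (Suc n)" using n0 \<open>n \<ge> n0\<close> by linarith
      then show ?thesis using d(1) by (simp add: field_simps del: of_nat_Suc)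
    qed
    have each: "\<bar>i (c n k) * integral {p k..p (Suc k)} e - integral {p k..p (Suc k)} (\<lambda>r. i r * e r)\<bar>
        \<le> \<delta> * integral {p k..p (Suc k)} (\<lambda>r. \<bar>e r\<bar>)" if k: "k < Suc n" for k
    proof -
      have sub: "{p k..p (Suc k)} \<subseteq> {s..t}"
        using upart_bounds[OF st, of k n] upart_bounds[OF st, of "Suc k" n] k by (auto simp: p_def)
      have int: "e integrable_on {p k..p (Suc k)}" "(\<lambda>r. i r * e r) integrable_on {p k..p (Suc k)}"
         "(\<lambda>r. \<bar>e r\<bar>) integrable_on {p k..p (Suc k)}"
        by (intro integrable_continuous_interval continuous_on_subset[OF _ sub] e ie ea)+
      have eq: "i (c n k) * integral {p k..p (Suc k)} e - integral {p k..p (Suc k)} (\<lambda>r. i r * e r)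
        = integral {p k..p (Suc k)} (\<lambda>r. i (c n k) * e r - i r * e r)"
        using int by (subst Henstock_Kurzweil_Integration.integral_diff) (auto intro: integrable_on_mult_right)
      have "norm (integral {p k..p (Suc k)} (\<lambda>r. i (c n k) * e r - i r * e r))
          \<le> integral {p k..p (Suc k)} (\<lambda>r. \<delta> * \<bar>e r\<bar>)"
      proof (intro integral_norm_bound_integral integrable_diff integrable_on_mult_right int)
        fix r assume r: "r \<in> {p k..p (Suc k)}"
        have ck: "c n k \<in> {p k..p (Suc k)}" using c[of k n] k by (simp add: p_def)
        have "dist (c n k) r \<le> p (Suc k) - p k" using r ck by (auto simp: dist_real_def)
        then have "dist (c n k) r < d" using mesh by (simp add: p_def upart_step)
        then have "dist (i (c n k)) (i r) < \<delta>" using d(2)[of r "c n k"] sub ck r by auto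
        then have "\<bar>i (c n k) - i r\<bar> * \<bar>e r\<bar> \<le> \<delta> * \<bar>e r\<bar>"
          by (intro mult_right_mono) (auto simp: dist_real_def)
        then show "norm (i (c n k) * e r - i r * e r) \<le> \<delta> * \<bar>e r\<bar>"
          by (simp add: left_diff_distrib[symmetric] abs_mult)
      qed
      then show ?thesis using int eq by simp
    qed
    have "\<bar>(\<Sum>k<Suc n. i (c n k) * integral {p k..p (Suc k)} e) - integral {s..t} (\<lambda>r. i r * e r)\<bar>
       = \<bar>\<Sum>k<Suc n. i (c n k) * integral {p k..p (Suc k)} e - integral {p k..p (Suc k)} (\<lambda>r. i r * e r)\<bar>"
      using integral_upart_sum[OF st ie, of "Suc n" n] by (simp add: p_def sum_subtractf del: sum.lessThan_Suc)
    also have "\<dots> \<le> (\<Sum>k<Suc n. \<delta> * integral {p k..p (Suc k)} (\<lambda>r. \<bar>e r\<bar>))"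
      using each by (intro order_trans[OF sum_abs] sum_mono) auto
    also have "\<dots> = \<delta> * L"
      using integral_upart_sum[OF st ea, of "Suc n" n]
      by (simp add: p_def L_def sum_distrib_left[symmetric] del: sum.lessThan_Suc)
    also have "\<dots> < \<epsilon>" by fact
    finally show "norm ((\<Sum>k<Suc n. i (c n k) * integral {upart s t n k..upart s t n (Suc k)} e)
      - integral {s..t} (\<lambda>r. i r * e r)) < \<epsilon>" by (simp add: p_def)
  qed
qed

text \<open>\<open>i\<close> may have unbounded variation, so the sums cannot be treated as a
  Stieltjes integral against \<open>i\<close>. Abel summation moves the increments onto
  \<open>E\<close>, where \<open>riemann_stieltjes_sums\<close> applies with right tags.\<close>

lemma by_parts_sums:
  fixes i e E :: "real \<Rightarrow> real"
  assumes st: "s \<le> t" and i: "continuous_on {s..t} i" and e: "continuous_on {s..t} e"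
    and E: "\<And>a b. s \<le> a \<Longrightarrow> a \<le> b \<Longrightarrow> b \<le> t \<Longrightarrow> integral {a..b} e = E b - E a"
  shows "(\<lambda>n. \<Sum>k<Suc n. E (upart s t n k) * (i (upart s t n (Suc k)) - i (upart s t n k)))
    \<longlonglongrightarrow> E t * i t - E s * i s - integral {s..t} (\<lambda>r. i r * e r)"
proof -
  have abel: "(\<Sum>k<m. E (p k) * (i (p (Suc k)) - i (p k)))
      = E (p m) * i (p m) - E (p 0) * i (p 0) - (\<Sum>k<m. i (p (Suc k)) * (E (p (Suc k)) - E (p k)))"
    for p :: "nat \<Rightarrow> real" and m
    by (induction m) (auto simp: algebra_simps)
  have "(\<Sum>k<Suc n. i (upart s t n (Suc k)) * (E (upart s t n (Suc k)) - E (upart s t n k)))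
    = (\<Sum>k<Suc n. i (upart s t n (Suc k)) * integral {upart s t n k..upart s t n (Suc k)} e)" for n
  proof (rule sum.cong)
    fix k assume "k \<in> {..<Suc n}"
    then show "i (upart s t n (Suc k)) * (E (upart s t n (Suc k)) - E (upart s t n k))
      = i (upart s t n (Suc k)) * integral {upart s t n k..upart s t n (Suc k)} e"
      using upart_bounds[OF st, of k n] upart_bounds[OF st, of "Suc k" n] upart_mono[OF st, of k "Suc k" n]
      by (subst E) auto
  qed simp
  then have eq: "(\<Sum>k<Suc n. E (upart s t n k) * (i (upart s t n (Suc k)) - i (upart s t n k)))
    = E t * i t - E s * i s - (\<Sum>k<Suc n. i (upart s t n (Suc k)) * integral {upart s t n k..upart s t n (Suc k)} e)" for n
    using abel[where p="upart s t n" and m="Suc n"] by (simp del: sum.lessThan_Suc)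
  show ?thesis unfolding eq
    by (intro tendsto_diff tendsto_const riemann_stieltjes_sums[OF st i e, where c="\<lambda>n k. upart s t n (Suc k)"])
      (auto intro: upart_mono[OF st])
qed

section \<open>Gaussian variables independent of a sigma-algebra\<close>

text \<open>Preimages are closed under intersection, so the product rule for them extends to the
  sigma-algebras that they generate.\<close>

lemma (in prob_space) indep_varI:
  assumes X: "random_variable N X" and Y: "random_variable L Y"
    and *: "\<And>A B. A \<in> sets N \<Longrightarrow> B \<in> sets L \<Longrightarrow>
      prob ((X -` A \<inter> space M) \<inter> (Y -` B \<inter> space M)) = prob (X -` A \<inter> space M) * prob (Y -` B \<inter> space M)"
  shows "indep_var N X L Y"
proof -
  have st: "Int_stable {Z -` A \<inter> space M |A. A \<in> sets S}" for Z :: "'a \<Rightarrow> 'b" and S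
  proof (rule Int_stableI)
    fix a b assume "a \<in> {Z -` A \<inter> space M |A. A \<in> sets S}" "b \<in> {Z -` A \<inter> space M |A. A \<in> sets S}"
    then obtain A B where "A \<in> sets S" "B \<in> sets S" "a = Z -` A \<inter> space M" "b = Z -` B \<inter> space M" by auto
    then show "a \<inter> b \<in> {Z -` A \<inter> space M |A. A \<in> sets S}"
      by (intro CollectI exI[of _ "A \<inter> B"]) auto
  qed
  have "indep_set {X -` A \<inter> space M |A. A \<in> sets N} {Y -` A \<inter> space M |A. A \<in> sets L}"
    using measurable_sets[OF X] measurable_sets[OF Y] * by (intro indep_setI) auto
  then show ?thesis
    unfolding indep_var_eq using X Y by (auto intro!: indep_set_sigma_sets st)
qed

lemma (in prob_space) integrable_scaleR_iexp:
  assumes w: "w \<in> borel_measurable M" "\<And>\<omega>. \<bar>w \<omega>\<bar> \<le> c" and Y: "Y \<in> borel_measurable M"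
  shows "integrable M (\<lambda>\<omega>. w \<omega> *\<^sub>R iexp (\<theta> * Y \<omega>))"
  using w Y by (intro integrable_const_bound[where B=c]) (auto simp: borel_measurable_complex_iff)

text \<open>Uniqueness of characteristic functions, applied to the law of \<open>Y\<close> under the measure with
  density proportional to \<open>w\<close>.\<close>

lemma (in prob_space) char_weight_factorization:
  fixes w Y :: "'a \<Rightarrow> real"
  assumes w [measurable]: "w \<in> borel_measurable M" and w0: "\<And>\<omega>. 0 \<le> w \<omega>" and wc: "\<And>\<omega>. w \<omega> \<le> c"
    and Y [measurable]: "Y \<in> borel_measurable M"
    and eq: "\<And>\<theta>. (\<integral>\<omega>. w \<omega> *\<^sub>R iexp (\<theta> * Y \<omega>) \<partial>M) = complex_of_real (expectation w) * char (distr M borel Y) \<theta>"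
    and A [measurable]: "A \<in> sets borel"
  shows "(\<integral>\<omega>. w \<omega> * indicator A (Y \<omega>) \<partial>M) = expectation w * prob (Y -` A \<inter> space M)"
proof -
  have iw: "integrable M w"
    using w0 wc by (intro integrable_const_bound[where B=c]) auto
  have Ew: "0 \<le> expectation w" by (intro Bochner_Integration.integral_nonneg) (simp add: w0)
  show ?thesis
  proof (cases "expectation w = 0")
    \<comment> \<open>A zero total weight cannot be normalised, but a nonnegative weight of mean
      zero vanishes almost surely.\<close>
    case True
    then have "AE \<omega> in M. w \<omega> = 0"
      using integral_nonneg_eq_0_iff_AE[OF iw] w0 by auto
    then have "(\<integral>\<omega>. w \<omega> * indicator A (Y \<omega>) \<partial>M) = (\<integral>\<omega>. 0 \<partial>M)"
      by (intro integral_cong_AE) auto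
    with True show ?thesis by simp
  next
    case False
    define e where "e = expectation w"
    have e: "e > 0" using Ew False by (simp add: e_def)
    define N where "N = density M (\<lambda>\<omega>. ennreal (w \<omega> / e))"
    have [measurable_cong, simp]: "sets N = sets M" by (simp add: N_def)
    have "emeasure N (space N) = (\<integral>\<^sup>+\<omega>. ennreal (w \<omega> / e) \<partial>M)"
      by (simp add: N_def emeasure_density cong: nn_integral_cong)
    also have "\<dots> = ennreal (\<integral>\<omega>. w \<omega> / e \<partial>M)"
      using w0 e iw by (intro nn_integral_eq_integral) auto
    also have "\<dots> = 1" using e by (simp add: e_def)
    finally interpret N: prob_space N by (rule prob_spaceI)
    have rd: "real_distribution (distr M borel Y)" "real_distribution (distr N borel Y)"
      using Y by (auto intro!: real_distribution_distr N.real_distribution_distr)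
    have "char (distr N borel Y) = char (distr M borel Y)"
    proof
      fix \<theta>
      have "char (distr N borel Y) \<theta> = (\<integral>\<omega>. iexp (\<theta> * Y \<omega>) \<partial>N)"
        unfolding char_def by (subst integral_distr) (auto simp: N_def)
      also have "\<dots> = (\<integral>\<omega>. (w \<omega> / e) *\<^sub>R iexp (\<theta> * Y \<omega>) \<partial>M)"
        unfolding N_def using w0 e by (subst integral_density) auto
      also have "\<dots> = (\<integral>\<omega>. (1 / e) *\<^sub>R (w \<omega> *\<^sub>R iexp (\<theta> * Y \<omega>)) \<partial>M)" by simp
      also have "\<dots> = (1 / e) *\<^sub>R (\<integral>\<omega>. w \<omega> *\<^sub>R iexp (\<theta> * Y \<omega>) \<partial>M)"
        by (rule integral_scaleR_right)
      also have "\<dots> = char (distr M borel Y) \<theta>"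
        unfolding eq e_def[symmetric] using e by (simp add: scaleR_conv_of_real)
      finally show "char (distr N borel Y) \<theta> = char (distr M borel Y) \<theta>" .
    qed
    then have eqd: "distr N borel Y = distr M borel Y"
      by (intro Levy_uniqueness rd)
    have "prob (Y -` A \<inter> space M) = (\<integral>y. indicator A y \<partial>distr N borel Y)"
      unfolding eqd by (simp add: measure_distr)
    also have "\<dots> = (\<integral>\<omega>. indicator A (Y \<omega>) \<partial>N)"
      by (subst integral_distr) auto
    also have "\<dots> = (\<integral>\<omega>. (w \<omega> / e) * indicator A (Y \<omega>) \<partial>M)"
      unfolding N_def using w0 e by (subst integral_density) auto
    also have "\<dots> = (\<integral>\<omega>. w \<omega> * indicator A (Y \<omega>) \<partial>M) / e" by simp
    finally show ?thesis using e by (simp add: e_def field_simps)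
  qed
qed

text \<open>\<open>Y\<close> is centred Gaussian with variance \<open>v\<close> and independent of \<open>G\<close>. Stated through characteristic
  functions, the property passes to almost sure limits by dominated convergence.\<close>

definition indep_gaussian :: "'w measure \<Rightarrow> 'w measure \<Rightarrow> ('w \<Rightarrow> real) \<Rightarrow> real \<Rightarrow> bool" where
  "indep_gaussian M G Y v \<longleftrightarrow> Y \<in> borel_measurable M \<and> 0 \<le> v \<and>
     (\<forall>C\<in>sets G. \<forall>\<theta>. (\<integral>\<omega>. indicator C \<omega> *\<^sub>R iexp (\<theta> * Y \<omega>) \<partial>M)
        = complex_of_real (measure M C * exp (- (\<theta>\<^sup>2 * v / 2))))"

section \<open>Calculus of Gaussian variables independent of a sigma-algebra\<close>

context prob_space begin

lemma indep_gaussianD: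
  assumes "indep_gaussian M G Y v"
  shows "Y \<in> borel_measurable M" "0 \<le> v"
    "C \<in> sets G \<Longrightarrow> (\<integral>\<omega>. indicator C \<omega> *\<^sub>R iexp (\<theta> * Y \<omega>) \<partial>M) = complex_of_real (prob C * exp (- (\<theta>\<^sup>2 * v / 2)))"
  using assms by (auto simp: indep_gaussian_def)

lemma indep_gaussian_char:
  assumes G: "subalgebra M G" and Y: "indep_gaussian M G Y v"
  shows "char (distr M borel Y) \<theta> = complex_of_real (exp (- (\<theta>\<^sup>2 * v / 2)))"
proof -
  have [measurable]: "Y \<in> borel_measurable M" using Y by (rule indep_gaussianD)
  have "char (distr M borel Y) \<theta> = (\<integral>\<omega>. iexp (\<theta> * Y \<omega>) \<partial>M)"
    unfolding char_def by (subst integral_distr) auto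
  also have "\<dots> = (\<integral>\<omega>. indicator (space M) \<omega> *\<^sub>R iexp (\<theta> * Y \<omega>) \<partial>M)"
    by (intro Bochner_Integration.integral_cong) auto
  also have "\<dots> = complex_of_real (prob (space M) * exp (- (\<theta>\<^sup>2 * v / 2)))"
    using sets.top[of G] G by (intro indep_gaussianD(3)[OF Y]) (metis subalgebra_def)
  also have "\<dots> = complex_of_real (exp (- (\<theta>\<^sup>2 * v / 2)))" by (simp add: prob_space)
  finally show ?thesis .
qed

text \<open>The integrals over \<open>C\<close> are \<open>prob C\<close> times the characteristic
  function of \<open>Y\<close>, which is the hypothesis of \<open>char_weight_factorization\<close>
  for the weight \<open>indicator C\<close>.\<close>

lemma indep_gaussian_events:
  assumes G: "subalgebra M G" and Y: "indep_gaussian M G Y v" and C: "C \<in> sets G" and A: "A \<in> sets borel"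
  shows "prob (C \<inter> (Y -` A \<inter> space M)) = prob C * prob (Y -` A \<inter> space M)"
proof -
  have [measurable]: "Y \<in> borel_measurable M" using Y by (rule indep_gaussianD)
  have [measurable]: "C \<in> sets M" using C G by (auto simp: subalgebra_def)
  have "(\<integral>\<omega>. indicat_real C \<omega> * indicator A (Y \<omega>) \<partial>M) = expectation (indicator C) * prob (Y -` A \<inter> space M)"
  proof (rule char_weight_factorization[where c=1])
    fix \<theta>
    show "(\<integral>\<omega>. indicator C \<omega> *\<^sub>R iexp (\<theta> * Y \<omega>) \<partial>M)
        = complex_of_real (expectation (indicator C)) * char (distr M borel Y) \<theta>"
      unfolding indep_gaussianD(3)[OF Y C] indep_gaussian_char[OF G Y] by simp
  qed (use A in \<open>auto simp: indicator_le_1\<close>)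
  moreover have "(\<integral>\<omega>. indicat_real C \<omega> * indicator A (Y \<omega>) \<partial>M) = expectation (indicat_real (C \<inter> (Y -` A \<inter> space M)))"
    by (intro Bochner_Integration.integral_cong) (auto simp: indicator_def)
  ultimately show ?thesis using A by simp
qed

lemma indep_gaussian_indep_var:
  assumes G: "subalgebra M G" and Y: "indep_gaussian M G Y v" and W: "W \<in> G \<rightarrow>\<^sub>M N" and g: "g \<in> borel \<rightarrow>\<^sub>M L"
  shows "indep_var N W L (\<lambda>\<omega>. g (Y \<omega>))"
proof (rule indep_varI)
  have Y': "random_variable borel Y" using Y by (rule indep_gaussianD)
  show "random_variable N W" using W G by (rule measurable_from_subalg[rotated])
  show "random_variable L (\<lambda>\<omega>. g (Y \<omega>))" using Y' g by (rule measurable_compose)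
  fix A B assume "A \<in> sets N" and B: "B \<in> sets L"
  then have "W -` A \<inter> space M \<in> sets G" using W G by (auto simp: subalgebra_def dest: measurable_sets)
  moreover have "g -` B \<in> sets borel" using g B by (simp add: measurable_def)
  moreover have "(\<lambda>\<omega>. g (Y \<omega>)) -` B = Y -` (g -` B)" by auto
  ultimately show "prob (W -` A \<inter> space M \<inter> ((\<lambda>\<omega>. g (Y \<omega>)) -` B \<inter> space M))
      = prob (W -` A \<inter> space M) * prob ((\<lambda>\<omega>. g (Y \<omega>)) -` B \<inter> space M)"
    by (simp add: indep_gaussian_events[OF G Y])
qed

text \<open>The product form of the joint law allows Fubini's theorem to integrate out
  \<open>Y\<close> with \<open>W\<close> frozen, as the Markov kernels require.\<close>

lemma indep_gaussian_pair_distr: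
  assumes G: "subalgebra M G" and Y: "indep_gaussian M G Y v" and W: "W \<in> G \<rightarrow>\<^sub>M N"
  shows "distr M N W \<Otimes>\<^sub>M distr M borel Y = distr M (N \<Otimes>\<^sub>M borel) (\<lambda>\<omega>. (W \<omega>, Y \<omega>))"
proof (rule pair_measure_eqI)
  have Y' [measurable]: "random_variable borel Y" using Y by (rule indep_gaussianD)
  have W' [measurable]: "random_variable N W" using W G by (rule measurable_from_subalg[rotated])
  interpret W: prob_space "distr M N W" by (rule prob_space_distr) fact
  interpret Y: prob_space "distr M borel Y" by (rule prob_space_distr) fact
  show "sigma_finite_measure (distr M N W)" "sigma_finite_measure (distr M borel Y)"
    by unfold_locales
  show "sets (distr M N W \<Otimes>\<^sub>M distr M borel Y) = sets (distr M (N \<Otimes>\<^sub>M borel) (\<lambda>\<omega>. (W \<omega>, Y \<omega>)))"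
    by (simp cong: sets_pair_measure_cong)
  fix A B assume "A \<in> sets (distr M N W)" "B \<in> sets (distr M borel Y)"
  then have AB [measurable]: "A \<in> sets N" "B \<in> sets borel" by auto
  have "W -` A \<inter> space M \<in> sets G" using measurable_sets[OF W AB(1)] G by (simp add: subalgebra_def)
  then have "prob (W -` A \<inter> space M \<inter> (Y -` B \<inter> space M)) = prob (W -` A \<inter> space M) * prob (Y -` B \<inter> space M)"
    by (intro indep_gaussian_events[OF G Y]) auto
  moreover have "(\<lambda>\<omega>. (W \<omega>, Y \<omega>)) -` (A \<times> B) \<inter> space M = W -` A \<inter> space M \<inter> (Y -` B \<inter> space M)" by auto
  ultimately show "emeasure (distr M N W) A * emeasure (distr M borel Y) B
      = emeasure (distr M (N \<Otimes>\<^sub>M borel) (\<lambda>\<omega>. (W \<omega>, Y \<omega>))) (A \<times> B)"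
    by (simp add: emeasure_distr emeasure_eq_measure ennreal_mult)
qed

text \<open>Rescaling by \<open>sqrt v\<close> reduces this to the uniqueness of the standard normal
  law.\<close>

lemma distributed_normal_if_char:
  assumes Y [measurable]: "Y \<in> borel_measurable M" and v: "v > 0"
    and char: "\<And>\<theta>. char (distr M borel Y) \<theta> = complex_of_real (exp (- (\<theta>\<^sup>2 * v / 2)))"
  shows "distributed M lborel Y (normal_density 0 (sqrt v))"
proof -
  have "char (distr M borel (\<lambda>\<omega>. Y \<omega> / sqrt v)) = char std_normal_distribution"
  proof
    fix \<theta>
    have "char (distr M borel (\<lambda>\<omega>. Y \<omega> / sqrt v)) \<theta> = char (distr M borel Y) (\<theta> / sqrt v)"
      unfolding char_def by (simp add: integral_distr)
    then show "char (distr M borel (\<lambda>\<omega>. Y \<omega> / sqrt v)) \<theta> = char std_normal_distribution \<theta>"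
      using v by (simp add: char char_std_normal_distribution power_divide)
  qed
  moreover have "real_distribution (distr M borel (\<lambda>\<omega>. Y \<omega> / sqrt v))"
    by (intro real_distribution_distr) simp
  ultimately have "distr M borel (\<lambda>\<omega>. Y \<omega> / sqrt v) = std_normal_distribution"
    using real_dist_normal_dist by (intro Levy_uniqueness) auto
  moreover have "distr M lborel (\<lambda>\<omega>. Y \<omega> / sqrt v) = distr M borel (\<lambda>\<omega>. Y \<omega> / sqrt v)"
    by (intro distr_cong) auto
  ultimately have "distributed M lborel (\<lambda>\<omega>. Y \<omega> / sqrt v) std_normal_density"
    by (simp add: distributed_def)
  then show ?thesis using normal_standard_normal_convert[of "sqrt v" Y 0] v by simp
qed

lemma AE_zero_if_char:
  assumes Y [measurable]: "Y \<in> borel_measurable M"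
    and char: "\<And>\<theta>. char (distr M borel Y) \<theta> = 1"
  shows "AE \<omega> in M. Y \<omega> = 0"
proof -
  have "real_distribution (return borel (0::real))"
    by (intro real_distribution.intro real_distribution_axioms.intro prob_space_return) auto
  moreover have "real_distribution (distr M borel Y)" by (intro real_distribution_distr) simp
  moreover have "char (distr M borel Y) = char (return borel 0)"
    by (rule ext) (simp add: char, simp add: char_def integral_return)
  ultimately have *: "distr M borel Y = return borel 0" by (intro Levy_uniqueness)
  have "AE x in distr M borel Y. x = 0" unfolding * by (simp add: AE_return)
  then show ?thesis by (simp add: AE_distr_iff)
qed

lemma normal_square_integrable:
  assumes v: "v > 0" and D: "distributed M lborel Y (normal_density m (sqrt v))"
  shows "integrable M Y" "integrable M (\<lambda>\<omega>. (Y \<omega>)\<^sup>2)" "expectation Y = m" "expectation (\<lambda>\<omega>. (Y \<omega> - m)\<^sup>2) = v"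
proof -
  have s: "0 < sqrt v" using v by simp
  have i1: "integrable M Y"
    using integrable_normal_moment_nz_1[OF s, of m] distributed_integrable[OF D, of "\<lambda>x. x"] by simp
  have i2: "integrable M (\<lambda>\<omega>. (Y \<omega> - m)\<^sup>2)"
    using integrable_normal_moment[OF s, of m 2] distributed_integrable[OF D, of "\<lambda>x. (x - m)\<^sup>2"] by simp
  have "integrable M (\<lambda>\<omega>. (Y \<omega> - m)\<^sup>2 + 2 * m * Y \<omega> - m\<^sup>2)"
    using i1 i2 by auto
  then show "integrable M (\<lambda>\<omega>. (Y \<omega>)\<^sup>2)" by (simp add: power2_diff algebra_simps)
  show "integrable M Y" by fact
  show e: "expectation Y = m" by (rule normal_distributed_expectation[OF s D])
  show "expectation (\<lambda>\<omega>. (Y \<omega> - m)\<^sup>2) = v"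
    using normal_distributed_variance[OF s D] v e by simp
qed

text \<open>A point mass has no density, so variance 0 is split off, just as in
  \<open>gaussian_variable\<close>.\<close>

lemma indep_gaussian_cases:
  assumes G: "subalgebra M G" and Y: "indep_gaussian M G Y v"
  obtains "v = 0" "AE \<omega> in M. Y \<omega> = 0"
  | "v > 0" "distributed M lborel Y (normal_density 0 (sqrt v))"
  using indep_gaussianD(2)[OF Y] indep_gaussian_char[OF G Y]
    AE_zero_if_char[OF indep_gaussianD(1)[OF Y]] distributed_normal_if_char[OF indep_gaussianD(1)[OF Y]]
  by (cases "v = 0") auto

lemma indep_gaussian_moments:
  assumes G: "subalgebra M G" and Y: "indep_gaussian M G Y v"
  shows "integrable M Y" "integrable M (\<lambda>\<omega>. (Y \<omega>)\<^sup>2)" "expectation Y = 0" "expectation (\<lambda>\<omega>. (Y \<omega>)\<^sup>2) = v"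
proof -
  have [measurable]: "Y \<in> borel_measurable M" using Y by (rule indep_gaussianD)
  have "integrable M Y \<and> integrable M (\<lambda>\<omega>. (Y \<omega>)\<^sup>2) \<and> expectation Y = 0 \<and> expectation (\<lambda>\<omega>. (Y \<omega>)\<^sup>2) = v"
    using G Y
  proof (cases rule: indep_gaussian_cases)
    case 1
    then have "integrable M Y" "integrable M (\<lambda>\<omega>. (Y \<omega>)\<^sup>2)"
      by (auto intro!: integrable_cong_AE_imp[of M "\<lambda>_. 0::real"])
    moreover have "expectation Y = 0" "expectation (\<lambda>\<omega>. (Y \<omega>)\<^sup>2) = 0"
      using 1 by (auto intro!: integral_eq_zero_AE)
    ultimately show ?thesis using 1 by simp
  next
    case 2
    from normal_square_integrable[OF this] show ?thesis by simp
  qed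
  then show "integrable M Y" "integrable M (\<lambda>\<omega>. (Y \<omega>)\<^sup>2)" "expectation Y = 0" "expectation (\<lambda>\<omega>. (Y \<omega>)\<^sup>2) = v" by auto
qed

lemma indep_gaussian_gaussian_variable:
  assumes G: "subalgebra M G" and Y: "indep_gaussian M G Y v"
  shows "gaussian_variable M (\<lambda>\<omega>. m + Y \<omega>)"
  using G Y
proof (cases rule: indep_gaussian_cases)
  case 1
  then show ?thesis using indep_gaussianD(1)[OF Y] by (auto simp: gaussian_variable_def)
next
  case 2
  have "distributed M lborel (\<lambda>\<omega>. m + 1 * Y \<omega>) (normal_density (m + 1 * 0) (\<bar>1\<bar> * sqrt v))"
    using 2 by (intro normal_density_affine) auto
  with 2 show ?thesis using indep_gaussianD(1)[OF Y] by (auto simp: gaussian_variable_def)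
qed

lemma indep_gaussian_0:
  assumes "subalgebra M G"
  shows "indep_gaussian M G (\<lambda>\<omega>. 0) 0"
proof -
  have "(\<integral>\<omega>. indicator C \<omega> *\<^sub>R iexp (\<theta> * 0) \<partial>M) = complex_of_real (prob C)" if "C \<in> sets G" for C \<theta>
  proof -
    have "C \<in> events" using that assms by (auto simp: subalgebra_def)
    then show ?thesis by (simp add: scaleR_conv_of_real)
  qed
  then show ?thesis by (simp add: indep_gaussian_def)
qed

lemma indep_gaussian_scale:
  assumes "indep_gaussian M G Y v"
  shows "indep_gaussian M G (\<lambda>\<omega>. a * Y \<omega>) (a\<^sup>2 * v)"
  unfolding indep_gaussian_def
proof (intro conjI ballI allI)
  show "(\<lambda>\<omega>. a * Y \<omega>) \<in> borel_measurable M" using indep_gaussianD(1)[OF assms] by simp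
  show "0 \<le> a\<^sup>2 * v" using indep_gaussianD(2)[OF assms] by simp
  fix C \<theta> assume "C \<in> sets G"
  from indep_gaussianD(3)[OF assms this, of "\<theta> * a"]
  show "(\<integral>\<omega>. indicator C \<omega> *\<^sub>R iexp (\<theta> * (a * Y \<omega>)) \<partial>M) = complex_of_real (prob C * exp (- (\<theta>\<^sup>2 * (a\<^sup>2 * v) / 2)))"
    by (simp add: mult_ac power_mult_distrib)
qed

text \<open>The indicator of \<open>C\<close> times \<open>iexp (\<theta> * Y \<omega>)\<close> is
  measurable with respect to \<open>G'\<close>, hence independent of \<open>Y'\<close>; the integral
  factorises and the exponents add.\<close>

lemma indep_gaussian_add:
  assumes G: "subalgebra M G'" "subalgebra G' G"
    and Y: "indep_gaussian M G Y v" "Y \<in> borel_measurable G'" and Y': "indep_gaussian M G' Y' v'"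
  shows "indep_gaussian M G (\<lambda>\<omega>. Y \<omega> + Y' \<omega>) (v + v')"
  unfolding indep_gaussian_def
proof (intro conjI ballI allI)
  have [measurable]: "Y \<in> borel_measurable M" "Y' \<in> borel_measurable M"
    using Y Y' by (auto dest: indep_gaussianD)
  show "(\<lambda>\<omega>. Y \<omega> + Y' \<omega>) \<in> borel_measurable M" by measurable
  show "0 \<le> v + v'" using indep_gaussianD(2)[OF Y(1)] indep_gaussianD(2)[OF Y'] by simp
  fix C \<theta> assume C: "C \<in> sets G"
  then have C': "C \<in> sets G'" using G(2) by (auto simp: subalgebra_def)
  then have [measurable]: "C \<in> sets M" using G(1) by (auto simp: subalgebra_def)
  define W where "W \<omega> = indicat_real C \<omega> *\<^sub>R iexp (\<theta> * Y \<omega>)" for \<omega>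
  have W: "W \<in> borel_measurable G'" unfolding W_def using C' Y(2) by measurable
  have ind: "indep_var borel W borel (\<lambda>\<omega>. iexp (\<theta> * Y' \<omega>))"
    by (rule indep_gaussian_indep_var[OF G(1) Y' W]) auto
  have "integrable M W" unfolding W_def by (rule integrable_scaleR_iexp[where c=1]) auto
  moreover have "integrable M (\<lambda>\<omega>. iexp (\<theta> * Y' \<omega>))"
    using integrable_scaleR_iexp[of "\<lambda>_. 1" 1 Y' \<theta>] by simp
  ultimately have "(\<integral>\<omega>. W \<omega> * iexp (\<theta> * Y' \<omega>) \<partial>M) = (\<integral>\<omega>. W \<omega> \<partial>M) * (\<integral>\<omega>. iexp (\<theta> * Y' \<omega>) \<partial>M)"
    by (intro indep_var_lebesgue_integral ind)
  moreover have "(\<integral>\<omega>. iexp (\<theta> * Y' \<omega>) \<partial>M) = char (distr M borel Y') \<theta>"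
    unfolding char_def by (simp add: integral_distr)
  ultimately have "(\<integral>\<omega>. W \<omega> * iexp (\<theta> * Y' \<omega>) \<partial>M) = complex_of_real (prob C * exp (- (\<theta>\<^sup>2 * v / 2))) * exp (- (\<theta>\<^sup>2 * v' / 2))"
    using indep_gaussianD(3)[OF Y(1) C] indep_gaussian_char[OF G(1) Y'] by (simp add: W_def)
  moreover have "W \<omega> * iexp (\<theta> * Y' \<omega>) = indicator C \<omega> *\<^sub>R iexp (\<theta> * (Y \<omega> + Y' \<omega>))" for \<omega>
    by (simp add: W_def exp_add distrib_left)
  moreover have "exp (- (\<theta>\<^sup>2 * v / 2)) * exp (- (\<theta>\<^sup>2 * v' / 2)) = exp (- (\<theta>\<^sup>2 * (v + v') / 2))"
    for \<theta> :: real
    by (simp only: exp_add[symmetric]) (simp add: field_simps)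
  then have "complex_of_real (prob C * exp (- (\<theta>\<^sup>2 * v / 2))) * exp (- (\<theta>\<^sup>2 * v' / 2))
     = complex_of_real (prob C * exp (- (\<theta>\<^sup>2 * (v + v') / 2)))"
    by (simp only: of_real_mult[symmetric] mult.assoc)
  ultimately show "(\<integral>\<omega>. indicator C \<omega> *\<^sub>R iexp (\<theta> * (Y \<omega> + Y' \<omega>)) \<partial>M) = complex_of_real (prob C * exp (- (\<theta>\<^sup>2 * (v + v') / 2)))"
    by simp
qed

lemma indep_gaussian_AE_limit:
  assumes G: "subalgebra M G" and Y: "\<And>n. indep_gaussian M G (Y n) (v n)"
    and lim: "AE \<omega> in M. (\<lambda>n. Y n \<omega>) \<longlonglongrightarrow> Z \<omega>" and Z [measurable]: "Z \<in> borel_measurable M"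
    and v: "v \<longlonglongrightarrow> u"
  shows "indep_gaussian M G Z u"
  unfolding indep_gaussian_def
proof (intro conjI ballI allI)
  have [measurable]: "Y n \<in> borel_measurable M" for n using Y by (rule indep_gaussianD)
  show "Z \<in> borel_measurable M" by measurable
  show "0 \<le> u" using v indep_gaussianD(2)[OF Y] by (intro LIMSEQ_le_const) auto
  fix C \<theta> assume C: "C \<in> sets G"
  then have [measurable]: "C \<in> sets M" using G by (auto simp: subalgebra_def)
  have "(\<lambda>n. \<integral>\<omega>. indicator C \<omega> *\<^sub>R iexp (\<theta> * Y n \<omega>) \<partial>M) \<longlonglongrightarrow> (\<integral>\<omega>. indicator C \<omega> *\<^sub>R iexp (\<theta> * Z \<omega>) \<partial>M)"
  proof (rule integral_dominated_convergence[where w="\<lambda>_. 1"])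
    show "AE \<omega> in M. (\<lambda>n. indicator C \<omega> *\<^sub>R iexp (\<theta> * Y n \<omega>)) \<longlonglongrightarrow> indicator C \<omega> *\<^sub>R iexp (\<theta> * Z \<omega>)"
      using lim by eventually_elim (intro tendsto_intros)
  qed (auto simp: indicator_def)
  moreover have "(\<lambda>n. complex_of_real (prob C * exp (- (\<theta>\<^sup>2 * v n / 2)))) \<longlonglongrightarrow> complex_of_real (prob C * exp (- (\<theta>\<^sup>2 * u / 2)))"
    by (intro tendsto_intros v) simp
  ultimately show "(\<integral>\<omega>. indicator C \<omega> *\<^sub>R iexp (\<theta> * Z \<omega>) \<partial>M) = complex_of_real (prob C * exp (- (\<theta>\<^sup>2 * u / 2)))"
    unfolding indep_gaussianD(3)[OF Y C] by (rule LIMSEQ_unique)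
qed

end

section \<open>The Ito isometry\<close>

lemma sum_product_square:
  fixes f :: "'i \<Rightarrow> real"
  shows "(\<Sum>k\<in>K. f k)\<^sup>2 = (\<Sum>k\<in>K. \<Sum>l\<in>K. f k * f l)"
  by (simp add: power2_eq_square sum_product)

lemma measure_Ioc_Int:
  assumes "s \<le> u" "s \<le> t" "u \<le> (v::real)"
  shows "measure lborel ({s<..t} \<inter> {u<..v}) = max 0 (min t v - u)"
proof -
  have "{s<..t} \<inter> {u<..v} = {u<..min t v}" using assms by auto
  then show ?thesis by (cases "u \<le> min t v") (auto simp: max_def)
qed

lemma ennreal_square_add_le:
  "ennreal ((x + y)\<^sup>2) \<le> 2 * ennreal (x\<^sup>2) + 2 * ennreal (y\<^sup>2)" for x y :: real
proof -
  have "(x + y)\<^sup>2 \<le> 2 * x\<^sup>2 + 2 * y\<^sup>2"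
    using sum_squares_ge_zero[of "x - y" 0] by (simp add: power2_eq_square algebra_simps)
  then have "ennreal ((x + y)\<^sup>2) \<le> ennreal (2 * x\<^sup>2 + 2 * y\<^sup>2)" by (rule ennreal_leI)
  then show ?thesis by (simp add: ennreal_plus ennreal_mult)
qed

context prob_space begin

text \<open>Independence of \<open>W\<close> from \<open>Y\<close> and from its square factorises
  the expectations, so integrability of \<open>W\<close> is enough.\<close>

lemma indep_gaussian_orthogonal:
  fixes W Y :: "'a \<Rightarrow> real"
  assumes G: "subalgebra M G" and Y: "indep_gaussian M G Y v"
    and W: "W \<in> borel_measurable G" "integrable M W"
  shows "integrable M (\<lambda>\<omega>. W \<omega> * Y \<omega>)" "expectation (\<lambda>\<omega>. W \<omega> * Y \<omega>) = 0"
    "integrable M (\<lambda>\<omega>. W \<omega> * (Y \<omega>)\<^sup>2)" "expectation (\<lambda>\<omega>. W \<omega> * (Y \<omega>)\<^sup>2) = expectation W * v"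
proof -
  note m = indep_gaussian_moments[OF G Y]
  have 1: "indep_var borel W borel (\<lambda>\<omega>. Y \<omega>)" and 2: "indep_var borel W borel (\<lambda>\<omega>. (Y \<omega>)\<^sup>2)"
    by (rule indep_gaussian_indep_var[OF G Y W(1)]; simp)+
  show "integrable M (\<lambda>\<omega>. W \<omega> * Y \<omega>)" "integrable M (\<lambda>\<omega>. W \<omega> * (Y \<omega>)\<^sup>2)"
    using indep_var_integrable[OF 1 W(2) m(1)] indep_var_integrable[OF 2 W(2) m(2)] by auto
  show "expectation (\<lambda>\<omega>. W \<omega> * Y \<omega>) = 0" "expectation (\<lambda>\<omega>. W \<omega> * (Y \<omega>)\<^sup>2) = expectation W * v"
    using indep_var_lebesgue_integral[OF 1 W(2) m(1)] indep_var_lebesgue_integral[OF 2 W(2) m(2)] m by auto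
qed

end

section \<open>The filtration and sums of successive increments\<close>

context filtered_prob_space begin

lemma F_space: "t \<in> {0..1} \<Longrightarrow> space (F t) = space M"
  using subalg by (auto simp: subalgebra_def)

lemma F_subalgebra: "0 \<le> s \<Longrightarrow> s \<le> t \<Longrightarrow> t \<le> 1 \<Longrightarrow> subalgebra (F t) (F s)"
  using filt_mono[of s t] F_space[of s] F_space[of t] by (auto simp: subalgebra_def)

lemma F_measurable_mono:
  "X \<in> F s \<rightarrow>\<^sub>M N \<Longrightarrow> 0 \<le> s \<Longrightarrow> s \<le> t \<Longrightarrow> t \<le> 1 \<Longrightarrow> X \<in> F t \<rightarrow>\<^sub>M N"
  using F_subalgebra[of s t] by (auto intro: measurable_from_subalg)

lemma F_measurable_M:
  "X \<in> F s \<rightarrow>\<^sub>M N \<Longrightarrow> 0 \<le> s \<Longrightarrow> s \<le> 1 \<Longrightarrow> X \<in> M \<rightarrow>\<^sub>M N"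
  using subalg[of s] by (auto intro: measurable_from_subalg)

text \<open>The induction adds an increment independent of \<open>F (p n)\<close> to a sum that must
  be measurable there; hence measurability and \<open>p 0 \<le> p n\<close> are carried along in the
  conclusion.\<close>

lemma indep_gaussian_increment_sum:
  assumes p: "0 \<le> p 0" "\<And>i. i < n \<Longrightarrow> p i \<le> p (Suc i)" "p n \<le> (1::real)"
    and Y: "\<And>i. i \<le> n \<Longrightarrow> Y (p i) \<in> borel_measurable (F (p i))"
    and inc: "\<And>i. i < n \<Longrightarrow> indep_gaussian M (F (p i)) (\<lambda>\<omega>. Y (p (Suc i)) \<omega> - Y (p i) \<omega>) (W (p (Suc i)) - W (p i))"
  shows "indep_gaussian M (F (p 0)) (\<lambda>\<omega>. \<Sum>i<n. c i * (Y (p (Suc i)) \<omega> - Y (p i) \<omega>))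
    (\<Sum>i<n. (c i)\<^sup>2 * (W (p (Suc i)) - W (p i)))
    \<and> (\<lambda>\<omega>. \<Sum>i<n. c i * (Y (p (Suc i)) \<omega> - Y (p i) \<omega>)) \<in> borel_measurable (F (p n)) \<and> p 0 \<le> p n"
  using p Y inc
proof (induction n)
  case 0
  then show ?case using indep_gaussian_0[of "F (p 0)"] subalg[of "p 0"] by auto
next
  case (Suc n)
  have le: "p n \<le> p (Suc n)" "p (Suc n) \<le> 1" using Suc.prems by auto
  have IH: "indep_gaussian M (F (p 0)) (\<lambda>\<omega>. \<Sum>i<n. c i * (Y (p (Suc i)) \<omega> - Y (p i) \<omega>))
    (\<Sum>i<n. (c i)\<^sup>2 * (W (p (Suc i)) - W (p i)))"
    "(\<lambda>\<omega>. \<Sum>i<n. c i * (Y (p (Suc i)) \<omega> - Y (p i) \<omega>)) \<in> borel_measurable (F (p n))" "p 0 \<le> p n"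
    using Suc.IH Suc.prems le by auto
  have 0: "0 \<le> p n" using IH(3) Suc.prems(1) by simp
  have "indep_gaussian M (F (p 0)) (\<lambda>\<omega>. (\<Sum>i<n. c i * (Y (p (Suc i)) \<omega> - Y (p i) \<omega>))
      + c n * (Y (p (Suc n)) \<omega> - Y (p n) \<omega>))
    ((\<Sum>i<n. (c i)\<^sup>2 * (W (p (Suc i)) - W (p i))) + (c n)\<^sup>2 * (W (p (Suc n)) - W (p n)))"
    using 0 le IH(3) Suc.prems(1)
    by (intro indep_gaussian_add[where G'="F (p n)"] indep_gaussian_scale Suc.prems IH subalg F_subalgebra) auto
  moreover have "(\<lambda>\<omega>. (\<Sum>i<n. c i * (Y (p (Suc i)) \<omega> - Y (p i) \<omega>))
      + c n * (Y (p (Suc n)) \<omega> - Y (p n) \<omega>)) \<in> borel_measurable (F (p (Suc n)))"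
    using F_measurable_mono[OF IH(2) 0 le] F_measurable_mono[OF Suc.prems(4)[of n] 0 le]
      Suc.prems(4)[of "Suc n"]
    by (intro borel_measurable_add borel_measurable_times borel_measurable_diff borel_measurable_const) auto
  ultimately show ?case using IH(3) le by simp
qed

lemma indep_gaussian_upart_sum:
  assumes st: "0 \<le> s" "s \<le> t" "t \<le> 1"
    and Y: "\<And>r. s \<le> r \<Longrightarrow> r \<le> t \<Longrightarrow> Y r \<in> borel_measurable (F r)"
    and inc: "\<And>a b. s \<le> a \<Longrightarrow> a \<le> b \<Longrightarrow> b \<le> t \<Longrightarrow> indep_gaussian M (F a) (\<lambda>\<omega>. Y b \<omega> - Y a \<omega>) (W b - W a)"
  shows "indep_gaussian M (F s)
      (\<lambda>\<omega>. \<Sum>i<Suc n. f (upart s t n i) * (Y (upart s t n (Suc i)) \<omega> - Y (upart s t n i) \<omega>))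
      (\<Sum>i<Suc n. (f (upart s t n i))\<^sup>2 * (W (upart s t n (Suc i)) - W (upart s t n i)))"
    "(\<lambda>\<omega>. \<Sum>i<Suc n. f (upart s t n i) * (Y (upart s t n (Suc i)) \<omega> - Y (upart s t n i) \<omega>)) \<in> borel_measurable (F t)"
proof -
  let ?p = "upart s t n"
  have p: "s \<le> ?p i" "?p i \<le> t" if "i \<le> Suc n" for i using upart_bounds[OF st(2) that] by auto
  have m: "?p i \<le> ?p (Suc i)" for i by (rule upart_mono[OF st(2)]) simp
  have "indep_gaussian M (F (?p 0)) (\<lambda>\<omega>. \<Sum>i<Suc n. f (?p i) * (Y (?p (Suc i)) \<omega> - Y (?p i) \<omega>))
    (\<Sum>i<Suc n. (f (?p i))\<^sup>2 * (W (?p (Suc i)) - W (?p i)))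
    \<and> (\<lambda>\<omega>. \<Sum>i<Suc n. f (?p i) * (Y (?p (Suc i)) \<omega> - Y (?p i) \<omega>)) \<in> borel_measurable (F (?p (Suc n)))
    \<and> ?p 0 \<le> ?p (Suc n)"
    using st by (intro indep_gaussian_increment_sum Y inc p m) auto
  then show "indep_gaussian M (F s) (\<lambda>\<omega>. \<Sum>i<Suc n. f (?p i) * (Y (?p (Suc i)) \<omega> - Y (?p i) \<omega>))
      (\<Sum>i<Suc n. (f (?p i))\<^sup>2 * (W (?p (Suc i)) - W (?p i)))"
    "(\<lambda>\<omega>. \<Sum>i<Suc n. f (?p i) * (Y (?p (Suc i)) \<omega> - Y (?p i) \<omega>)) \<in> borel_measurable (F t)"
    by (simp_all del: sum.lessThan_Suc)
qed

end

section \<open>Brownian increments and the isometry for simple integrands\<close>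

locale filtered_brownian_motion = filtered_prob_space M F
  for M :: "'w measure" and F :: "real \<Rightarrow> 'w measure" +
  fixes B :: "real \<Rightarrow> 'w \<Rightarrow> real"
  assumes bm: "brownian_motion M F B"
begin

lemma B_adapted: "0 \<le> t \<Longrightarrow> t \<le> 1 \<Longrightarrow> B t \<in> borel_measurable (F t)"
  using bm by (auto simp: brownian_motion_def adapted_on_def)

lemma B_measurable_mono: "0 \<le> s \<Longrightarrow> s \<le> t \<Longrightarrow> t \<le> 1 \<Longrightarrow> B s \<in> borel_measurable (F t)"
  using F_measurable_mono[OF B_adapted] by auto

text \<open>Translates the density and the independent sigma-algebras of
  \<open>brownian_motion\<close> into characteristic functions tested on the events of
  \<open>F s\<close>. The case \<open>s = t\<close>, on which \<open>brownian_motion\<close> is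
  silent, has variance 0.\<close>

lemma B_increment:
  assumes "0 \<le> s" "s \<le> t" "t \<le> 1"
  shows "indep_gaussian M (F s) (\<lambda>\<omega>. B t \<omega> - B s \<omega>) (t - s)"
proof (cases "s = t")
  case True
  then show ?thesis using indep_gaussian_0[of "F s"] subalg[of s] assms by simp
next
  case False
  with assms have st: "s < t" by simp
  define Y where "Y \<omega> = B t \<omega> - B s \<omega>" for \<omega>
  have D: "distributed M lborel Y (normal_density 0 (sqrt (t - s)))"
    and ind: "indep_set (sets (F s)) (sets (vimage_algebra (space M) Y borel))"
    using bm st assms unfolding brownian_motion_def Y_def by auto
  have [measurable]: "B t \<in> borel_measurable M" "B s \<in> borel_measurable M"
    using F_measurable_M[OF B_adapted] assms by auto
  have [measurable]: "Y \<in> borel_measurable M" unfolding Y_def by measurable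
  have "distributed M lborel (\<lambda>\<omega>. Y \<omega> / sqrt (t - s)) std_normal_density"
    using normal_standard_normal_convert[of "sqrt (t - s)" Y 0] D st by simp
  moreover have "distr M lborel (\<lambda>\<omega>. Y \<omega> / sqrt (t - s)) = distr M borel (\<lambda>\<omega>. Y \<omega> / sqrt (t - s))"
    by (intro distr_cong) auto
  ultimately have "distr M borel (\<lambda>\<omega>. Y \<omega> / sqrt (t - s)) = std_normal_distribution"
    by (simp add: distributed_def)
  then have ch: "char (distr M borel (\<lambda>\<omega>. Y \<omega> / sqrt (t - s))) \<theta> = complex_of_real (exp (- \<theta>\<^sup>2 / 2))" for \<theta>
    by (simp add: char_std_normal_distribution)
  have chY: "(\<integral>\<omega>. iexp (\<theta> * Y \<omega>) \<partial>M) = complex_of_real (exp (- (\<theta>\<^sup>2 * (t - s) / 2)))" for \<theta>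
  proof -
    have "(\<integral>\<omega>. iexp (\<theta> * Y \<omega>) \<partial>M) = (\<integral>\<omega>. iexp ((\<theta> * sqrt (t - s)) * (Y \<omega> / sqrt (t - s))) \<partial>M)"
      using st by (intro Bochner_Integration.integral_cong) (simp_all add: field_simps)
    also have "\<dots> = char (distr M borel (\<lambda>\<omega>. Y \<omega> / sqrt (t - s))) (\<theta> * sqrt (t - s))"
      unfolding char_def by (subst integral_distr) auto
    also have "\<dots> = complex_of_real (exp (- (\<theta>\<^sup>2 * (t - s) / 2)))"
      unfolding ch using st by (simp add: power_mult_distrib)
    finally show ?thesis .
  qed
  have "(\<integral>\<omega>. indicator C \<omega> *\<^sub>R iexp (\<theta> * Y \<omega>) \<partial>M) = complex_of_real (prob C * exp (- (\<theta>\<^sup>2 * (t - s) / 2)))"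
    if C: "C \<in> sets (F s)" for C \<theta>
  proof -
    have C' [measurable]: "C \<in> events" using C subalg[of s] assms by (auto simp: subalgebra_def)
    have iv: "indep_var borel (\<lambda>\<omega>. complex_of_real (indicator C \<omega>)) borel (\<lambda>\<omega>. iexp (\<theta> * Y \<omega>))"
    proof (rule indep_varI)
      fix A A' :: "complex set" assume A: "A \<in> sets borel" "A' \<in> sets borel"
      have "(\<lambda>\<omega>. complex_of_real (indicator C \<omega>)) \<in> borel_measurable (F s)" using C by simp
      from measurable_sets[OF this A(1)]
      have 1: "(\<lambda>\<omega>. complex_of_real (indicator C \<omega>)) -` A \<inter> space M \<in> sets (F s)"
        using F_space[of s] assms by simp
      have "(\<lambda>y. iexp (\<theta> * y)) -` A' \<inter> space borel \<in> sets borel"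
        using A(2) by (intro measurable_sets[of _ borel borel]) auto
      then have "Y -` ((\<lambda>y. iexp (\<theta> * y)) -` A' \<inter> space borel) \<inter> space M \<in> sets (vimage_algebra (space M) Y borel)"
        by (rule in_vimage_algebra)
      moreover have "Y -` ((\<lambda>y. iexp (\<theta> * y)) -` A' \<inter> space borel) = (\<lambda>\<omega>. iexp (\<theta> * Y \<omega>)) -` A'"
        by auto
      ultimately have 2: "(\<lambda>\<omega>. iexp (\<theta> * Y \<omega>)) -` A' \<inter> space M \<in> sets (vimage_algebra (space M) Y borel)"
        by simp
      show "prob ((\<lambda>\<omega>. complex_of_real (indicator C \<omega>)) -` A \<inter> space M \<inter> ((\<lambda>\<omega>. iexp (\<theta> * Y \<omega>)) -` A' \<inter> space M))
        = prob ((\<lambda>\<omega>. complex_of_real (indicator C \<omega>)) -` A \<inter> space M) * prob ((\<lambda>\<omega>. iexp (\<theta> * Y \<omega>)) -` A' \<inter> space M)"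
        by (rule indep_setD[OF ind 1 2])
    qed auto
    have "integrable M (\<lambda>\<omega>. complex_of_real (indicator C \<omega>))"
      by (intro integrable_const_bound[where B=1]) (auto simp: indicator_def)
    moreover have "integrable M (\<lambda>\<omega>. iexp (\<theta> * Y \<omega>))"
      using integrable_scaleR_iexp[of "\<lambda>_. 1" 1 Y \<theta>] by simp
    ultimately have "(\<integral>\<omega>. complex_of_real (indicator C \<omega>) * iexp (\<theta> * Y \<omega>) \<partial>M)
        = (\<integral>\<omega>. complex_of_real (indicator C \<omega>) \<partial>M) * complex_of_real (exp (- (\<theta>\<^sup>2 * (t - s) / 2)))"
      using indep_var_lebesgue_integral[OF iv] by (simp only: chY)
    then show ?thesis by (simp add: scaleR_conv_of_real)
  qed
  then show ?thesis using st unfolding indep_gaussian_def Y_def[symmetric] by simp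
qed

text \<open>This is what \<open>simple_integrand\<close> demands of a single coefficient.\<close>

definition bounded_at :: "real \<Rightarrow> ('w \<Rightarrow> real) \<Rightarrow> bool" where
  "bounded_at s \<xi> \<longleftrightarrow> \<xi> \<in> borel_measurable (F s) \<and> (\<exists>C. \<forall>\<omega>\<in>space M. \<bar>\<xi> \<omega>\<bar> \<le> C)"

lemma bounded_at_times:
  assumes "bounded_at s \<xi>" "bounded_at s \<eta>" shows "bounded_at s (\<lambda>\<omega>. \<xi> \<omega> * \<eta> \<omega>)"
proof -
  obtain C D where "\<forall>\<omega>\<in>space M. \<bar>\<xi> \<omega>\<bar> \<le> C" "\<forall>\<omega>\<in>space M. \<bar>\<eta> \<omega>\<bar> \<le> D"
    using assms by (auto simp: bounded_at_def)
  then have "\<forall>\<omega>\<in>space M. \<bar>\<xi> \<omega> * \<eta> \<omega>\<bar> \<le> C * D"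
    unfolding abs_mult by (meson abs_ge_zero mult_mono order_trans)
  then show ?thesis using assms by (auto simp: bounded_at_def)
qed

lemma bounded_at_mono:
  "bounded_at s \<xi> \<Longrightarrow> 0 \<le> s \<Longrightarrow> s \<le> t \<Longrightarrow> t \<le> 1 \<Longrightarrow> bounded_at t \<xi>"
  unfolding bounded_at_def using F_measurable_mono by blast

lemma bounded_at_integrable_mult:
  assumes \<xi>: "bounded_at s \<xi>" "0 \<le> s" "s \<le> 1" and Y: "integrable M Y"
  shows "integrable M (\<lambda>\<omega>. \<xi> \<omega> * Y \<omega>)"
proof -
  obtain C where C: "\<forall>\<omega>\<in>space M. \<bar>\<xi> \<omega>\<bar> \<le> C" using \<xi> by (auto simp: bounded_at_def)
  have [measurable]: "\<xi> \<in> borel_measurable M" using \<xi> F_measurable_M by (auto simp: bounded_at_def)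
  have "integrable M (\<lambda>\<omega>. C * Y \<omega>)" using Y by simp
  then show ?thesis
  proof (rule Bochner_Integration.integrable_bound)
    show "AE \<omega> in M. norm (\<xi> \<omega> * Y \<omega>) \<le> norm (C * Y \<omega>)"
      using C by (intro AE_I2) (force simp: abs_mult intro!: mult_right_mono)
  qed (use Y in measurable)
qed

lemma bounded_at_integrable: "bounded_at s \<xi> \<Longrightarrow> 0 \<le> s \<Longrightarrow> s \<le> 1 \<Longrightarrow> integrable M \<xi>"
  using bounded_at_integrable_mult[of s \<xi> "\<lambda>_. 1"] by simp

text \<open>Cutting the increments at each other's endpoints leaves products over separated
  intervals, which have mean zero, and a square over the common part, whose length is
  \<open>max 0 (min t v - u)\<close>.\<close>

lemma B_product_aux:
  assumes \<zeta>: "bounded_at u \<zeta>" and le: "0 \<le> s" "s \<le> u" "u \<le> v" "v \<le> 1" "s \<le> t" "t \<le> 1"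
  shows "integrable M (\<lambda>\<omega>. \<zeta> \<omega> * (B t \<omega> - B s \<omega>) * (B v \<omega> - B u \<omega>)) \<and>
    expectation (\<lambda>\<omega>. \<zeta> \<omega> * (B t \<omega> - B s \<omega>) * (B v \<omega> - B u \<omega>)) = expectation \<zeta> * max 0 (min t v - u)"
proof -
  have orth: "integrable M (\<lambda>\<omega>. \<zeta> \<omega> * (B b \<omega> - B a \<omega>) * (B d \<omega> - B c \<omega>))"
    "expectation (\<lambda>\<omega>. \<zeta> \<omega> * (B b \<omega> - B a \<omega>) * (B d \<omega> - B c \<omega>)) = 0"
    if "0 \<le> a" "a \<le> b" "b \<le> c" "u \<le> c" "c \<le> d" "d \<le> 1" for a b c d
  proof -
    have z: "bounded_at c \<zeta>" using bounded_at_mono[OF \<zeta>] that le by auto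
    have i: "integrable M (\<lambda>\<omega>. B b \<omega> - B a \<omega>)"
      using indep_gaussian_moments(1)[OF subalg B_increment[of a b]] that by auto
    have *: "(\<lambda>\<omega>. \<zeta> \<omega> * (B b \<omega> - B a \<omega>)) \<in> borel_measurable (F c)"
      using z that by (intro borel_measurable_times borel_measurable_diff B_measurable_mono) (auto simp: bounded_at_def)
    show "integrable M (\<lambda>\<omega>. \<zeta> \<omega> * (B b \<omega> - B a \<omega>) * (B d \<omega> - B c \<omega>))"
      "expectation (\<lambda>\<omega>. \<zeta> \<omega> * (B b \<omega> - B a \<omega>) * (B d \<omega> - B c \<omega>)) = 0"
      by (rule indep_gaussian_orthogonal(1,2)[OF subalg B_increment *];
        use that bounded_at_integrable_mult[OF z] i in auto)+
  qed
  have sq: "integrable M (\<lambda>\<omega>. \<zeta> \<omega> * (B d \<omega> - B u \<omega>)\<^sup>2)"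
    "expectation (\<lambda>\<omega>. \<zeta> \<omega> * (B d \<omega> - B u \<omega>)\<^sup>2) = expectation \<zeta> * (d - u)"
    if "u \<le> d" "d \<le> 1" for d
    by (rule indep_gaussian_orthogonal(3,4)[OF subalg B_increment];
      use le that \<zeta> bounded_at_integrable[OF \<zeta>] in \<open>auto simp: bounded_at_def\<close>)+
  consider "t \<le> u" | "u \<le> t" "t \<le> v" | "v \<le> t" by linarith
  then show ?thesis
  proof cases
    case 1
    then show ?thesis using orth[of s t u v] le by (simp add: max_def)
  next
    case 2
    have eq: "\<zeta> \<omega> * (B t \<omega> - B s \<omega>) * (B v \<omega> - B u \<omega>) =
      \<zeta> \<omega> * (B u \<omega> - B s \<omega>) * (B v \<omega> - B u \<omega>) + \<zeta> \<omega> * (B t \<omega> - B u \<omega>)\<^sup>2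
        + \<zeta> \<omega> * (B t \<omega> - B u \<omega>) * (B v \<omega> - B t \<omega>)" for \<omega>
      by (simp add: power2_eq_square algebra_simps)
    show ?thesis unfolding eq
      using orth[of s u u v] orth[of u t t v] sq[of t] 2 le by (simp add: max_def min_def)
  next
    case 3
    have eq: "\<zeta> \<omega> * (B t \<omega> - B s \<omega>) * (B v \<omega> - B u \<omega>) =
      \<zeta> \<omega> * (B u \<omega> - B s \<omega>) * (B v \<omega> - B u \<omega>) + \<zeta> \<omega> * (B v \<omega> - B u \<omega>)\<^sup>2
        + \<zeta> \<omega> * (B v \<omega> - B u \<omega>) * (B t \<omega> - B v \<omega>)" for \<omega>
      by (simp add: power2_eq_square algebra_simps)
    show ?thesis unfolding eq
      using orth[of s u u v] orth[of u v v t] sq[of v] 3 le by (simp add: max_def min_def)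
  qed
qed

text \<open>The product of the coefficients is measurable at the later of the two left endpoints;
  which one that is distinguishes the two cases.\<close>

lemma B_product:
  assumes \<xi>: "bounded_at s \<xi>" "0 \<le> s" "s \<le> t" "t \<le> 1" and \<eta>: "bounded_at u \<eta>" "0 \<le> u" "u \<le> v" "v \<le> 1"
  shows "integrable M (\<lambda>\<omega>. (\<xi> \<omega> * (B t \<omega> - B s \<omega>)) * (\<eta> \<omega> * (B v \<omega> - B u \<omega>))) \<and>
    expectation (\<lambda>\<omega>. (\<xi> \<omega> * (B t \<omega> - B s \<omega>)) * (\<eta> \<omega> * (B v \<omega> - B u \<omega>)))
      = expectation (\<lambda>\<omega>. \<xi> \<omega> * \<eta> \<omega>) * measure lborel ({s<..t} \<inter> {u<..v})"
proof (cases "s \<le> u")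
  case True
  have "bounded_at u (\<lambda>\<omega>. \<xi> \<omega> * \<eta> \<omega>)"
    using bounded_at_times[OF bounded_at_mono[OF \<xi>(1)] \<eta>(1)] \<xi> \<eta> True by auto
  from B_product_aux[OF this, of s v t] show ?thesis
    using measure_Ioc_Int[of s u t v] True \<xi> \<eta> by (simp add: mult_ac)
next
  case False
  then have "bounded_at s (\<lambda>\<omega>. \<xi> \<omega> * \<eta> \<omega>)"
    using bounded_at_times[OF \<xi>(1) bounded_at_mono[OF \<eta>(1)]] \<xi> \<eta> by auto
  from B_product_aux[OF this, of u t v] show ?thesis
    using measure_Ioc_Int[of u s v t] False \<xi> \<eta> by (simp add: mult_ac Int_commute min.commute)
qed

text \<open>The intervals may overlap, a freedom used to subtract simple integrands over unrelated
  partitions. Both sides equal the same double sum: the expectation of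
  \<open>\<xi> k \<omega> * \<xi> l \<omega>\<close> times the length of the intersection of the two
  intervals.\<close>

lemma ito_isometry:
  fixes a b :: "'i \<Rightarrow> real"
  assumes K: "finite K" and \<xi>: "\<And>k. k \<in> K \<Longrightarrow> bounded_at (a k) (\<xi> k) \<and> 0 \<le> a k \<and> a k \<le> b k \<and> b k \<le> 1"
  shows "(\<integral>\<^sup>+\<omega>. ennreal ((\<Sum>k\<in>K. \<xi> k \<omega> * (B (b k) \<omega> - B (a k) \<omega>))\<^sup>2) \<partial>M)
    = (\<integral>\<^sup>+\<omega>. (\<integral>\<^sup>+s. ennreal ((\<Sum>k\<in>K. \<xi> k \<omega> * indicator {a k<..b k} s)\<^sup>2) \<partial>lborel) \<partial>M)"
proof -
  let ?m = "\<lambda>k l. measure lborel ({a k<..b k} \<inter> {a l<..b l})"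
  define Q where "Q \<omega> = (\<Sum>k\<in>K. \<Sum>l\<in>K. \<xi> k \<omega> * \<xi> l \<omega> * ?m k l)" for \<omega>
  have pr: "integrable M (\<lambda>\<omega>. (\<xi> k \<omega> * (B (b k) \<omega> - B (a k) \<omega>)) * (\<xi> l \<omega> * (B (b l) \<omega> - B (a l) \<omega>)))"
    "expectation (\<lambda>\<omega>. (\<xi> k \<omega> * (B (b k) \<omega> - B (a k) \<omega>)) * (\<xi> l \<omega> * (B (b l) \<omega> - B (a l) \<omega>)))
      = expectation (\<lambda>\<omega>. \<xi> k \<omega> * \<xi> l \<omega>) * ?m k l"
    if "k \<in> K" "l \<in> K" for k l
    using B_product[of "a k" "\<xi> k" "b k" "a l" "\<xi> l" "b l"] \<xi> that by auto
  have i2: "integrable M (\<lambda>\<omega>. \<xi> k \<omega> * \<xi> l \<omega>)" if "k \<in> K" "l \<in> K" for k l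
  proof -
    have "a k \<le> 1" "a l \<le> 1" using \<xi>[OF that(1)] \<xi>[OF that(2)] by linarith+
    then show ?thesis
      using \<xi>[OF that(1)] \<xi>[OF that(2)] by (intro bounded_at_integrable_mult[of "a k"] bounded_at_integrable[of "a l"]) auto
  qed
  have fin: "emeasure lborel ({a k<..b k} \<inter> {a l<..b l}) < \<infinity>" if "k \<in> K" for k l
  proof -
    have "emeasure lborel ({a k<..b k} \<inter> {a l<..b l}) \<le> emeasure lborel {a k<..b k}"
      by (intro emeasure_mono) auto
    also have "\<dots> < \<infinity>" using \<xi>[OF that] by simp
    finally show ?thesis .
  qed
  have "has_bochner_integral lborel (\<lambda>s. (\<Sum>k\<in>K. \<xi> k \<omega> * indicator {a k<..b k} s)\<^sup>2) (Q \<omega>)" for \<omega>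
  proof -
    have "has_bochner_integral lborel (\<lambda>s. \<Sum>k\<in>K. \<Sum>l\<in>K. (\<xi> k \<omega> * \<xi> l \<omega>) * indicator ({a k<..b k} \<inter> {a l<..b l}) s) (Q \<omega>)"
      unfolding Q_def using fin
      by (intro has_bochner_integral_sum has_bochner_integral_mult_right) (auto intro!: has_bochner_integral_real_indicator)
    then show ?thesis
      by (simp add: sum_product_square indicator_inter_arith mult_ac del: Int_greaterThanAtMost)
  qed
  note hb = this
  have inner: "(\<integral>\<^sup>+s. ennreal ((\<Sum>k\<in>K. \<xi> k \<omega> * indicator {a k<..b k} s)\<^sup>2) \<partial>lborel) = ennreal (Q \<omega>)" for \<omega>
    using hb[of \<omega>] by (subst nn_integral_eq_integral) (auto simp: has_bochner_integral_iff)
  have Q0: "0 \<le> Q \<omega>" for \<omega>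
    using hb[of \<omega>] Bochner_Integration.integral_nonneg[of lborel "\<lambda>s. (\<Sum>k\<in>K. \<xi> k \<omega> * indicator {a k<..b k} s)\<^sup>2"]
    by (simp add: has_bochner_integral_iff)
  have "has_bochner_integral M (\<lambda>\<omega>. (\<Sum>k\<in>K. \<xi> k \<omega> * (B (b k) \<omega> - B (a k) \<omega>))\<^sup>2)
     (\<Sum>k\<in>K. \<Sum>l\<in>K. expectation (\<lambda>\<omega>. \<xi> k \<omega> * \<xi> l \<omega>) * ?m k l)"
    unfolding sum_product_square using pr
    by (intro has_bochner_integral_sum) (auto simp: has_bochner_integral_iff)
  moreover have "has_bochner_integral M Q (\<Sum>k\<in>K. \<Sum>l\<in>K. expectation (\<lambda>\<omega>. \<xi> k \<omega> * \<xi> l \<omega>) * ?m k l)"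
    unfolding Q_def using i2
    by (intro has_bochner_integral_sum has_bochner_integral_mult_left) (auto simp: has_bochner_integral_iff)
  ultimately show ?thesis
    unfolding inner using Q0 by (subst (1 2) nn_integral_eq_integral) (auto simp: has_bochner_integral_iff)
qed

end

section \<open>Riemann sums for deterministic integrands\<close>

lemma step_sum_outside:
  assumes "mono p" and "x \<notin> {p 0<..p n}"
  shows "(\<Sum>i<n. c i * indicator {p i<..p (Suc i)} x) = (0::real)"
proof (rule sum.neutral, rule ballI)
  fix i assume i: "i \<in> {..<n}"
  have "p 0 \<le> p i" "p (Suc i) \<le> p n"
    using i assms(1) by (auto intro!: monoD[OF assms(1)])
  then show "c i * indicator {p i<..p (Suc i)} x = 0" using assms(2) by (auto simp: indicator_def)
qed

lemma step_sum_inside: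
  fixes p c :: "nat \<Rightarrow> real"
  assumes p: "mono p" and "x \<in> {p 0<..p n}"
  shows "\<exists>i<n. x \<in> {p i<..p (Suc i)} \<and> (\<Sum>i<n. c i * indicator {p i<..p (Suc i)} x) = c i"
  using assms(2)
proof (induction n)
  case (Suc n)
  show ?case
  proof (cases "x \<le> p n")
    case True
    then obtain i where "i < n" "x \<in> {p i<..p (Suc i)}" "(\<Sum>i<n. c i * indicator {p i<..p (Suc i)} x) = c i"
      using Suc by fastforce
    then show ?thesis using True by (intro exI[of _ i]) auto
  next
    case False
    then have "(\<Sum>i<n. c i * indicator {p i<..p (Suc i)} x) = 0"
      by (intro step_sum_outside p) auto
    then show ?thesis using False Suc.prems by (intro exI[of _ n]) auto
  qed
qed simp

lemma mono_upart: "s \<le> t \<Longrightarrow> mono (upart s t n)"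
  by (simp add: mono_def upart_mono)

text \<open>The blocks are half-open on the left, as in \<open>simple_process\<close>, while
  \<open>f\<close> is taken at the left endpoint; the value at \<open>s\<close> itself is 0.\<close>

definition riemann_step :: "(real \<Rightarrow> real) \<Rightarrow> real \<Rightarrow> real \<Rightarrow> nat \<Rightarrow> real \<Rightarrow> real" where
  "riemann_step f s t n x = (\<Sum>i<Suc n. f (upart s t n i) * indicator {upart s t n i<..upart s t n (Suc i)} x)"

lemma riemann_step_outside:
  "s \<le> t \<Longrightarrow> x \<notin> {s<..t} \<Longrightarrow> riemann_step f s t n x = 0"
  unfolding riemann_step_def by (rule step_sum_outside[OF mono_upart]) auto

lemma riemann_step_inside:
  assumes "s \<le> t" "x \<in> {s<..t}"
  obtains z where "z \<in> {s..t}" "\<bar>x - z\<bar> \<le> (t - s) / real (Suc n)" "riemann_step f s t n x = f z"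
proof -
  have "\<exists>i<Suc n. x \<in> {upart s t n i<..upart s t n (Suc i)} \<and> riemann_step f s t n x = f (upart s t n i)"
    unfolding riemann_step_def using assms
    by (intro step_sum_inside[OF mono_upart]) auto
  then obtain i where i: "i < Suc n" "x \<in> {upart s t n i<..upart s t n (Suc i)}" "riemann_step f s t n x = f (upart s t n i)"
    by blast
  show ?thesis
  proof (rule that[of "upart s t n i"])
    show "upart s t n i \<in> {s..t}" using upart_bounds[OF assms(1), of i n] i(1) by simp
    have "\<bar>x - upart s t n i\<bar> \<le> upart s t n (Suc i) - upart s t n i" using i(2) by simp
    then show "\<bar>x - upart s t n i\<bar> \<le> (t - s) / real (Suc n)" by (simp only: upart_step)
  qed (rule i(3))
qed

lemma riemann_step_uniform:
  assumes st: "s \<le> t" and f: "continuous_on {s..t} f" and \<epsilon>: "\<epsilon> > 0"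
  shows "\<forall>\<^sub>F n in sequentially. \<forall>x\<in>{s<..t}. \<bar>riemann_step f s t n x - f x\<bar> < \<epsilon>"
proof -
  have "uniformly_continuous_on {s..t} f" using f by (intro compact_uniformly_continuous) auto
  then obtain d where d: "d > 0" "\<And>x y. x \<in> {s..t} \<Longrightarrow> y \<in> {s..t} \<Longrightarrow> dist y x < d \<Longrightarrow> dist (f y) (f x) < \<epsilon>"
    using \<epsilon> unfolding uniformly_continuous_on_def by blast
  obtain n0 where n0: "(t - s) / d < real n0" using reals_Archimedean2 by blast
  have "\<bar>riemann_step f s t n x - f x\<bar> < \<epsilon>" if n: "n \<ge> n0" and x: "x \<in> {s<..t}" for n x
  proof -
    have "(t - s) / d < real (Suc n)" using n0 n by linarith
    then have mesh: "(t - s) / real (Suc n) < d" using d(1) by (simp add: field_simps del: of_nat_Suc)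
    obtain z where "z \<in> {s..t}" "\<bar>x - z\<bar> \<le> (t - s) / real (Suc n)" "riemann_step f s t n x = f z"
      using riemann_step_inside[OF st x] by blast
    then show ?thesis using d(2)[of x z] x mesh by (auto simp: dist_real_def abs_minus_commute)
  qed
  then show ?thesis unfolding eventually_sequentially by blast
qed

lemma tendsto_0_ennrealI:
  fixes f :: "nat \<Rightarrow> ennreal"
  assumes "\<And>\<epsilon>. \<epsilon> > 0 \<Longrightarrow> \<forall>\<^sub>F n in sequentially. f n \<le> ennreal \<epsilon>"
  shows "f \<longlonglongrightarrow> 0"
proof (rule order_tendstoI)
  fix a :: ennreal assume "0 < a"
  then obtain b where b: "0 < b" "b < a" using dense by blast
  then obtain r where r: "b = ennreal r" "0 \<le> r" by (cases b rule: ennreal_cases) auto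
  then have "0 < r" using b(1) by (cases "r = 0") auto
  from assms[OF this] show "\<forall>\<^sub>F n in sequentially. f n < a"
    by (rule eventually_mono) (use b(2) r(1) in auto)
qed simp

text \<open>Riemann step functions vanish at 0, where they need not approximate; this single point
  has measure zero, so the bound is asked for only off it.\<close>

lemma nn_integral_uniform_bound:
  fixes g :: "real \<Rightarrow> real"
  assumes "0 \<le> t" "t \<le> 1" "\<And>x. x \<in> {0<..t} \<Longrightarrow> \<bar>g x\<bar> \<le> \<delta>"
  shows "(\<integral>\<^sup>+x\<in>{0..t}. ennreal ((g x)\<^sup>2) \<partial>lborel) \<le> ennreal (\<delta>\<^sup>2)"
proof -
  have "(\<integral>\<^sup>+x\<in>{0..t}. ennreal ((g x)\<^sup>2) \<partial>lborel) \<le> (\<integral>\<^sup>+x. ennreal (\<delta>\<^sup>2) * indicator {0..t} x \<partial>lborel)"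
  proof (rule nn_integral_mono_AE)
    show "AE x in lborel. ennreal ((g x)\<^sup>2) * indicator {0..t} x \<le> ennreal (\<delta>\<^sup>2) * indicator {0..t} x"
      using AE_lborel_singleton[of 0]
    proof eventually_elim
      case (elim x)
      show ?case
      proof (cases "x \<in> {0..t}")
        case True
        then have "\<bar>g x\<bar> \<le> \<bar>\<delta>\<bar>" using assms(3)[of x] elim by auto
        then have "(g x)\<^sup>2 \<le> \<delta>\<^sup>2" by (simp add: abs_le_square_iff)
        then show ?thesis by (intro mult_right_mono ennreal_leI) auto
      qed simp
    qed
  qed
  also have "\<dots> = ennreal (\<delta>\<^sup>2) * ennreal t" using assms by (simp add: nn_integral_cmult_indicator)
  also have "\<dots> \<le> ennreal (\<delta>\<^sup>2) * 1" using assms by (intro mult_left_mono) auto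
  finally show ?thesis by simp
qed

lemma (in prob_space) L2_AE_subseq:
  fixes Y :: "nat \<Rightarrow> 'a \<Rightarrow> real"
  assumes [measurable]: "\<And>k. Y k \<in> borel_measurable M" "J \<in> borel_measurable M"
    and conv: "(\<lambda>k. \<integral>\<^sup>+\<omega>. ennreal ((Y k \<omega> - J \<omega>)\<^sup>2) \<partial>M) \<longlonglongrightarrow> 0"
  obtains r where "strict_mono r" "AE \<omega> in M. (\<lambda>k. Y (r k) \<omega>) \<longlonglongrightarrow> J \<omega>"
proof -
  \<comment> \<open>The first terms may have infinite second moment; from \<open>k0\<close> on the
    integrals are finite and ordinary \<open>L\<^sup>1\<close> convergence of the squares can be
    used.\<close>
  have "\<forall>\<^sub>F k in sequentially. (\<integral>\<^sup>+\<omega>. ennreal ((Y k \<omega> - J \<omega>)\<^sup>2) \<partial>M) < 1"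
    using conv by (rule order_tendstoD) simp
  then obtain k0 where k0: "\<And>k. k \<ge> k0 \<Longrightarrow> (\<integral>\<^sup>+\<omega>. ennreal ((Y k \<omega> - J \<omega>)\<^sup>2) \<partial>M) < 1"
    unfolding eventually_sequentially by blast
  have int: "integrable M (\<lambda>\<omega>. (Y (k + k0) \<omega> - J \<omega>)\<^sup>2)" for k
    using k0[of "k + k0"] by (intro integrableI_bounded) (auto intro: less_trans)
  have "(\<lambda>k. \<integral>\<^sup>+\<omega>. ennreal ((Y (k + k0) \<omega> - J \<omega>)\<^sup>2) \<partial>M) \<longlonglongrightarrow> 0"
    using conv by (rule LIMSEQ_ignore_initial_segment)
  then have "(\<lambda>k. ennreal (\<integral>\<omega>. norm ((Y (k + k0) \<omega> - J \<omega>)\<^sup>2) \<partial>M)) \<longlonglongrightarrow> ennreal 0"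
    using int by (simp add: nn_integral_eq_integral)
  then have "(\<lambda>k. \<integral>\<omega>. norm ((Y (k + k0) \<omega> - J \<omega>)\<^sup>2) \<partial>M) \<longlonglongrightarrow> 0"
    by (rule tendsto_ennrealD) auto
  from tendsto_L1_AE_subseq[OF int this]
  obtain r where r: "strict_mono r" "AE \<omega> in M. (\<lambda>k. (Y (r k + k0) \<omega> - J \<omega>)\<^sup>2) \<longlonglongrightarrow> 0" by blast
  have "AE \<omega> in M. (\<lambda>k. Y (r k + k0) \<omega>) \<longlonglongrightarrow> J \<omega>"
    using r(2)
  proof eventually_elim
    case (elim \<omega>)
    then have "(\<lambda>k. sqrt ((Y (r k + k0) \<omega> - J \<omega>)\<^sup>2)) \<longlonglongrightarrow> sqrt 0" by (rule tendsto_real_sqrt)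
    then have "(\<lambda>k. Y (r k + k0) \<omega> - J \<omega>) \<longlonglongrightarrow> 0" by (simp add: tendsto_rabs_zero_iff)
    then show ?case by (simp add: LIM_zero_iff)
  qed
  moreover have "strict_mono (\<lambda>k. r k + k0)" using r(1) by (simp add: strict_mono_def)
  ultimately show ?thesis using that[of "\<lambda>k. r k + k0"] by blast
qed

context filtered_brownian_motion begin

text \<open>The integrands that define \<open>J\<close> are random and otherwise unknown. The
  isometry for their difference from the deterministic step functions, together with
  \<open>ennreal_square_add_le\<close> applied twice, shows that the deterministic sums have the
  same limit.\<close>

lemma ito_integral_deterministic_approx:
  fixes a b c :: "nat \<Rightarrow> 'i \<Rightarrow> real"
  assumes J: "is_ito_integral M F B f t J" and t: "0 \<le> t" "t \<le> 1"
    and K: "\<And>k. finite (K k)" "\<And>k i. i \<in> K k \<Longrightarrow> 0 \<le> a k i \<and> a k i \<le> b k i \<and> b k i \<le> t"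
    and conv: "(\<lambda>k. \<integral>\<^sup>+x\<in>{0..t}. ennreal ((f x - (\<Sum>i\<in>K k. c k i * indicator {a k i<..b k i} x))\<^sup>2) \<partial>lborel) \<longlonglongrightarrow> 0"
  shows "(\<lambda>k. \<integral>\<^sup>+\<omega>. ennreal (((\<Sum>i\<in>K k. c k i * (B (b k i) \<omega> - B (a k i) \<omega>)) - J \<omega>)\<^sup>2) \<partial>M) \<longlonglongrightarrow> 0"
proof -
  obtain n \<tau> \<xi> where simp: "\<And>k. simple_integrand M F t (n k) (\<tau> k) (\<xi> k)"
    and c1: "(\<lambda>k. \<integral>\<^sup>+\<omega>. (\<integral>\<^sup>+s\<in>{0..t}. ennreal ((simple_process (n k) (\<tau> k) (\<xi> k) s \<omega> - f s)\<^sup>2) \<partial>lborel) \<partial>M) \<longlonglongrightarrow> 0"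
    and c2: "(\<lambda>k. \<integral>\<^sup>+\<omega>. ennreal ((simple_integral B (n k) (\<tau> k) (\<xi> k) \<omega> - J \<omega>)\<^sup>2) \<partial>M) \<longlonglongrightarrow> 0"
    and f': "set_borel_measurable borel {0..t} f" and J' [measurable]: "J \<in> borel_measurable M"
    using J unfolding is_ito_integral_def by blast
  define S where "S k \<omega> = (\<Sum>i\<in>K k. c k i * (B (b k i) \<omega> - B (a k i) \<omega>))" for k \<omega>
  define g where "g k x = (\<Sum>i\<in>K k. c k i * indicator {a k i<..b k i} x)" for k and x :: real
  define R where "R k \<omega> = simple_integral B (n k) (\<tau> k) (\<xi> k) \<omega>" for k \<omega>
  define \<phi> where "\<phi> k x \<omega> = simple_process (n k) (\<tau> k) (\<xi> k) x \<omega>" for k x \<omega>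
  have f [measurable]: "(\<lambda>x. indicator {0..t} x * f x) \<in> borel_measurable borel"
    using f' by (simp add: set_borel_measurable_def)
  have g [measurable]: "g k \<in> borel_measurable borel" for k
    unfolding g_def[abs_def] by measurable
  have \<xi>M [measurable]: "(\<xi> k i) \<in> borel_measurable M" if "i < n k" for k i
    using simp[of k] that F_measurable_M[of "\<xi> k i" "\<tau> k i" borel] t by (fastforce simp: simple_integrand_def)
  have \<phi> [measurable]: "(\<lambda>(\<omega>, x). \<phi> k x \<omega>) \<in> borel_measurable (M \<Otimes>\<^sub>M lborel)" for k
    unfolding \<phi>_def simple_process_def split_beta' by measurable
  have BM [measurable]: "B r \<in> borel_measurable M" if "0 \<le> r" "r \<le> 1" for r
    using F_measurable_M[OF B_adapted] that by auto
  have S [measurable]: "S k \<in> borel_measurable M" for k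
    unfolding S_def[abs_def] using K(2)[of _ k] t by (intro borel_measurable_sum borel_measurable_times borel_measurable_diff BM) force+
  have R [measurable]: "R k \<in> borel_measurable M" for k
    unfolding R_def[abs_def] simple_integral_def using simp[of k] t \<xi>M[of _ k]
    by (intro borel_measurable_sum borel_measurable_times borel_measurable_diff BM) (force simp: simple_integrand_def)+
  have iso: "(\<integral>\<^sup>+\<omega>. ennreal ((R k \<omega> - S k \<omega>)\<^sup>2) \<partial>M)
     = (\<integral>\<^sup>+\<omega>. (\<integral>\<^sup>+x. ennreal ((\<phi> k x \<omega> - g k x)\<^sup>2) \<partial>lborel) \<partial>M)" for k
  proof -
    \<comment> \<open>A disjoint sum of the two index sets, with a minus sign on the deterministic
      part, makes the difference a single simple integrand.\<close>
    let ?K = "{..<n k} <+> K k"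
    define a' where "a' = case_sum (\<tau> k) (a k)"
    define b' where "b' = case_sum (\<lambda>i. \<tau> k (Suc i)) (b k)"
    define \<xi>' where "\<xi>' = case_sum (\<xi> k) (\<lambda>i \<omega>. - c k i)"
    have eq1: "R k \<omega> - S k \<omega> = (\<Sum>j\<in>?K. \<xi>' j \<omega> * (B (b' j) \<omega> - B (a' j) \<omega>))" for \<omega>
      using K(1)[of k] by (simp add: sum.Plus R_def S_def simple_integral_def a'_def b'_def \<xi>'_def sum_negf)
    have eq2: "\<phi> k x \<omega> - g k x = (\<Sum>j\<in>?K. \<xi>' j \<omega> * indicator {a' j<..b' j} x)" for x \<omega>
      using K(1)[of k] by (simp add: sum.Plus \<phi>_def g_def simple_process_def a'_def b'_def \<xi>'_def sum_negf
        del: sum_mult_indicator)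
    show ?thesis unfolding eq1 eq2
    proof (rule ito_isometry)
      show "finite ?K" using K(1) by simp
      fix j assume "j \<in> ?K"
      then show "bounded_at (a' j) (\<xi>' j) \<and> 0 \<le> a' j \<and> a' j \<le> b' j \<and> b' j \<le> 1"
        using simp[of k] K(2)[of _ k] t
        by (fastforce simp: a'_def b'_def \<xi>'_def bounded_at_def simple_integrand_def)
    qed
  qed
  have bound: "(\<integral>\<^sup>+\<omega>. ennreal ((R k \<omega> - S k \<omega>)\<^sup>2) \<partial>M)
     \<le> 2 * (\<integral>\<^sup>+\<omega>. (\<integral>\<^sup>+s\<in>{0..t}. ennreal ((\<phi> k s \<omega> - f s)\<^sup>2) \<partial>lborel) \<partial>M)
      + 2 * (\<integral>\<^sup>+x\<in>{0..t}. ennreal ((f x - g k x)\<^sup>2) \<partial>lborel)" for k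
  proof -
    \<comment> \<open>The isometry integrates over the whole line; both step functions vanish off
      \<open>{0..t}\<close>.\<close>
    have z: "\<phi> k x \<omega> = 0 \<and> g k x = 0" if "x \<notin> {0..t}" for x \<omega>
      unfolding \<phi>_def g_def simple_process_def using that simp[of k] K(2)[of _ k]
      by (intro conjI sum.neutral ballI) (fastforce simp: simple_integrand_def indicator_def)+
    \<comment> \<open>Only the restriction of \<open>f\<close> to \<open>{0..t}\<close> is known to
      be measurable, hence the indicators inside the squares.\<close>
    let ?A = "\<lambda>\<omega> x. ennreal ((\<phi> k x \<omega> - indicator {0..t} x * f x)\<^sup>2) * indicator {0..t} x"
    let ?B = "\<lambda>x. ennreal ((indicator {0..t} x * f x - g k x)\<^sup>2) * indicator {0..t} x"
    have [measurable]: "(\<lambda>p. \<phi> k (snd p) (fst p)) \<in> borel_measurable (M \<Otimes>\<^sub>M lborel)"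
      using \<phi>[of k] by (simp add: split_beta')
    have A2: "(\<lambda>p. ?A (fst p) (snd p)) \<in> borel_measurable (M \<Otimes>\<^sub>M lborel)" by measurable
    have A1: "?A \<omega> \<in> borel_measurable lborel" if "\<omega> \<in> space M" for \<omega>
      using measurable_compose[OF measurable_Pair1'[OF that] A2] by simp
    have A3: "(\<lambda>\<omega>. \<integral>\<^sup>+x. ?A \<omega> x \<partial>lborel) \<in> borel_measurable M"
      using lborel.borel_measurable_nn_integral_fst[OF A2] by simp
    have "(\<integral>\<^sup>+\<omega>. ennreal ((R k \<omega> - S k \<omega>)\<^sup>2) \<partial>M) \<le> (\<integral>\<^sup>+\<omega>. (\<integral>\<^sup>+x. 2 * ?A \<omega> x + 2 * ?B x \<partial>lborel) \<partial>M)"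
      unfolding iso
    proof (intro nn_integral_mono)
      fix \<omega> x
      show "ennreal ((\<phi> k x \<omega> - g k x)\<^sup>2) \<le> 2 * ?A \<omega> x + 2 * ?B x"
        using z[of x \<omega>] ennreal_square_add_le[of "\<phi> k x \<omega> - f x" "f x - g k x"]
        by (cases "x \<in> {0..t}") auto
    qed
    also have "\<dots> = (\<integral>\<^sup>+\<omega>. 2 * (\<integral>\<^sup>+x. ?A \<omega> x \<partial>lborel) + 2 * (\<integral>\<^sup>+x. ?B x \<partial>lborel) \<partial>M)"
      by (intro nn_integral_cong) (simp add: nn_integral_add nn_integral_cmult A1)
    also have "\<dots> = 2 * (\<integral>\<^sup>+\<omega>. (\<integral>\<^sup>+x. ?A \<omega> x \<partial>lborel) \<partial>M) + 2 * (\<integral>\<^sup>+x. ?B x \<partial>lborel)"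
      by (simp add: nn_integral_add nn_integral_cmult emeasure_space_1 A3)
    also have "(\<integral>\<^sup>+\<omega>. (\<integral>\<^sup>+x. ?A \<omega> x \<partial>lborel) \<partial>M)
        = (\<integral>\<^sup>+\<omega>. (\<integral>\<^sup>+s\<in>{0..t}. ennreal ((\<phi> k s \<omega> - f s)\<^sup>2) \<partial>lborel) \<partial>M)"
      by (intro nn_integral_cong) (auto simp: indicator_def)
    also have "(\<integral>\<^sup>+x. ?B x \<partial>lborel) = (\<integral>\<^sup>+x\<in>{0..t}. ennreal ((f x - g k x)\<^sup>2) \<partial>lborel)"
      by (intro nn_integral_cong) (auto simp: indicator_def)
    finally show ?thesis .
  qed
  let ?u = "\<lambda>k. 2 * (2 * (\<integral>\<^sup>+\<omega>. (\<integral>\<^sup>+s\<in>{0..t}. ennreal ((\<phi> k s \<omega> - f s)\<^sup>2) \<partial>lborel) \<partial>M)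
      + 2 * (\<integral>\<^sup>+x\<in>{0..t}. ennreal ((f x - g k x)\<^sup>2) \<partial>lborel))
      + 2 * (\<integral>\<^sup>+\<omega>. ennreal ((R k \<omega> - J \<omega>)\<^sup>2) \<partial>M)"
  have "?u \<longlonglongrightarrow> 2 * (2 * 0 + 2 * 0) + 2 * 0"
    using c1 c2 conv unfolding \<phi>_def[symmetric] R_def[symmetric] g_def[symmetric]
    by (intro tendsto_add ennreal_tendsto_cmult) auto
  then have u: "?u \<longlonglongrightarrow> 0" by simp
  have "(\<integral>\<^sup>+\<omega>. ennreal ((S k \<omega> - J \<omega>)\<^sup>2) \<partial>M) \<le> ?u k" for k
  proof -
    have "(\<integral>\<^sup>+\<omega>. ennreal ((S k \<omega> - J \<omega>)\<^sup>2) \<partial>M)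
        \<le> (\<integral>\<^sup>+\<omega>. 2 * ennreal ((R k \<omega> - S k \<omega>)\<^sup>2) + 2 * ennreal ((R k \<omega> - J \<omega>)\<^sup>2) \<partial>M)"
    proof (intro nn_integral_mono)
      fix \<omega> show "ennreal ((S k \<omega> - J \<omega>)\<^sup>2) \<le> 2 * ennreal ((R k \<omega> - S k \<omega>)\<^sup>2) + 2 * ennreal ((R k \<omega> - J \<omega>)\<^sup>2)"
        using ennreal_square_add_le[of "S k \<omega> - R k \<omega>" "R k \<omega> - J \<omega>"] by (simp add: power2_commute[of "S k \<omega>" "R k \<omega>"])
    qed
    also have "\<dots> = 2 * (\<integral>\<^sup>+\<omega>. ennreal ((R k \<omega> - S k \<omega>)\<^sup>2) \<partial>M) + 2 * (\<integral>\<^sup>+\<omega>. ennreal ((R k \<omega> - J \<omega>)\<^sup>2) \<partial>M)"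
      by (simp add: nn_integral_add nn_integral_cmult)
    also have "\<dots> \<le> ?u k" by (intro add_mono mult_left_mono bound) auto
    finally show ?thesis .
  qed
  then show ?thesis
    unfolding S_def[symmetric] by (intro tendsto_sandwich[OF _ _ tendsto_const u]) auto
qed

definition riemann_ito :: "(real \<Rightarrow> real) \<Rightarrow> real \<Rightarrow> real \<Rightarrow> nat \<Rightarrow> 'w \<Rightarrow> real" where
  "riemann_ito f s t n \<omega> = (\<Sum>i<Suc n. f (upart s t n i) * (B (upart s t n (Suc i)) \<omega> - B (upart s t n i) \<omega>))"

text \<open>Breaking the partition at \<open>s\<close> lets the first summand approximate the
  integral up to \<open>s\<close>, so that the second one captures the increment from
  \<open>s\<close> to \<open>t\<close>.\<close>

lemma ito_integral_riemann_ito: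
  assumes J: "is_ito_integral M F B f t J" and st: "0 \<le> s" "s \<le> t" "t \<le> 1" and f: "continuous_on {0..t} f"
  shows "(\<lambda>k. \<integral>\<^sup>+\<omega>. ennreal ((riemann_ito f 0 s k \<omega> + riemann_ito f s t k \<omega> - J \<omega>)\<^sup>2) \<partial>M) \<longlonglongrightarrow> 0"
proof -
  define K where "K k = {..<Suc k} <+> {..<Suc k}" for k :: nat
  define a where "a k = case_sum (upart 0 s k) (upart s t k)" for k
  define b where "b k = case_sum (\<lambda>i. upart 0 s k (Suc i)) (\<lambda>i. upart s t k (Suc i))" for k
  define c where "c k = case_sum (\<lambda>i. f (upart 0 s k i)) (\<lambda>i. f (upart s t k i))" for k
  have e1: "(\<Sum>i\<in>K k. c k i * (B (b k i) \<omega> - B (a k i) \<omega>)) = riemann_ito f 0 s k \<omega> + riemann_ito f s t k \<omega>" for k \<omega>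
    by (simp add: K_def sum.Plus a_def b_def c_def riemann_ito_def del: sum.lessThan_Suc)
  have e2: "(\<Sum>i\<in>K k. c k i * indicator {a k i<..b k i} x) = riemann_step f 0 s k x + riemann_step f s t k x" for k x
    by (simp add: K_def sum.Plus a_def b_def c_def riemann_step_def del: sum.lessThan_Suc sum_mult_indicator)
  show ?thesis
  proof (rule ito_integral_deterministic_approx[OF J, of K a b c, unfolded e1 e2])
    show "finite (K k)" for k by (simp add: K_def)
    show "0 \<le> a k i \<and> a k i \<le> b k i \<and> b k i \<le> t" if "i \<in> K k" for k i
      using that st upart_bounds[of 0 s] upart_bounds[of s t] upart_mono[of 0 s] upart_mono[of s t]
      by (auto simp: K_def a_def b_def intro: order_trans[of 0 s] order_trans[of _ s t] upart_mono)
    show "(\<lambda>k. \<integral>\<^sup>+x\<in>{0..t}. ennreal ((f x - (riemann_step f 0 s k x + riemann_step f s t k x))\<^sup>2) \<partial>lborel) \<longlonglongrightarrow> 0"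
    proof (rule tendsto_0_ennrealI)
      fix \<epsilon> :: real assume "\<epsilon> > 0"
      then have "sqrt \<epsilon> > 0" by simp
      have "\<forall>\<^sub>F k in sequentially. \<forall>x\<in>{0<..s}. \<bar>riemann_step f 0 s k x - f x\<bar> < sqrt \<epsilon>"
        "\<forall>\<^sub>F k in sequentially. \<forall>x\<in>{s<..t}. \<bar>riemann_step f s t k x - f x\<bar> < sqrt \<epsilon>"
        using st \<open>sqrt \<epsilon> > 0\<close> by (auto intro!: riemann_step_uniform continuous_on_subset[OF f])
      then show "\<forall>\<^sub>F k in sequentially. (\<integral>\<^sup>+x\<in>{0..t}. ennreal ((f x - (riemann_step f 0 s k x + riemann_step f s t k x))\<^sup>2) \<partial>lborel) \<le> ennreal \<epsilon>"
      proof eventually_elim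
        case (elim k)
        have "\<bar>f x - (riemann_step f 0 s k x + riemann_step f s t k x)\<bar> \<le> sqrt \<epsilon>" if x: "x \<in> {0<..t}" for x
        proof (cases "x \<le> s")
          case True
          then have "riemann_step f s t k x = 0" using st by (intro riemann_step_outside) auto
          then show ?thesis using elim(1) True x by (auto simp: abs_minus_commute less_imp_le)
        next
          case False
          then have "riemann_step f 0 s k x = 0" using st by (intro riemann_step_outside) auto
          then show ?thesis using elim(2) False x by (auto simp: abs_minus_commute less_imp_le)
        qed
        then have "(\<integral>\<^sup>+x\<in>{0..t}. ennreal ((f x - (riemann_step f 0 s k x + riemann_step f s t k x))\<^sup>2) \<partial>lborel)
            \<le> ennreal ((sqrt \<epsilon>)\<^sup>2)"
          using st by (intro nn_integral_uniform_bound) auto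
        then show ?case using \<open>\<epsilon> > 0\<close> by simp
      qed
    qed
  qed (use st in auto)
qed

end

section \<open>Gaussian processes with independent increments\<close>

text \<open>The approximating rationals lie to the right of \<open>t\<close>, which keeps them in
  \<open>{a..<1}\<close> even for \<open>t = a\<close>. The set \<open>A\<close> will be
  \<open>{0}\<close> when two paths are identified, and a closed ball when an oscillation bound is
  extended.\<close>

lemma continuous_Ico_dense_closed:
  fixes f :: "real \<Rightarrow> real"
  assumes f: "continuous_on {0..<1} f" and A: "closed A" and a: "0 \<le> a"
    and q: "\<And>q. q \<in> \<rat> \<Longrightarrow> q \<in> {a..<1} \<Longrightarrow> f q \<in> A" and t: "t \<in> {a..<1}"
  shows "f t \<in> A"
proof -
  have "\<exists>q\<in>\<rat>. t < q \<and> q < t + (1 - t) / real (Suc n)" for n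
    using t by (intro Rats_dense_in_real) simp
  then obtain q where q': "\<And>n. q n \<in> \<rat>" "\<And>n. t < q n" "\<And>n. q n < t + (1 - t) / real (Suc n)" by metis
  have le: "(1 - t) / real (Suc n) \<le> 1 - t" for n
    using t mult_right_mono[of 1 "real (Suc n)" "1 - t"] by (simp add: divide_le_eq mult.commute del: of_nat_Suc)
  have in1: "q n \<in> {a..<1}" for n
    using q'(2)[of n] q'(3)[of n] le[of n] t by auto
  have "(\<lambda>n. t + (1 - t) * (1 / real (Suc n))) \<longlonglongrightarrow> t + (1 - t) * 0"
    by (intro tendsto_intros lim_inverse_n'[THEN LIMSEQ_Suc])
  then have "(\<lambda>n. t + (1 - t) / real (Suc n)) \<longlonglongrightarrow> t" by simp
  then have "q \<longlonglongrightarrow> t"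
    using q'(2,3) by (intro tendsto_sandwich[OF _ _ tendsto_const, of t q]) (auto intro!: always_eventually less_imp_le)
  moreover have "q n \<in> {0..<1}" for n using in1[of n] a by simp
  ultimately have "(\<lambda>n. f (q n)) \<longlonglongrightarrow> f t"
    using t a by (intro continuous_on_tendsto_compose[OF f]) auto
  then show ?thesis
    by (rule closed_sequentially[OF A _, rotated]) (use q[OF q'(1) in1] in blast)
qed

lemma (in prob_space) gaussian_variable_AE_cong:
  assumes "gaussian_variable M X" "AE \<omega> in M. X \<omega> = Y \<omega>" and Y [measurable]: "Y \<in> borel_measurable M"
  shows "gaussian_variable M Y"
proof -
  have [measurable]: "X \<in> borel_measurable M" using assms(1) by (simp add: gaussian_variable_def)
  have "distr M lborel X = distr M lborel Y" using assms(2) by (intro distr_cong_AE) auto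
  then have "distributed M lborel X f \<longleftrightarrow> distributed M lborel Y f" for f
    by (simp add: distributed_def)
  moreover have "(AE \<omega> in M. X \<omega> = m) \<longleftrightarrow> (AE \<omega> in M. Y \<omega> = m)" for m
  proof
    assume "AE \<omega> in M. X \<omega> = m"
    with assms(2) show "AE \<omega> in M. Y \<omega> = m" by eventually_elim simp
  next
    assume "AE \<omega> in M. Y \<omega> = m"
    with assms(2) show "AE \<omega> in M. X \<omega> = m" by eventually_elim simp
  qed
  ultimately show ?thesis using assms(1) Y by (simp add: gaussian_variable_def)
qed

context filtered_prob_space begin

text \<open>Completeness enters here: every subset of a null set lies in \<open>F 0\<close>, so a
  preimage changes only by sets that are already measurable.\<close>

lemma F_measurable_AE_cong:
  fixes f g :: "'w \<Rightarrow> real"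
  assumes f: "f \<in> borel_measurable (F t)" and eq: "AE \<omega> in M. f \<omega> = g \<omega>" and t: "0 \<le> t" "t \<le> 1"
  shows "g \<in> borel_measurable (F t)"
proof -
  obtain N where N: "N \<in> null_sets M" "{\<omega> \<in> space M. f \<omega> \<noteq> g \<omega>} \<subseteq> N"
    using eq by (auto elim!: AE_E simp: null_sets_def)
  have null: "A \<in> sets (F t)" if "A \<subseteq> N" for A
    using null_sets_complete[OF N(1) that] filt_mono[of 0 t] t by auto
  show ?thesis
  proof (rule measurableI)
    fix A :: "real set" assume "A \<in> sets borel"
    then have "f -` A \<inter> space (F t) \<in> sets (F t)" using f by (rule measurable_sets[rotated])
    moreover have "g -` A \<inter> space (F t) = (f -` A \<inter> space (F t) - (N \<inter> space M)) \<union> (g -` A \<inter> space (F t) \<inter> N)"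
      using N(2) F_space[of t] t by auto
    moreover have "N \<inter> space M \<in> sets (F t)" "g -` A \<inter> space (F t) \<inter> N \<in> sets (F t)"
      by (auto intro: null)
    ultimately show "g -` A \<inter> space (F t) \<in> sets (F t)"
      by (metis sets.Diff sets.Un)
  qed simp
qed

lemma F_measurable_AE_limit:
  fixes Y :: "nat \<Rightarrow> 'w \<Rightarrow> real"
  assumes Y: "\<And>n. Y n \<in> borel_measurable (F t)" and lim: "AE \<omega> in M. (\<lambda>n. Y n \<omega>) \<longlonglongrightarrow> Z \<omega>" and t: "0 \<le> t" "t \<le> 1"
  shows "Z \<in> borel_measurable (F t)"
proof (rule F_measurable_AE_cong[OF _ _ t])
  show "(\<lambda>\<omega>. lim (\<lambda>n. Y n \<omega>)) \<in> borel_measurable (F t)" using Y by (rule borel_measurable_lim_metric)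
  show "AE \<omega> in M. lim (\<lambda>n. Y n \<omega>) = Z \<omega>" using lim by eventually_elim (rule limI)
qed

text \<open>A Gaussian process with independent increments and deterministic variance function
  \<open>U\<close>. The index set is a parameter because the noise first lives on
  \<open>{0..<1}\<close> and is later extended to \<open>{0..1}\<close>.\<close>

definition gaussian_martingale :: "real set \<Rightarrow> (real \<Rightarrow> 'w \<Rightarrow> real) \<Rightarrow> (real \<Rightarrow> real) \<Rightarrow> bool" where
  "gaussian_martingale T N U \<longleftrightarrow> T \<subseteq> {0..1} \<and> 0 \<in> T \<and> U 0 = 0 \<and> (\<forall>t\<in>T. N t \<in> borel_measurable (F t)) \<and>
     (AE \<omega> in M. N 0 \<omega> = 0) \<and>
     (\<forall>s\<in>T. \<forall>t\<in>T. s \<le> t \<longrightarrow> indep_gaussian M (F s) (\<lambda>\<omega>. N t \<omega> - N s \<omega>) (U t - U s))"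

context
  fixes T N U assumes N: "gaussian_martingale T N U"
begin

lemma gm_times: "t \<in> T \<Longrightarrow> 0 \<le> t" "t \<in> T \<Longrightarrow> t \<le> 1" "0 \<in> T"
  and gm_adapted: "t \<in> T \<Longrightarrow> N t \<in> borel_measurable (F t)"
  and gm_increment: "s \<in> T \<Longrightarrow> t \<in> T \<Longrightarrow> s \<le> t \<Longrightarrow> indep_gaussian M (F s) (\<lambda>\<omega>. N t \<omega> - N s \<omega>) (U t - U s)"
  using N by (auto simp: gaussian_martingale_def)

lemma gm_measurable: "t \<in> T \<Longrightarrow> N t \<in> borel_measurable M"
  using gm_adapted gm_times F_measurable_M by blast

text \<open>\<open>N 0\<close> vanishes only almost surely; the limit lemma with constant sequences
  trades the increment from 0 for \<open>N t\<close>.\<close>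

lemma gm_indep_gaussian:
  assumes t: "t \<in> T" shows "indep_gaussian M (F 0) (N t) (U t)"
proof (rule indep_gaussian_AE_limit[where Y="\<lambda>n \<omega>. N t \<omega> - N 0 \<omega>" and v="\<lambda>n. U t"])
  show "AE \<omega> in M. (\<lambda>n. N t \<omega> - N 0 \<omega>) \<longlonglongrightarrow> N t \<omega>"
    using N unfolding gaussian_martingale_def by (auto elim!: eventually_mono)
  show "indep_gaussian M (F 0) (\<lambda>\<omega>. N t \<omega> - N 0 \<omega>) (U t)"
    using gm_increment[of 0 t] t gm_times N by (simp add: gaussian_martingale_def)
qed (use subalg gm_measurable[OF t] in auto)

text \<open>Induction on the largest time \<open>m\<close>: with \<open>p\<close> the preceding
  time, \<open>N m\<close> is \<open>N p\<close> plus an increment independent of the past. The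
  coefficient of \<open>N m\<close> is thereby passed on to \<open>p\<close>, hence the
  generalisation over \<open>a\<close>.\<close>

lemma gm_linear_combination:
  assumes J: "finite J" "J \<subseteq> T"
  shows "\<exists>v. indep_gaussian M (F 0) (\<lambda>\<omega>. \<Sum>t\<in>J. a t * N t \<omega>) v"
  using J
proof (induction J arbitrary: a rule: finite_linorder_max_induct)
  case empty
  then show ?case using indep_gaussian_0[OF subalg[of 0]] by auto
next
  case (insert m J)
  show ?case
  proof (cases "J = {}")
    case True
    then show ?thesis using indep_gaussian_scale[OF gm_indep_gaussian[of m], of "a m"] insert.prems by auto
  next
    case False
    define p where "p = Max J"
    have p: "p \<in> J" "\<And>t. t \<in> J \<Longrightarrow> t \<le> p" "p < m" using False insert.hyps by (auto simp: p_def)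
    have pm: "p \<in> T" "m \<in> T" using p insert.prems by auto
    define a' where "a' = a(p := a p + a m)"
    obtain v where v: "indep_gaussian M (F 0) (\<lambda>\<omega>. \<Sum>t\<in>J. a' t * N t \<omega>) v"
      using insert.IH[of a'] insert.prems by auto
    have meas: "(\<lambda>\<omega>. \<Sum>t\<in>J. a' t * N t \<omega>) \<in> borel_measurable (F p)"
      using p insert.prems gm_times
      by (intro borel_measurable_sum borel_measurable_times F_measurable_mono[OF gm_adapted]) auto
    have "(\<Sum>t\<in>J. a' t * N t \<omega>) = (\<Sum>t\<in>J. a t * N t \<omega>) + a m * N p \<omega>" for \<omega>
      using p(1) insert.hyps(1) by (simp add: a'_def sum.remove[of J p] algebra_simps)
    then have "(\<Sum>t\<in>insert m J. a t * N t \<omega>) = (\<Sum>t\<in>J. a' t * N t \<omega>) + a m * (N m \<omega> - N p \<omega>)" for \<omega>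
      using insert.hyps by (subst sum.insert) (auto simp: algebra_simps)
    moreover have "indep_gaussian M (F 0) (\<lambda>\<omega>. (\<Sum>t\<in>J. a' t * N t \<omega>) + a m * (N m \<omega> - N p \<omega>)) (v + (a m)\<^sup>2 * (U m - U p))"
      using v meas pm p(3) gm_times
      by (intro indep_gaussian_add[where G'="F p"] indep_gaussian_scale gm_increment subalg F_subalgebra) auto
    ultimately show ?thesis by auto
  qed
qed

lemma gm_moments:
  assumes t: "t \<in> T"
  shows "integrable M (N t)" "integrable M (\<lambda>\<omega>. (N t \<omega>)\<^sup>2)" "expectation (N t) = 0" "expectation (\<lambda>\<omega>. (N t \<omega>)\<^sup>2) = U t"
  using indep_gaussian_moments[OF subalg gm_indep_gaussian[OF t]] by auto

lemma gm_product:
  assumes st: "s \<in> T" "t \<in> T" "s \<le> t"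
  shows "integrable M (\<lambda>\<omega>. N s \<omega> * N t \<omega>)" "expectation (\<lambda>\<omega>. N s \<omega> * N t \<omega>) = U s"
proof -
  have "subalgebra M (F s)" using subalg gm_times st by auto
  from indep_gaussian_orthogonal(1,2)[OF this gm_increment[OF st] gm_adapted[OF st(1)] gm_moments(1)[OF st(1)]]
  have 1: "integrable M (\<lambda>\<omega>. N s \<omega> * (N t \<omega> - N s \<omega>))" "expectation (\<lambda>\<omega>. N s \<omega> * (N t \<omega> - N s \<omega>)) = 0"
    by auto
  have eq: "N s \<omega> * N t \<omega> = N s \<omega> * (N t \<omega> - N s \<omega>) + (N s \<omega>)\<^sup>2" for \<omega>
    by (simp add: power2_eq_square algebra_simps)
  show "integrable M (\<lambda>\<omega>. N s \<omega> * N t \<omega>)" "expectation (\<lambda>\<omega>. N s \<omega> * N t \<omega>) = U s"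
    unfolding eq using 1 gm_moments[OF st(1)] by auto
qed

lemma gm_affine_mean:
  assumes X: "X \<in> borel_measurable M" "AE \<omega> in M. X \<omega> = m + c * N t \<omega>" and t: "t \<in> T"
  shows "mean M X = m"
proof -
  have "mean M X = expectation (\<lambda>\<omega>. m + c * N t \<omega>)"
    unfolding mean_def using X gm_measurable[OF t] by (intro integral_cong_AE) auto
  then show ?thesis using gm_moments[OF t] by (simp add: prob_space)
qed

lemma gm_affine_covariance:
  assumes X: "X \<in> borel_measurable M" "AE \<omega> in M. X \<omega> = m + c * N s \<omega>"
    and Y: "Y \<in> borel_measurable M" "AE \<omega> in M. Y \<omega> = m' + c' * N t \<omega>" and st: "s \<in> T" "t \<in> T"
  shows "covariance M X Y = c * c' * U (min s t)"
proof -
  have "covariance M X Y = expectation (\<lambda>\<omega>. c * c' * (N s \<omega> * N t \<omega>))"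
    unfolding covariance_def gm_affine_mean[OF X st(1)] gm_affine_mean[OF Y st(2)]
    using X Y gm_measurable[OF st(1)] gm_measurable[OF st(2)]
    by (intro integral_cong_AE) (auto elim!: eventually_elim2)
  also have "\<dots> = c * c' * U (min s t)"
    using gm_product(2)[of s t] gm_product(2)[of t s] st by (cases "s \<le> t") (auto simp: min_def mult.commute)
  finally show ?thesis .
qed

lemma gm_affine_gaussian:
  assumes X: "\<And>t. t \<in> T \<Longrightarrow> X t \<in> borel_measurable M" "\<And>t. t \<in> T \<Longrightarrow> AE \<omega> in M. X t \<omega> = m t + c t * N t \<omega>"
  shows "gaussian_process M T X"
  unfolding gaussian_process_def
proof (intro allI impI)
  fix J a assume J: "finite J \<and> J \<subseteq> T"
  obtain v where "indep_gaussian M (F 0) (\<lambda>\<omega>. \<Sum>t\<in>J. (a t * c t) * N t \<omega>) v"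
    using gm_linear_combination[of J "\<lambda>t. a t * c t"] J by auto
  then have "gaussian_variable M (\<lambda>\<omega>. (\<Sum>t\<in>J. a t * m t) + (\<Sum>t\<in>J. (a t * c t) * N t \<omega>))"
    by (intro indep_gaussian_gaussian_variable[OF subalg[of 0]]) auto
  moreover have "AE \<omega> in M. \<forall>t\<in>J. X t \<omega> = m t + c t * N t \<omega>"
    using J X(2) by (intro AE_finite_allI) auto
  then have "AE \<omega> in M. (\<Sum>t\<in>J. a t * m t) + (\<Sum>t\<in>J. (a t * c t) * N t \<omega>) = (\<Sum>t\<in>J. a t * X t \<omega>)"
    by eventually_elim (simp add: sum.distrib algebra_simps)
  moreover have "(\<lambda>\<omega>. \<Sum>t\<in>J. a t * X t \<omega>) \<in> borel_measurable M"
    using J X(1) by (intro borel_measurable_sum borel_measurable_times) auto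
  ultimately show "gaussian_variable M (\<lambda>\<omega>. \<Sum>t\<in>J. a t * X t \<omega>)"
    by (rule gaussian_variable_AE_cong)
qed

end

end

section \<open>Ito integrals of continuous deterministic integrands\<close>

context filtered_brownian_motion begin

lemma riemann_ito_indep_gaussian:
  assumes st: "0 \<le> s" "s \<le> t" "t \<le> 1"
  shows "indep_gaussian M (F s) (riemann_ito f s t n)
    (\<Sum>i<Suc n. (f (upart s t n i))\<^sup>2 * (upart s t n (Suc i) - upart s t n i))"
    "riemann_ito f s t n \<in> borel_measurable (F t)"
  unfolding riemann_ito_def[abs_def]
  by (rule indep_gaussian_upart_sum[OF st, where W="\<lambda>x. x"]; use st in \<open>auto intro: B_adapted B_increment\<close>)+

lemma riemann_ito_trivial: "riemann_ito f t t n \<omega> = 0"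
  by (simp add: riemann_ito_def upart_def)

text \<open>The second subsequence is drawn from the first, so both limits hold along a common one
  and can be subtracted.\<close>

lemma ito_integral_AE_approx:
  assumes J: "is_ito_integral M F B f s J" and J': "is_ito_integral M F B f t J'"
    and st: "0 \<le> s" "s \<le> t" "t \<le> 1" and f: "continuous_on {0..t} f"
  obtains r where "strict_mono r" "AE \<omega> in M. (\<lambda>k. riemann_ito f 0 s (r k) \<omega>) \<longlonglongrightarrow> J \<omega>"
    "AE \<omega> in M. (\<lambda>k. riemann_ito f s t (r k) \<omega>) \<longlonglongrightarrow> J' \<omega> - J \<omega>"
proof -
  have [measurable]: "J \<in> borel_measurable M" "J' \<in> borel_measurable M"
    using J J' by (auto simp: is_ito_integral_def)
  have [measurable]: "riemann_ito f 0 s k \<in> borel_measurable M" "riemann_ito f s t k \<in> borel_measurable M" for k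
    using F_measurable_M[OF riemann_ito_indep_gaussian(2)] st by auto
  have f': "continuous_on {0..s} f" using st by (intro continuous_on_subset[OF f]) auto
  have c: "(\<lambda>k. \<integral>\<^sup>+\<omega>. ennreal ((riemann_ito f 0 s k \<omega> - J \<omega>)\<^sup>2) \<partial>M) \<longlonglongrightarrow> 0"
    using ito_integral_riemann_ito[OF J, of s] st f' by (simp add: riemann_ito_trivial)
  obtain r1 where r1: "strict_mono r1" "AE \<omega> in M. (\<lambda>k. riemann_ito f 0 s (r1 k) \<omega>) \<longlonglongrightarrow> J \<omega>"
    by (rule L2_AE_subseq[OF _ _ c]) auto
  have c': "(\<lambda>k. \<integral>\<^sup>+\<omega>. ennreal ((riemann_ito f 0 s (r1 k) \<omega> + riemann_ito f s t (r1 k) \<omega> - J' \<omega>)\<^sup>2) \<partial>M) \<longlonglongrightarrow> 0"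
    using LIMSEQ_subseq_LIMSEQ[OF ito_integral_riemann_ito[OF J' st f] r1(1)] by (simp add: o_def)
  obtain r2 where r2: "strict_mono r2"
    "AE \<omega> in M. (\<lambda>k. riemann_ito f 0 s (r1 (r2 k)) \<omega> + riemann_ito f s t (r1 (r2 k)) \<omega>) \<longlonglongrightarrow> J' \<omega>"
    by (rule L2_AE_subseq[OF _ _ c']) auto
  have 1: "AE \<omega> in M. (\<lambda>k. riemann_ito f 0 s (r1 (r2 k)) \<omega>) \<longlonglongrightarrow> J \<omega>"
    using r1(2) by eventually_elim (use LIMSEQ_subseq_LIMSEQ[OF _ r2(1)] in \<open>force simp: o_def\<close>)
  have 2: "AE \<omega> in M. (\<lambda>k. riemann_ito f s t (r1 (r2 k)) \<omega>) \<longlonglongrightarrow> J' \<omega> - J \<omega>"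
    using r2(2) 1 by eventually_elim (force dest: tendsto_diff)
  have "strict_mono (\<lambda>k. r1 (r2 k))" using strict_mono_o[OF r1(1) r2(1)] by (simp add: o_def)
  then show ?thesis using 1 2 by (rule that)
qed

text \<open>\<open>is_ito_integral\<close> asks for measurability with respect to \<open>M\<close>
  only; the finer one comes from the Riemann sums and from completeness.\<close>

lemma ito_integral_adapted:
  assumes J: "is_ito_integral M F B f t J" and t: "0 \<le> t" "t \<le> 1" and f: "continuous_on {0..t} f"
  shows "J \<in> borel_measurable (F t)"
proof -
  obtain r where r: "AE \<omega> in M. (\<lambda>k. riemann_ito f 0 t (r k) \<omega>) \<longlonglongrightarrow> J \<omega>"
    using ito_integral_AE_approx[OF J J] t f by blast
  show ?thesis
    by (rule F_measurable_AE_limit[OF _ r t], rule riemann_ito_indep_gaussian(2)) (use t in auto)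
qed

text \<open>With \<open>s = t\<close> all increments in the second Riemann sum are zero, so its
  limit \<open>J' - J\<close> vanishes.\<close>

lemma ito_integral_unique:
  assumes J: "is_ito_integral M F B f t J" "is_ito_integral M F B f t J'" and t: "0 \<le> t" "t \<le> 1" and f: "continuous_on {0..t} f"
  shows "AE \<omega> in M. J \<omega> = J' \<omega>"
proof -
  obtain r where "AE \<omega> in M. (\<lambda>k. riemann_ito f t t (r k) \<omega>) \<longlonglongrightarrow> J' \<omega> - J \<omega>"
    using ito_integral_AE_approx[OF J] t f by blast
  then show ?thesis by eventually_elim (simp add: riemann_ito_trivial LIMSEQ_const_iff)
qed

lemma ito_integral_increment:
  assumes J: "is_ito_integral M F B f s J" and J': "is_ito_integral M F B f t J'"
    and st: "0 \<le> s" "s \<le> t" "t \<le> 1" and f: "continuous_on {0..t} f"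
  shows "indep_gaussian M (F s) (\<lambda>\<omega>. J' \<omega> - J \<omega>) (integral {s..t} (\<lambda>x. (f x)\<^sup>2))"
proof -
  obtain r where r: "strict_mono r" "AE \<omega> in M. (\<lambda>k. riemann_ito f s t (r k) \<omega>) \<longlonglongrightarrow> J' \<omega> - J \<omega>"
    using ito_integral_AE_approx[OF J J' st f] by blast
  have f2: "continuous_on {s..t} (\<lambda>x. (f x)\<^sup>2)"
    using st by (intro continuous_intros continuous_on_subset[OF f]) auto
  have le: "upart s t n i \<le> upart s t n (Suc i)" for n i by (rule upart_mono[OF st(2)]) simp
  \<comment> \<open>The constant 1 as second factor turns the Stieltjes sums into ordinary Riemann
    sums, which are the variances.\<close>
  have "(\<lambda>n. \<Sum>i<Suc n. (f (upart s t n i))\<^sup>2 * integral {upart s t n i..upart s t n (Suc i)} (\<lambda>_. 1))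
      \<longlonglongrightarrow> integral {s..t} (\<lambda>x. (f x)\<^sup>2 * 1)"
    by (rule riemann_stieltjes_sums[OF st(2) f2]) (use le in auto)
  then have *: "(\<lambda>n. \<Sum>i<Suc n. (f (upart s t n i))\<^sup>2 * (upart s t n (Suc i) - upart s t n i))
      \<longlonglongrightarrow> integral {s..t} (\<lambda>x. (f x)\<^sup>2)"
    using le by simp
  show ?thesis
  proof (rule indep_gaussian_AE_limit[OF _ riemann_ito_indep_gaussian(1)[OF st] r(2)])
    show "(\<lambda>x. J' x - J x) \<in> borel_measurable M" using J J' by (auto simp: is_ito_integral_def)
    show "(\<lambda>k. \<Sum>i<Suc (r k). (f (upart s t (r k) i))\<^sup>2 * (upart s t (r k) (Suc i) - upart s t (r k) i))
      \<longlonglongrightarrow> integral {s..t} (\<lambda>x. (f x)\<^sup>2)"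
      using LIMSEQ_subseq_LIMSEQ[OF * r(1)] by (simp add: o_def del: sum.lessThan_Suc)
  qed (use subalg st in auto)
qed

lemma ito_integral_gaussian_martingale:
  assumes I: "\<And>t. t \<in> {0..<1} \<Longrightarrow> is_ito_integral M F B f t (I t)" and f: "continuous_on {0..<1} f"
  shows "gaussian_martingale {0..<1} I (\<lambda>t. integral {0..t} (\<lambda>x. (f x)\<^sup>2))"
  unfolding gaussian_martingale_def
proof (intro conjI ballI impI)
  have f': "continuous_on {0..t} f" if "t < 1" for t using that by (intro continuous_on_subset[OF f]) auto
  have f2: "continuous_on {0..<1} (\<lambda>x. (f x)\<^sup>2)" by (intro continuous_intros f)
  show "I t \<in> borel_measurable (F t)" if "t \<in> {0..<1}" for t
    using that by (intro ito_integral_adapted[OF I] f') auto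
  show "indep_gaussian M (F s) (\<lambda>\<omega>. I t \<omega> - I s \<omega>) (integral {0..t} (\<lambda>x. (f x)\<^sup>2) - integral {0..s} (\<lambda>x. (f x)\<^sup>2))"
    if "s \<in> {0..<1}" "t \<in> {0..<1}" "s \<le> t" for s t
    using ito_integral_increment[OF I I, of s t] that f'[of t] integral_diff_Ico[OF f2, of s t] by simp
  obtain r where "AE \<omega> in M. (\<lambda>k. riemann_ito f 0 0 (r k) \<omega>) \<longlonglongrightarrow> I 0 \<omega>"
    using ito_integral_AE_approx[OF I[of 0] I[of 0]] f'[of 0] by auto
  then show "AE \<omega> in M. I 0 \<omega> = 0" by eventually_elim (simp add: riemann_ito_trivial LIMSEQ_const_iff)
qed auto

end

section \<open>Explicit solution of the linear equation\<close>

locale linear_sde = filtered_brownian_motion M F B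
  for M :: "'w measure" and F :: "real \<Rightarrow> 'w measure" and B :: "real \<Rightarrow> 'w \<Rightarrow> real" +
  fixes h \<sigma> :: "real \<Rightarrow> real" and X :: "real \<Rightarrow> real \<Rightarrow> real \<Rightarrow> 'w \<Rightarrow> real"
  assumes h: "continuous_on {0..<1} h" and \<sigma>: "continuous_on {0..<1} \<sigma>"
    and \<sigma>_pos: "\<And>t. t \<in> {0..<1} \<Longrightarrow> \<sigma> t > 0"
    and sde: "\<And>x y. sde_solution M F B (\<lambda>t z. h t * (y - z)) \<sigma> x (X x y)"
begin

definition H where "H t = integral {0..t} h"
definition V where "V t = integral {0..t} (\<lambda>r. (\<sigma> r)\<^sup>2)"
definition U where "U t = integral {0..t} (\<lambda>r. (exp (H r))\<^sup>2 * (\<sigma> r)\<^sup>2)"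

lemma H_0 [simp]: "H 0 = 0" and V_0 [simp]: "V 0 = 0" and U_0 [simp]: "U 0 = 0"
  by (simp_all add: H_def V_def U_def)

lemma \<sigma>2: "continuous_on {0..<1} (\<lambda>r. (\<sigma> r)\<^sup>2)" by (intro continuous_intros \<sigma>)

lemma H_cont: "continuous_on {0..<1} H"
  unfolding H_def[abs_def] by (rule continuous_on_integral_Ico[OF h])

lemma H_deriv: "t \<in> {0..<1} \<Longrightarrow> (H has_real_derivative h t) (at t within {0..<1})"
  unfolding H_def[abs_def] by (rule integral_derivative_Ico[OF h])

lemma V_cont: "continuous_on {0..<1} V"
  unfolding V_def[abs_def] by (rule continuous_on_integral_Ico[OF \<sigma>2])

lemma V_deriv: "t \<in> {0..<1} \<Longrightarrow> (V has_real_derivative (\<sigma> t)\<^sup>2) (at t within {0..<1})"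
  unfolding V_def[abs_def] by (rule integral_derivative_Ico[OF \<sigma>2])

lemma U_integrand: "continuous_on {0..<1} (\<lambda>r. (exp (H r))\<^sup>2 * (\<sigma> r)\<^sup>2)"
  by (intro continuous_intros \<sigma> H_cont)

lemma U_deriv: "t \<in> {0..<1} \<Longrightarrow> (U has_real_derivative (exp (H t))\<^sup>2 * (\<sigma> t)\<^sup>2) (at t within {0..<1})"
  unfolding U_def[abs_def] by (rule integral_derivative_Ico[OF U_integrand])

lemma hexp_cont: "continuous_on {0..<1} (\<lambda>s. h s * exp (H s))"
  by (intro continuous_intros h H_cont)

lemma hexp_integral:
  assumes "0 \<le> a" "a \<le> b" "b < 1"
  shows "integral {a..b} (\<lambda>s. h s * exp (H s)) = exp (H b) - exp (H a)"
proof -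
  have "((\<lambda>s. h s * exp (H s)) has_integral exp (H b) - exp (H a)) {a..b}"
  proof (rule fundamental_theorem_of_calculus[OF assms(2)])
    fix x assume x: "x \<in> {a..b}"
    have "(H has_real_derivative h x) (at x within {a..b})"
      using assms x by (intro DERIV_subset[OF H_deriv]) auto
    then have "((\<lambda>s. exp (H s)) has_real_derivative exp (H x) * h x) (at x within {a..b})"
      by (auto intro!: derivative_eq_intros)
    then show "((\<lambda>s. exp (H s)) has_vector_derivative h x * exp (H x)) (at x within {a..b})"
      by (simp add: has_real_derivative_iff_has_vector_derivative mult.commute)
  qed
  then show ?thesis by (rule integral_unique)
qed

lemma X_adapted: "t \<in> {0..<1} \<Longrightarrow> X x y t \<in> borel_measurable (F t)"
  using sde[of y x] by (auto simp: sde_solution_def adapted_on_def)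

lemma X_measurable: "t \<in> {0..<1} \<Longrightarrow> X x y t \<in> borel_measurable M"
  using F_measurable_M[OF X_adapted] by auto

text \<open>The convolution of the noise with \<open>exp H\<close>, after integration by parts:
  \<open>J\<close> enters through its values only, path by path.\<close>

definition variation_of_constants :: "real \<Rightarrow> real \<Rightarrow> (real \<Rightarrow> 'w \<Rightarrow> real) \<Rightarrow> 'w \<Rightarrow> bool" where
  "variation_of_constants x y J \<omega> \<longleftrightarrow>
     continuous_on {0..<1} (\<lambda>t. X x y t \<omega>) \<and> continuous_on {0..<1} (\<lambda>t. J t \<omega>) \<and>
     (\<forall>t\<in>{0..<1}. X x y t \<omega> = y + (x - y) * exp (- H t) + J t \<omega>
        - exp (- H t) * integral {0..t} (\<lambda>s. h s * exp (H s) * J s \<omega>))"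

text \<open>\<open>sde_solution\<close> quantifies the integral process existentially for each
  solution, so at this stage \<open>I\<close> may depend on \<open>x\<close> and
  \<open>y\<close>.\<close>

lemma noise_exists:
  obtains I where "\<And>t. t \<in> {0..<1} \<Longrightarrow> is_ito_integral M F B \<sigma> t (I t)"
    "AE \<omega> in M. variation_of_constants x y I \<omega>"
proof -
  obtain I where I: "\<And>t. t \<in> {0..<1} \<Longrightarrow> is_ito_integral M F B \<sigma> t (I t)"
    and eq: "AE \<omega> in M. \<forall>t\<in>{0..<1}. X x y t \<omega> = x + integral {0..t} (\<lambda>s. h s * (y - X x y s \<omega>)) + I t \<omega>"
    and c: "AE \<omega> in M. continuous_on {0..<1} (\<lambda>t. X x y t \<omega>)"
  proof -
    from sde[of y x] obtain I where "\<forall>t\<in>{0..<1}. is_ito_integral M F B \<sigma> t (I t)"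
      and eq: "AE \<omega> in M. \<forall>t\<in>{0..<1}. (\<lambda>s. h s * (y - X x y s \<omega>)) absolutely_integrable_on {0..t} \<and>
        X x y t \<omega> = x + integral {0..t} (\<lambda>s. h s * (y - X x y s \<omega>)) + I t \<omega>"
      and "AE \<omega> in M. continuous_on {0..<1} (\<lambda>t. X x y t \<omega>)"
      unfolding sde_solution_def continuous_paths_on_def by blast
    moreover have "AE \<omega> in M. \<forall>t\<in>{0..<1}. X x y t \<omega> = x + integral {0..t} (\<lambda>s. h s * (y - X x y s \<omega>)) + I t \<omega>"
      using eq by eventually_elim blast
    ultimately show ?thesis using that by blast
  qed
  have "AE \<omega> in M. variation_of_constants x y I \<omega>"
    using eq c
  proof eventually_elim
    case (elim \<omega>)
    have "continuous_on {0..<1} (\<lambda>t. X x y t \<omega> - x - integral {0..t} (\<lambda>s. h s * (y - X x y s \<omega>)))"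
      by (intro continuous_intros elim(2) continuous_on_integral_Ico h)
    then have "continuous_on {0..<1} (\<lambda>t. I t \<omega>)"
      by (rule continuous_on_eq) (use elim(1) in auto)
    moreover have "\<forall>t\<in>{0..<1}. X x y t \<omega> = y + (x - y) * exp (- H t) + I t \<omega>
        - exp (- H t) * integral {0..t} (\<lambda>s. h s * exp (H s) * I s \<omega>)"
      using linear_integral_equation[OF h elim(2), of x y "\<lambda>t. I t \<omega>"] elim(1) unfolding H_def by auto
    ultimately show ?case using elim(2) unfolding variation_of_constants_def by blast
  qed
  with I show ?thesis by (rule that)
qed

text \<open>One version of the noise, taken from the solution with \<open>x = y = 0\<close>, serves
  as reference for all the others.\<close>

definition I where
  "I = (SOME J. (\<forall>t\<in>{0..<1}. is_ito_integral M F B \<sigma> t (J t)) \<and> (AE \<omega> in M. variation_of_constants 0 0 J \<omega>))"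

lemma I: "t \<in> {0..<1} \<Longrightarrow> is_ito_integral M F B \<sigma> t (I t)"
  and X00: "AE \<omega> in M. continuous_on {0..<1} (\<lambda>t. X 0 0 t \<omega>) \<and> continuous_on {0..<1} (\<lambda>t. I t \<omega>) \<and>
      (\<forall>t\<in>{0..<1}. X 0 0 t \<omega> = I t \<omega> - exp (- H t) * integral {0..t} (\<lambda>s. h s * exp (H s) * I s \<omega>))"
proof -
  have "\<exists>J. (\<forall>t\<in>{0..<1}. is_ito_integral M F B \<sigma> t (J t)) \<and> (AE \<omega> in M. variation_of_constants 0 0 J \<omega>)"
  proof -
    obtain J where "\<And>t. t \<in> {0..<1} \<Longrightarrow> is_ito_integral M F B \<sigma> t (J t)" "AE \<omega> in M. variation_of_constants 0 0 J \<omega>"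
      using noise_exists[of 0 0] by blast
    then show ?thesis by (intro exI[of _ J]) simp
  qed
  from someI_ex[OF this, folded I_def]
  have I: "\<forall>t\<in>{0..<1}. is_ito_integral M F B \<sigma> t (I t)" and voc: "AE \<omega> in M. variation_of_constants 0 0 I \<omega>"
    by blast+
  from I show "t \<in> {0..<1} \<Longrightarrow> is_ito_integral M F B \<sigma> t (I t)" by blast
  from voc show "AE \<omega> in M. continuous_on {0..<1} (\<lambda>t. X 0 0 t \<omega>) \<and> continuous_on {0..<1} (\<lambda>t. I t \<omega>) \<and>
      (\<forall>t\<in>{0..<1}. X 0 0 t \<omega> = I t \<omega> - exp (- H t) * integral {0..t} (\<lambda>s. h s * exp (H s) * I s \<omega>))"
    by eventually_elim (simp add: variation_of_constants_def)
qed

lemma I_martingale: "gaussian_martingale {0..<1} I V"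
  using ito_integral_gaussian_martingale[OF I \<sigma>] by (simp add: V_def[abs_def])

lemma I_cont: "AE \<omega> in M. continuous_on {0..<1} (\<lambda>t. I t \<omega>)"
  using X00 by auto

text \<open>Two versions of the noise agree almost surely at each fixed time, hence at all rational
  times simultaneously, and by continuity at all times outside a single null set. With equal noise,
  only the deterministic parts of two solutions differ.\<close>

lemma X_formula: "AE \<omega> in M. \<forall>t\<in>{0..<1}. X x y t \<omega> = y + (x - y) * exp (- H t) + X 0 0 t \<omega>"
proof -
  obtain I' where I': "\<And>t. t \<in> {0..<1} \<Longrightarrow> is_ito_integral M F B \<sigma> t (I' t)"
    and X: "AE \<omega> in M. variation_of_constants x y I' \<omega>"
    using noise_exists[of x y] by blast
  have "AE \<omega> in M. I' q \<omega> = I q \<omega>" if "q \<in> {0..<1}" for q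
  proof -
    have "continuous_on {0..q} \<sigma>" using that by (intro continuous_on_subset[OF \<sigma>]) auto
    then show ?thesis using ito_integral_unique[OF I'[OF that] I[OF that]] that by simp
  qed
  then have "AE \<omega> in M. \<forall>q\<in>\<rat> \<inter> {0..<1}. I' q \<omega> = I q \<omega>"
    by (subst AE_ball_countable) (auto intro: countable_subset[OF _ countable_rat])
  with X X00 show ?thesis
    unfolding variation_of_constants_def
  proof eventually_elim
    case (elim \<omega>)
    have eq: "I' t \<omega> = I t \<omega>" if "t \<in> {0..<1}" for t
    proof -
      have "I' t \<omega> - I t \<omega> \<in> {0}"
      proof (rule continuous_Ico_dense_closed[where a=0 and f="\<lambda>t. I' t \<omega> - I t \<omega>"])
        show "continuous_on {0..<1} (\<lambda>t. I' t \<omega> - I t \<omega>)" using elim by (intro continuous_on_diff) auto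
      qed (use elim that in auto)
      then show ?thesis by simp
    qed
    show ?case
    proof
      fix t :: real assume t: "t \<in> {0..<1}"
      have "integral {0..t} (\<lambda>s. h s * exp (H s) * I' s \<omega>) = integral {0..t} (\<lambda>s. h s * exp (H s) * I s \<omega>)"
        using eq t by (intro Henstock_Kurzweil_Integration.integral_cong) auto
      then show "X x y t \<omega> = y + (x - y) * exp (- H t) + X 0 0 t \<omega>"
        using elim t eq[OF t] by simp
    qed
  qed
qed

text \<open>\<open>N\<close> is a version of the Wiener integral of \<open>exp \<circ> H * \<sigma>\<close>.\<close>

definition N where "N t \<omega> = exp (H t) * X 0 0 t \<omega>"

lemma X_formula_N:
  "AE \<omega> in M. \<forall>t\<in>{0..<1}. X x y t \<omega> = (y + (x - y) * exp (- H t)) + exp (- H t) * N t \<omega>"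
  using X_formula[of x y] by eventually_elim (simp add: N_def exp_minus field_simps)

text \<open>Sums of \<open>exp H\<close> against increments of \<open>I\<close> are Gaussian and
  independent of \<open>F s\<close>. Pathwise they tend to \<open>N t - N s\<close> by summation by
  parts, while their variances are Stieltjes sums of \<open>(exp (H r))\<^sup>2\<close> against
  \<open>V\<close> and tend to \<open>U t - U s\<close>.\<close>

lemma N_martingale: "gaussian_martingale {0..<1} N U"
  unfolding gaussian_martingale_def
proof (intro conjI ballI impI)
  have adapted: "N t \<in> borel_measurable (F t)" if "t \<in> {0..<1}" for t
    unfolding N_def[abs_def] using X_adapted[OF that] by measurable
  then show "N t \<in> borel_measurable (F t)" if "t \<in> {0..<1}" for t using that .
  have I0: "AE \<omega> in M. I 0 \<omega> = 0" using I_martingale by (simp add: gaussian_martingale_def)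
  with X00 show "AE \<omega> in M. N 0 \<omega> = 0"
    by eventually_elim (auto simp: N_def)
  fix s t :: real assume st: "s \<in> {0..<1}" "t \<in> {0..<1}" "s \<le> t"
  define Y where "Y n \<omega> = (\<Sum>i<Suc n. exp (H (upart s t n i)) * (I (upart s t n (Suc i)) \<omega> - I (upart s t n i) \<omega>))" for n \<omega>
  define w where "w n = (\<Sum>i<Suc n. (exp (H (upart s t n i)))\<^sup>2 * (V (upart s t n (Suc i)) - V (upart s t n i)))" for n
  have cst: "continuous_on {s..t} f" if "continuous_on {0..<1} f" for f :: "real \<Rightarrow> real"
    using st by (intro continuous_on_subset[OF that]) auto
  show "indep_gaussian M (F s) (\<lambda>\<omega>. N t \<omega> - N s \<omega>) (U t - U s)"
  proof (rule indep_gaussian_AE_limit)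
    show "subalgebra M (F s)" using subalg st by auto
    show "(\<lambda>\<omega>. N t \<omega> - N s \<omega>) \<in> borel_measurable M"
      using F_measurable_M[OF adapted] st by (intro borel_measurable_diff) auto
    show "indep_gaussian M (F s) (Y n) (w n)" for n
      unfolding Y_def[abs_def] w_def using st
      by (intro indep_gaussian_upart_sum(1)) (auto intro!: gm_adapted[OF I_martingale] gm_increment[OF I_martingale])
    show "AE \<omega> in M. (\<lambda>n. Y n \<omega>) \<longlonglongrightarrow> N t \<omega> - N s \<omega>"
      using X00
    proof eventually_elim
      case (elim \<omega>)
      have hI: "continuous_on {0..<1} (\<lambda>r. I r \<omega> * (h r * exp (H r)))"
        using elim by (intro continuous_intros h H_cont) auto
      have "(\<lambda>n. Y n \<omega>) \<longlonglongrightarrow> exp (H t) * I t \<omega> - exp (H s) * I s \<omega> - integral {s..t} (\<lambda>r. I r \<omega> * (h r * exp (H r)))"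
        unfolding Y_def using st elim
        by (intro by_parts_sums cst hexp_cont hexp_integral) auto
      also have "integral {s..t} (\<lambda>r. I r \<omega> * (h r * exp (H r)))
          = integral {0..t} (\<lambda>r. h r * exp (H r) * I r \<omega>) - integral {0..s} (\<lambda>r. h r * exp (H r) * I r \<omega>)"
        using integral_diff_Ico[OF hI, of s t] st by (simp add: mult_ac)
      also have "exp (H t) * I t \<omega> - exp (H s) * I s \<omega> - \<dots> = N t \<omega> - N s \<omega>"
        using elim st by (simp add: N_def right_diff_distrib mult.assoc[symmetric] flip: exp_add)
      finally show ?case .
    qed
    have "(\<lambda>n. \<Sum>i<Suc n. (exp (H (upart s t n i)))\<^sup>2 * integral {upart s t n i..upart s t n (Suc i)} (\<lambda>r. (\<sigma> r)\<^sup>2))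
        \<longlonglongrightarrow> integral {s..t} (\<lambda>r. (exp (H r))\<^sup>2 * (\<sigma> r)\<^sup>2)"
      by (rule riemann_stieltjes_sums[OF st(3)])
        (auto intro!: cst \<sigma> \<sigma>2 continuous_intros H_cont intro: upart_mono[OF st(3)])
    also have "integral {s..t} (\<lambda>r. (exp (H r))\<^sup>2 * (\<sigma> r)\<^sup>2) = U t - U s"
      using integral_diff_Ico[OF U_integrand, of s t] st by (simp add: U_def)
    also have "(\<lambda>n. \<Sum>i<Suc n. (exp (H (upart s t n i)))\<^sup>2 * integral {upart s t n i..upart s t n (Suc i)} (\<lambda>r. (\<sigma> r)\<^sup>2)) = w"
    proof
      fix n
      show "(\<Sum>i<Suc n. (exp (H (upart s t n i)))\<^sup>2 * integral {upart s t n i..upart s t n (Suc i)} (\<lambda>r. (\<sigma> r)\<^sup>2)) = w n"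
        unfolding w_def
      proof (rule sum.cong)
        fix i assume "i \<in> {..<Suc n}"
        then have "0 \<le> upart s t n i" "upart s t n i \<le> upart s t n (Suc i)" "upart s t n (Suc i) < 1"
          using upart_bounds[OF st(3), of i n] upart_bounds[OF st(3), of "Suc i" n] upart_mono[OF st(3), of i "Suc i" n] st by auto
        then show "(exp (H (upart s t n i)))\<^sup>2 * integral {upart s t n i..upart s t n (Suc i)} (\<lambda>r. (\<sigma> r)\<^sup>2)
            = (exp (H (upart s t n i)))\<^sup>2 * (V (upart s t n (Suc i)) - V (upart s t n i))"
          using integral_diff_Ico[OF \<sigma>2, of "upart s t n i" "upart s t n (Suc i)"] by (simp only: V_def)
      qed simp
    qed
    finally show "w \<longlonglongrightarrow> U t - U s" .
  qed
qed auto

end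

section \<open>Convergence at the terminal time\<close>

context filtered_prob_space begin

text \<open>Decomposition by the first time of exceedance: on \<open>A t\<close> the later increment
  is orthogonal to \<open>D t\<close>, so the second moment can only grow up to the last time
  \<open>m\<close>. The bound \<open>C\<close> in place of the last variance is uniform in
  \<open>J\<close>, as the passage to countable sets requires.\<close>

lemma gm_kolmogorov_inequality_finite:
  assumes N: "gaussian_martingale T N U" and a: "a \<in> T" and J: "finite J" "J \<subseteq> T" "\<And>t. t \<in> J \<Longrightarrow> a \<le> t \<and> U t \<le> C"
    and \<epsilon>: "\<epsilon> > 0" and C: "U a \<le> C"
  shows "prob {\<omega> \<in> space M. \<exists>t\<in>J. \<bar>N t \<omega> - N a \<omega>\<bar> > \<epsilon>} \<le> (C - U a) / \<epsilon>\<^sup>2"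
proof (cases "J = {}")
  case True
  then show ?thesis using C by simp
next
  case False
  define m where "m = Max J"
  have m: "m \<in> J" "\<And>t. t \<in> J \<Longrightarrow> t \<le> m" using False J by (auto simp: m_def)
  define D where "D t \<omega> = N t \<omega> - N a \<omega>" for t \<omega>
  define A where "A t = {\<omega> \<in> space M. \<bar>D t \<omega>\<bar> > \<epsilon> \<and> (\<forall>s\<in>J. s < t \<longrightarrow> \<bar>D s \<omega>\<bar> \<le> \<epsilon>)}" for t
  note [measurable] = gm_measurable[OF N]
  have aT: "0 \<le> a" "a \<le> 1" using gm_times[OF N] a by auto
  have JT: "t \<in> T" "0 \<le> t" "t \<le> 1" "a \<le> t" if "t \<in> J" for t using gm_times[OF N] that J by auto
  have DF: "D s \<in> borel_measurable (F t)" if "s \<in> J" "s \<le> t" "t \<le> 1" for s t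
    unfolding D_def[abs_def] using that JT[OF that(1)] aT a
    by (intro borel_measurable_diff F_measurable_mono[OF gm_adapted[OF N]]) auto
  have [measurable]: "D t \<in> borel_measurable M" if "t \<in> J" for t
    using F_measurable_M[OF DF[OF that order_refl]] JT[OF that] by auto
  have AF: "A t \<in> sets (F t)" if t: "t \<in> J" for t
  proof -
    have sp: "space M = space (F t)" using F_space JT[OF t] by auto
    have "A t = {\<omega> \<in> space (F t). \<epsilon> < \<bar>D t \<omega>\<bar> \<and> (\<forall>s\<in>J \<inter> {..<t}. \<bar>D s \<omega>\<bar> \<le> \<epsilon>)}"
      unfolding A_def sp by auto
    also have "\<dots> \<in> sets (F t)"
      using J(1) JT[OF t] t
      by (intro sets.sets_Collect_conj sets.sets_Collect_finite_All borel_measurable_le borel_measurable_less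
          borel_measurable_abs borel_measurable_const DF) auto
    finally show ?thesis .
  qed
  have AM [measurable]: "A t \<in> events" if "t \<in> J" for t
    using AF[OF that] subalg[of t] JT[OF that] by (auto simp: subalgebra_def)
  have sq: "integrable M (\<lambda>\<omega>. (D t \<omega>)\<^sup>2)" "expectation (\<lambda>\<omega>. (D t \<omega>)\<^sup>2) = U t - U a" "integrable M (D t)" if "t \<in> J" for t
    using indep_gaussian_moments[OF subalg gm_increment[OF N a, of t]] JT[OF that] aT unfolding D_def by auto
  have key: "\<epsilon>\<^sup>2 * prob (A t) \<le> expectation (\<lambda>\<omega>. indicator (A t) \<omega> * (D m \<omega>)\<^sup>2)" if t: "t \<in> J" for t
  proof -
    \<comment> \<open>\<open>W\<close> carries the cross term when \<open>D m\<close> is expanded as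
      \<open>D t\<close> plus an increment; multiplied by that increment it has mean zero.\<close>
    define W where "W \<omega> = indicator (A t) \<omega> * D t \<omega>" for \<omega>
    have sub: "subalgebra M (F t)" using subalg JT[OF t] by auto
    have inc: "indep_gaussian M (F t) (\<lambda>\<omega>. N m \<omega> - N t \<omega>) (U m - U t)"
      using gm_increment[OF N] m t JT by auto
    have W: "W \<in> borel_measurable (F t)" "integrable M W"
      unfolding W_def using AF[OF t] DF[OF t order_refl] JT[OF t] sq(3)[OF t] AM[OF t] integrable_real_mult_indicator[of "A t" M "D t"]
      by (auto simp: mult.commute)
    note o = indep_gaussian_orthogonal(1,2)[OF sub inc W]
    have i1: "integrable M (\<lambda>\<omega>. indicator (A t) \<omega> * (D t \<omega>)\<^sup>2)" "integrable M (\<lambda>\<omega>. indicator (A t) \<omega> * (D m \<omega>)\<^sup>2)"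
      using integrable_real_mult_indicator[OF AM[OF t] sq(1)] t m by (auto simp: mult.commute)
    have "\<epsilon>\<^sup>2 * prob (A t) = expectation (\<lambda>\<omega>. \<epsilon>\<^sup>2 * indicator (A t) \<omega>)"
      using AM[OF t] by simp
    also have "\<dots> \<le> expectation (\<lambda>\<omega>. indicator (A t) \<omega> * (D t \<omega>)\<^sup>2)"
    proof (intro integral_mono i1)
      show "integrable M (\<lambda>\<omega>. \<epsilon>\<^sup>2 * indicator (A t) \<omega>)" using AM[OF t] by (simp add: emeasure_eq_measure)
      fix \<omega>
      have "\<epsilon>\<^sup>2 \<le> (D t \<omega>)\<^sup>2" if "\<omega> \<in> A t" using that \<epsilon> by (auto simp: A_def abs_le_square_iff[symmetric])
      then show "\<epsilon>\<^sup>2 * indicator (A t) \<omega> \<le> indicator (A t) \<omega> * (D t \<omega>)\<^sup>2" by (auto simp: indicator_def)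
    qed
    also have "\<dots> = expectation (\<lambda>\<omega>. indicator (A t) \<omega> * (D t \<omega>)\<^sup>2 + 2 * (W \<omega> * (N m \<omega> - N t \<omega>)))"
      using o i1 by simp
    also have "\<dots> \<le> expectation (\<lambda>\<omega>. indicator (A t) \<omega> * (D m \<omega>)\<^sup>2)"
    proof (intro integral_mono i1)
      show "integrable M (\<lambda>\<omega>. indicator (A t) \<omega> * (D t \<omega>)\<^sup>2 + 2 * (W \<omega> * (N m \<omega> - N t \<omega>)))" using o i1 by simp
      fix \<omega>
      have "indicator (A t) \<omega> * (D m \<omega>)\<^sup>2 = indicator (A t) \<omega> * (D t \<omega>)\<^sup>2 + 2 * (W \<omega> * (N m \<omega> - N t \<omega>))
          + indicator (A t) \<omega> * (N m \<omega> - N t \<omega>)\<^sup>2"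
        by (simp add: W_def D_def power2_eq_square algebra_simps)
      then show "indicator (A t) \<omega> * (D t \<omega>)\<^sup>2 + 2 * (W \<omega> * (N m \<omega> - N t \<omega>)) \<le> indicator (A t) \<omega> * (D m \<omega>)\<^sup>2"
        by simp
    qed
    finally show ?thesis .
  qed
  have disj: "disjoint_family_on A J"
    unfolding disjoint_family_on_def
  proof (intro ballI impI equals0I)
    fix s t \<omega> assume st: "s \<in> J" "t \<in> J" "s \<noteq> t" and "\<omega> \<in> A s \<inter> A t"
    moreover consider "s < t" | "t < s" using st(3) by linarith
    ultimately show False by cases (force simp: A_def)+
  qed
  have "{\<omega> \<in> space M. \<exists>t\<in>J. \<bar>D t \<omega>\<bar> > \<epsilon>} \<subseteq> (\<Union>t\<in>J. A t)"
  proof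
    fix \<omega> assume "\<omega> \<in> {\<omega> \<in> space M. \<exists>t\<in>J. \<bar>D t \<omega>\<bar> > \<epsilon>}"
    then have \<omega>: "\<omega> \<in> space M" and ne: "{t\<in>J. \<bar>D t \<omega>\<bar> > \<epsilon>} \<noteq> {}" by auto
    define t where "t = Min {t\<in>J. \<bar>D t \<omega>\<bar> > \<epsilon>}"
    have "t \<in> {t\<in>J. \<bar>D t \<omega>\<bar> > \<epsilon>}" unfolding t_def using J(1) ne by (intro Min_in) auto
    moreover have "\<bar>D s \<omega>\<bar> \<le> \<epsilon>" if "s \<in> J" "s < t" for s
    proof (rule ccontr)
      assume "\<not> \<bar>D s \<omega>\<bar> \<le> \<epsilon>"
      then have "t \<le> s" unfolding t_def using that J(1) by (intro Min_le) auto
      with that show False by simp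
    qed
    ultimately show "\<omega> \<in> (\<Union>t\<in>J. A t)" using \<omega> by (auto simp: A_def)
  qed
  then have "prob {\<omega> \<in> space M. \<exists>t\<in>J. \<bar>D t \<omega>\<bar> > \<epsilon>} \<le> prob (\<Union>t\<in>J. A t)"
    using J(1) AM by (intro finite_measure_mono sets.finite_UN) auto
  also have "\<dots> \<le> (\<Sum>t\<in>J. prob (A t))" using J(1) AM by (intro measure_UNION_le) auto
  finally have "\<epsilon>\<^sup>2 * prob {\<omega> \<in> space M. \<exists>t\<in>J. \<bar>D t \<omega>\<bar> > \<epsilon>} \<le> \<epsilon>\<^sup>2 * (\<Sum>t\<in>J. prob (A t))"
    by (intro mult_left_mono) auto
  also have "\<dots> \<le> (\<Sum>t\<in>J. expectation (\<lambda>\<omega>. indicator (A t) \<omega> * (D m \<omega>)\<^sup>2))"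
    unfolding sum_distrib_left by (intro sum_mono key)
  also have "\<dots> = expectation (\<lambda>\<omega>. \<Sum>t\<in>J. indicator (A t) \<omega> * (D m \<omega>)\<^sup>2)"
    using integrable_real_mult_indicator[OF AM sq(1)[OF m(1)]]
    by (intro Bochner_Integration.integral_sum[symmetric]) (simp add: mult.commute)
  also have "\<dots> \<le> expectation (\<lambda>\<omega>. (D m \<omega>)\<^sup>2)"
  proof (intro integral_mono sq m)
    show "integrable M (\<lambda>\<omega>. \<Sum>t\<in>J. indicator (A t) \<omega> * (D m \<omega>)\<^sup>2)"
      using integrable_real_mult_indicator[OF AM sq(1)[OF m(1)]]
      by (intro Bochner_Integration.integrable_sum) (simp add: mult.commute)
    fix \<omega>
    have "(\<Sum>t\<in>J. indicat_real (A t) \<omega>) = indicat_real (\<Union>t\<in>J. A t) \<omega>"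
      by (rule indicator_UN_disjoint[symmetric]) (use J disj in auto)
    also have "\<dots> \<le> 1" by (simp add: indicator_def)
    finally have "(\<Sum>t\<in>J. indicat_real (A t) \<omega>) * (D m \<omega>)\<^sup>2 \<le> 1 * (D m \<omega>)\<^sup>2" by (intro mult_right_mono) auto
    then show "(\<Sum>t\<in>J. indicator (A t) \<omega> * (D m \<omega>)\<^sup>2) \<le> (D m \<omega>)\<^sup>2" by (simp only: sum_distrib_right mult_1)
  qed
  also have "\<dots> \<le> C - U a" using sq(2)[OF m(1)] J(3)[OF m(1)] by simp
  finally show ?thesis using \<epsilon> unfolding D_def by (simp add: le_divide_eq mult.commute)
qed

text \<open>Finite initial parts of an enumeration of \<open>Q\<close> give increasing events with a
  common bound.\<close>

lemma gm_kolmogorov_inequality: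
  assumes N: "gaussian_martingale T N U" and a: "a \<in> T" and Q: "countable Q" "Q \<subseteq> T" "\<And>t. t \<in> Q \<Longrightarrow> a \<le> t \<and> U t \<le> C"
    and \<epsilon>: "\<epsilon> > 0" and C: "U a \<le> C"
  shows "{\<omega> \<in> space M. \<exists>t\<in>Q. \<bar>N t \<omega> - N a \<omega>\<bar> > \<epsilon>} \<in> events"
    "prob {\<omega> \<in> space M. \<exists>t\<in>Q. \<bar>N t \<omega> - N a \<omega>\<bar> > \<epsilon>} \<le> (C - U a) / \<epsilon>\<^sup>2"
proof -
  note [measurable] = gm_measurable[OF N a]
  have ev [measurable]: "{\<omega> \<in> space M. \<exists>t\<in>Q'. \<bar>N t \<omega> - N a \<omega>\<bar> > \<epsilon>} \<in> events" if "Q' \<subseteq> Q" for Q'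
  proof -
    have [simp]: "countable Q'" using that Q(1) by (rule countable_subset)
    have [measurable]: "N t \<in> borel_measurable M" if "t \<in> Q'" for t
      using gm_measurable[OF N, of t] that \<open>Q' \<subseteq> Q\<close> Q(2) by auto
    show ?thesis by measurable
  qed
  from ev[of Q] show "{\<omega> \<in> space M. \<exists>t\<in>Q. \<bar>N t \<omega> - N a \<omega>\<bar> > \<epsilon>} \<in> events" by simp
  show "prob {\<omega> \<in> space M. \<exists>t\<in>Q. \<bar>N t \<omega> - N a \<omega>\<bar> > \<epsilon>} \<le> (C - U a) / \<epsilon>\<^sup>2"
  proof (cases "Q = {}")
    case True
    then show ?thesis using C by simp
  next
    case False
    define J where "J n = from_nat_into Q ` {..n}" for n :: nat
    have J: "finite (J n)" "J n \<subseteq> Q" for n using from_nat_into[OF False] by (auto simp: J_def)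
    define E where "E n = {\<omega> \<in> space M. \<exists>t\<in>J n. \<bar>N t \<omega> - N a \<omega>\<bar> > \<epsilon>}" for n
    have "(\<lambda>n. prob (E n)) \<longlonglongrightarrow> prob (\<Union>n. E n)"
      using ev[OF J(2)] by (intro finite_Lim_measure_incseq) (auto simp: E_def incseq_def J_def)
    moreover have "(\<Union>n. E n) = {\<omega> \<in> space M. \<exists>t\<in>Q. \<bar>N t \<omega> - N a \<omega>\<bar> > \<epsilon>}"
    proof -
      have "(\<Union>n. J n) = range (from_nat_into Q)" unfolding J_def by blast
      then have "Q = (\<Union>n. J n)" using range_from_nat_into[OF False Q(1)] by simp
      then show ?thesis by (auto simp: E_def)
    qed
    moreover have "prob (E n) \<le> (C - U a) / \<epsilon>\<^sup>2" for n
      unfolding E_def using J[of n] Q by (intro gm_kolmogorov_inequality_finite[OF N a _ _ _ \<epsilon> C]) auto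
    ultimately show ?thesis by (intro LIMSEQ_le_const2) auto
  qed
qed

end

section \<open>Limits from the left at time 1\<close>

definition approach :: "nat \<Rightarrow> real" where "approach n = 1 - 1 / real (Suc n)"

lemma approach: "approach n \<in> {0..<1}" "approach \<longlonglongrightarrow> 1" "filterlim approach (at_left 1) sequentially"
proof -
  show 1: "approach n \<in> {0..<1}" for n by (simp add: approach_def divide_le_eq)
  have "(\<lambda>n. 1 - 1 / real (Suc n)) \<longlonglongrightarrow> 1 - 0"
    by (intro tendsto_intros lim_inverse_n'[THEN LIMSEQ_Suc])
  then show 2: "approach \<longlonglongrightarrow> 1" by (simp add: approach_def[abs_def])
  show "filterlim approach (at_left 1) sequentially"
    unfolding filterlim_at using 1 2 by (auto intro!: always_eventually simp: less_le)
qed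

text \<open>The value at a single time \<open>a\<close> serves as a pivot, first for the Cauchy
  property along \<open>approach\<close> and then for all times after \<open>a\<close>.\<close>

lemma convergent_at_left_if_oscillation:
  fixes f :: "real \<Rightarrow> real"
  assumes osc: "\<And>e. e > 0 \<Longrightarrow> \<exists>a<1. \<forall>t\<in>{a..<1}. \<bar>f t - f a\<bar> \<le> e"
  shows "\<exists>L. (f \<longlongrightarrow> L) (at_left 1)"
proof -
  have ev: "\<forall>\<^sub>F n in sequentially. approach n \<in> {a..<1}" if "a < 1" for a
    using order_tendstoD(1)[OF approach(2) that] approach(1) by (auto elim!: eventually_mono)
  have "Cauchy (\<lambda>n. f (approach n))"
  proof (rule metric_CauchyI)
    fix e :: real assume "e > 0"
    then obtain a where a: "a < 1" "\<And>t. t \<in> {a..<1} \<Longrightarrow> \<bar>f t - f a\<bar> \<le> e / 3" using osc[of "e / 3"] by auto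
    obtain n0 where n0: "\<And>n. n \<ge> n0 \<Longrightarrow> approach n \<in> {a..<1}"
      using ev[OF a(1)] unfolding eventually_sequentially by blast
    have "dist (f (approach m)) (f (approach n)) < e" if "m \<ge> n0" "n \<ge> n0" for m n
      using a(2)[OF n0[OF that(1)]] a(2)[OF n0[OF that(2)]] \<open>e > 0\<close> unfolding dist_real_def by linarith
    then show "\<exists>n0. \<forall>m\<ge>n0. \<forall>n\<ge>n0. dist (f (approach m)) (f (approach n)) < e" by blast
  qed
  then obtain L where L: "(\<lambda>n. f (approach n)) \<longlonglongrightarrow> L" using real_Cauchy_convergent convergent_def by blast
  have "(f \<longlongrightarrow> L) (at_left 1)"
  proof (rule tendstoI)
    fix e :: real assume "e > 0"
    then obtain a where a: "a < 1" "\<And>t. t \<in> {a..<1} \<Longrightarrow> \<bar>f t - f a\<bar> \<le> e / 3" using osc[of "e / 3"] by auto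
    have "(\<lambda>n. \<bar>f (approach n) - f a\<bar>) \<longlonglongrightarrow> \<bar>L - f a\<bar>" by (intro tendsto_intros L)
    then have La: "\<bar>L - f a\<bar> \<le> e / 3"
      by (rule tendsto_upperbound) (use ev[OF a(1)] a(2) in \<open>auto elim!: eventually_mono\<close>)
    have "\<forall>\<^sub>F t in at_left 1. t \<in> {a<..<1}" using a(1) by (rule eventually_at_left_real)
    then show "\<forall>\<^sub>F t in at_left 1. dist (f t) L < e"
    proof eventually_elim
      case (elim t)
      then have "\<bar>f t - f a\<bar> \<le> e / 3" by (intro a(2)) auto
      then show ?case using La \<open>e > 0\<close> unfolding dist_real_def by linarith
    qed
  qed
  then show ?thesis by blast
qed

lemma strict_increase_Ico:
  assumes f: "continuous_on {0..<1} f" "\<And>t. t \<in> {0..<1} \<Longrightarrow> (f has_real_derivative f' t) (at t within {0..<1})"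
    and pos: "\<And>t. t \<in> {0..<1} \<Longrightarrow> f' t > 0" and st: "0 \<le> s" "s < t" "t < 1"
  shows "f s < f t"
proof (rule DERIV_pos_imp_increasing_open[OF st(2)])
  fix x assume x: "s < x" "x < t"
  then have "(f has_real_derivative f' x) (at x)"
    using f(2)[of x] st by (simp add: at_within_interior[of x "{0..<1}"])
  then show "\<exists>y. (f has_real_derivative y) (at x) \<and> y > 0" using pos[of x] x st by auto
qed (use st in \<open>auto intro!: continuous_on_subset[OF f(1)]\<close>)

context linear_sde begin

lemma V_strict: "0 \<le> s \<Longrightarrow> s < t \<Longrightarrow> t < 1 \<Longrightarrow> V s < V t"
  using \<sigma>_pos by (intro strict_increase_Ico[OF V_cont V_deriv]) force+

lemma U_cont: "continuous_on {0..<1} U"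
  unfolding U_def[abs_def] by (rule continuous_on_integral_Ico[OF U_integrand])

lemma U_strict: "0 \<le> s \<Longrightarrow> s < t \<Longrightarrow> t < 1 \<Longrightarrow> U s < U t"
  using \<sigma>_pos by (intro strict_increase_Ico[OF U_cont U_deriv]) force+

text \<open>Passing to the limit preserves only the weak inequality; the intermediate time
  \<open>u\<close> makes it strict. The strictness keeps the denominator \<open>S - V t\<close>
  positive.\<close>

lemma V_less_limit:
  assumes S: "(V \<longlongrightarrow> S) (at_left 1)" and t: "0 \<le> t" "t < 1"
  shows "V t < S"
proof -
  obtain u where u: "t < u" "u < 1" using dense[OF t(2)] by blast
  have "\<forall>\<^sub>F r in at_left 1. r \<in> {u<..<1}" using u(2) by (rule eventually_at_left_real)
  then have "\<forall>\<^sub>F r in at_left 1. V u \<le> V r"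
    by eventually_elim (use V_strict[of u] t u in \<open>auto intro!: less_imp_le\<close>)
  then have "V u \<le> S" by (intro tendsto_lowerbound[OF S]) auto
  with V_strict[OF t(1) u] show ?thesis by simp
qed

text \<open>Kolmogorov's inequality makes the probability of \<open>E m n\<close> vanish as
  \<open>n\<close> grows, because \<open>V (approach n)\<close> exhausts \<open>S\<close>. So for
  almost every path and each \<open>m\<close> there is a time after which the path stays within
  \<open>1 / real (Suc m)\<close> of its value there, first at rational times and then, by
  continuity, always.\<close>

lemma I_converges:
  assumes S: "(V \<longlongrightarrow> S) (at_left 1)"
  shows "AE \<omega> in M. \<exists>L. ((\<lambda>t. I t \<omega>) \<longlongrightarrow> L) (at_left 1)"
proof -
  define Q where "Q n = \<rat> \<inter> {approach n..<1}" for n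
  define E where "E m n = {\<omega> \<in> space M. \<exists>t\<in>Q n. \<bar>I t \<omega> - I (approach n) \<omega>\<bar> > 1 / real (Suc m)}" for m n
  have Q: "countable (Q n)" "Q n \<subseteq> {0..<1}" "\<And>t. t \<in> Q n \<Longrightarrow> approach n \<le> t \<and> V t \<le> S" for n
    using approach(1)[of n] V_less_limit[OF S]
    by (auto simp: Q_def intro: countable_subset[OF _ countable_rat] less_imp_le)
  have le: "V (approach n) \<le> S" for n using V_less_limit[OF S] approach(1)[of n] by (auto intro: less_imp_le)
  have E: "E m n \<in> events" "prob (E m n) \<le> (S - V (approach n)) / (1 / real (Suc m))\<^sup>2" for m n
    unfolding E_def by (rule gm_kolmogorov_inequality[OF I_martingale approach(1) Q _ le]; simp)+
  have "AE \<omega> in M. \<exists>n. \<omega> \<notin> E m n" for m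
  proof -
    have sub: "(\<Inter>n. E m n) \<in> events" using E by auto
    have "(\<lambda>n. V (approach n)) \<longlonglongrightarrow> S" by (rule filterlim_compose[OF S approach(3)])
    then have "(\<lambda>n. (S - V (approach n)) / (1 / real (Suc m))\<^sup>2) \<longlonglongrightarrow> (S - S) / (1 / real (Suc m))\<^sup>2"
      by (intro tendsto_intros) auto
    moreover have "prob (\<Inter>n. E m n) \<le> (S - V (approach n)) / (1 / real (Suc m))\<^sup>2" for n
      using finite_measure_mono[of "\<Inter>n. E m n" "E m n"] E[of m n] by fastforce
    ultimately have "prob (\<Inter>n. E m n) \<le> (S - S) / (1 / real (Suc m))\<^sup>2"
      by (intro LIMSEQ_le_const) blast+
    then have "prob (\<Inter>n. E m n) = 0" by (simp add: measure_le_0_iff)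
    then have "(\<Inter>n. E m n) \<in> null_sets M" using sub by (simp add: null_sets_def emeasure_eq_measure)
    from AE_not_in[OF this] show ?thesis by eventually_elim blast
  qed
  then have "AE \<omega> in M. \<forall>m. \<exists>n. \<omega> \<notin> E m n" by (simp add: AE_all_countable)
  with I_cont AE_space show ?thesis
  proof eventually_elim
    case (elim \<omega>)
    show ?case
    proof (rule convergent_at_left_if_oscillation)
      fix e :: real assume "e > 0"
      then obtain m where m: "1 / real (Suc m) < e" using nat_approx_posE by blast
      obtain n where n: "\<omega> \<notin> E m n" using elim by blast
      have "\<bar>I t \<omega> - I (approach n) \<omega>\<bar> \<le> e" if t: "t \<in> {approach n..<1}" for t
      proof -
        have "I t \<omega> \<in> cball (I (approach n) \<omega>) (1 / real (Suc m))"
        proof (rule continuous_Ico_dense_closed[OF elim(1) _ _ _ t])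
          show "0 \<le> approach n" using approach(1)[of n] by simp
          fix q assume "q \<in> \<rat>" "q \<in> {approach n..<1}"
          then show "I q \<omega> \<in> cball (I (approach n) \<omega>) (1 / real (Suc m))"
            using n elim by (auto simp: E_def Q_def dist_real_def not_less abs_minus_commute)
        qed simp
        then show ?thesis using m by (simp add: dist_real_def abs_minus_commute)
      qed
      then show "\<exists>a<1. \<forall>t\<in>{a..<1}. \<bar>I t \<omega> - I a \<omega>\<bar> \<le> e"
        using approach(1)[of n] by (intro exI[of _ "approach n"]) auto
    qed
  qed
qed

text \<open>For \<open>h \<ge> 0\<close> the weights have total mass at most 1 and this is an
  averaging argument. The lower bound \<open>- K\<close> admits a negative part, controlled by
  \<open>\<bar>h s\<bar> \<le> h s + 2 * K\<close> and \<open>H s \<le> H t + K\<close>.\<close>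

lemma weighted_average_vanishes:
  fixes g :: "real \<Rightarrow> real"
  assumes g: "continuous_on {0..<1} g" "(g \<longlongrightarrow> 0) (at_left 1)"
    and K: "\<And>t. t \<in> {0..<1} \<Longrightarrow> - K \<le> h t" "0 \<le> K" and Hinf: "filterlim H at_top (at_left 1)"
  shows "((\<lambda>t. exp (- H t) * integral {0..t} (\<lambda>s. h s * exp (H s) * g s)) \<longlongrightarrow> 0) (at_left 1)"
proof (rule tendstoI)
  fix e :: real assume "e > 0"
  \<comment> \<open>\<open>c * exp (H t)\<close> bounds the mass of the weights on
    \<open>{a..t}\<close>: the 1 comes from the exact integral of \<open>h * exp H\<close>, the rest
    from the correction for negative \<open>h\<close>.\<close>
  define c where "c = 1 + 2 * K * exp K"
  have c: "c > 0" unfolding c_def using K(2) by (intro add_pos_nonneg) auto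
  define \<delta> where "\<delta> = e / (2 * c)"
  have \<delta>: "\<delta> > 0" "\<delta> * c = e / 2" using \<open>e > 0\<close> c by (auto simp: \<delta>_def)
  have "\<forall>\<^sub>F t in at_left 1. dist (g t) 0 < \<delta>" using g(2) \<delta>(1) by (rule tendstoD)
  then obtain b where b: "b < 1" "\<And>t. b < t \<Longrightarrow> t < 1 \<Longrightarrow> \<bar>g t\<bar> < \<delta>"
    unfolding eventually_at_left_field by (auto simp: dist_real_def)
  \<comment> \<open>The midpoint of \<open>max b 0\<close> and 1 is nonnegative and lies beyond
    \<open>b\<close>.\<close>
  define a where "a = (max b 0 + 1) / 2"
  have a: "0 \<le> a" "a < 1" "\<And>t. a \<le> t \<Longrightarrow> t < 1 \<Longrightarrow> \<bar>g t\<bar> \<le> \<delta>"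
    using b by (auto simp: a_def intro!: less_imp_le[OF b(2)])
  define C where "C = \<bar>integral {0..a} (\<lambda>s. h s * exp (H s) * g s)\<bar>"
  have c1: "continuous_on {0..<1} (\<lambda>s. h s * exp (H s) * g s)" by (intro continuous_intros h H_cont g)
  have c2: "continuous_on {0..<1} (\<lambda>s. exp (H s))" by (intro continuous_intros H_cont)
  have "((\<lambda>t. exp (- H t)) \<longlongrightarrow> 0) (at_left 1)"
    using Hinf by (intro filterlim_compose[OF exp_at_bot]) (simp add: filterlim_uminus_at_bot)
  then have "((\<lambda>t. C * exp (- H t)) \<longlongrightarrow> C * 0) (at_left 1)" by (intro tendsto_intros)
  then have "\<forall>\<^sub>F t in at_left 1. C * exp (- H t) < e / 2" using \<open>e > 0\<close> by (intro order_tendstoD) auto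
  moreover have "\<forall>\<^sub>F t in at_left 1. t \<in> {a<..<1}" using a(2) by (rule eventually_at_left_real)
  ultimately show "\<forall>\<^sub>F t in at_left 1. dist (exp (- H t) * integral {0..t} (\<lambda>s. h s * exp (H s) * g s)) 0 < e"
  proof eventually_elim
    case (elim t)
    then have t: "a \<le> t" "t < 1" "0 \<le> t" using a by auto
    \<comment> \<open>Over a time span of at most 1, \<open>h \<ge> - K\<close> lets
      \<open>H\<close> fall by at most \<open>K\<close>.\<close>
    have Hle: "H s \<le> H t + K" if s: "s \<in> {a..t}" for s
    proof -
      have "H t - H s = integral {s..t} h"
        unfolding H_def using s a t by (intro integral_diff_Ico[symmetric] h) auto
      also have "\<dots> \<ge> integral {s..t} (\<lambda>_. - K)"
        using s a t K by (intro integral_le integrable_Ico[OF h] integrable_const_ivl) auto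
      moreover have "integral {s..t} (\<lambda>_. - K) = - (K * (t - s))" using s by simp
      moreover have "K * (t - s) \<le> K * 1" using s a t K by (intro mult_left_mono) auto
      ultimately show ?thesis by linarith
    qed
    have "norm (integral {a..t} (\<lambda>s. h s * exp (H s) * g s))
      \<le> integral {a..t} (\<lambda>s. \<delta> * (h s * exp (H s) + 2 * K * exp (H t + K)))"
    proof (rule integral_norm_bound_integral)
      show "(\<lambda>s. h s * exp (H s) * g s) integrable_on {a..t}" using a t by (intro integrable_Ico[OF c1]) auto
      show "(\<lambda>s. \<delta> * (h s * exp (H s) + 2 * K * exp (H t + K))) integrable_on {a..t}"
        using a t by (intro integrable_on_mult_right integrable_add integrable_Ico[OF hexp_cont] integrable_const_ivl) auto
      fix s assume s: "s \<in> {a..t}"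
      have "\<bar>h s\<bar> \<le> h s + 2 * K" using K(1)[of s] K(2) s a t by auto
      then have "\<bar>h s\<bar> * exp (H s) \<le> (h s + 2 * K) * exp (H s)" by (intro mult_right_mono) auto
      also have "\<dots> \<le> h s * exp (H s) + 2 * K * exp (H t + K)"
        unfolding distrib_right using Hle[OF s] K(2) by (intro add_left_mono mult_left_mono) auto
      finally have *: "\<bar>h s\<bar> * exp (H s) \<le> h s * exp (H s) + 2 * K * exp (H t + K)" .
      moreover have "0 \<le> h s * exp (H s) + 2 * K * exp (H t + K)" by (rule order_trans[OF _ *]) simp
      ultimately have "\<bar>h s\<bar> * exp (H s) * \<bar>g s\<bar> \<le> (h s * exp (H s) + 2 * K * exp (H t + K)) * \<delta>"
        using a(3)[of s] s t by (intro mult_mono) auto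
      then show "norm (h s * exp (H s) * g s) \<le> \<delta> * (h s * exp (H s) + 2 * K * exp (H t + K))"
        by (simp add: abs_mult mult_ac)
    qed
    also have "\<dots> = \<delta> * (exp (H t) - exp (H a) + (t - a) * (2 * K * exp (H t + K)))"
    proof -
      have "integral {a..t} (\<lambda>s. h s * exp (H s) + 2 * K * exp (H t + K)) = exp (H t) - exp (H a) + (t - a) * (2 * K * exp (H t + K))"
        using a t by (subst Henstock_Kurzweil_Integration.integral_add)
          (auto simp: hexp_integral intro!: integrable_Ico[OF hexp_cont])
      then show ?thesis by simp
    qed
    also have "\<dots> \<le> \<delta> * (exp (H t) + 1 * (2 * K * exp (H t + K)))"
      using \<delta> a t K by (intro mult_left_mono add_mono mult_right_mono) auto
    also have "\<dots> = exp (H t) * (\<delta> * c)" by (simp add: c_def exp_add algebra_simps)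
    finally have 1: "\<bar>integral {a..t} (\<lambda>s. h s * exp (H s) * g s)\<bar> \<le> exp (H t) * (e / 2)" using \<delta> by simp
    have "integral {0..t} (\<lambda>s. h s * exp (H s) * g s) = integral {0..a} (\<lambda>s. h s * exp (H s) * g s) + integral {a..t} (\<lambda>s. h s * exp (H s) * g s)"
      using integral_diff_Ico[OF c1, of a t] a t by simp
    then have "\<bar>integral {0..t} (\<lambda>s. h s * exp (H s) * g s)\<bar> \<le> C + exp (H t) * (e / 2)"
      using 1 unfolding C_def by linarith
    then have "exp (- H t) * \<bar>integral {0..t} (\<lambda>s. h s * exp (H s) * g s)\<bar> \<le> exp (- H t) * (C + exp (H t) * (e / 2))"
      by (intro mult_left_mono) auto
    also have "\<dots> = C * exp (- H t) + e / 2" by (simp add: distrib_left exp_minus_inverse mult.commute exp_minus)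
    also have "\<dots> < e" using elim by simp
    finally show ?case by (simp add: dist_real_def abs_mult)
  qed
qed

text \<open>The noise tends to some \<open>L\<close>, not to 0, so
  \<open>weighted_average_vanishes\<close> is applied to \<open>I - L\<close>. The constant
  \<open>L\<close> leaves only \<open>L * exp (- H t)\<close>, because \<open>h * exp H\<close>
  integrates to \<open>exp (H t) - 1\<close>.\<close>

lemma pinned_if_bounded_below:
  assumes K: "\<And>t. t \<in> {0..<1} \<Longrightarrow> K \<le> h t" and Hinf: "filterlim H at_top (at_left 1)" and S: "(V \<longlongrightarrow> S) (at_left 1)"
  shows "pinned M X"
  unfolding pinned_def
proof (intro allI)
  fix x y
  have K': "- \<bar>K\<bar> \<le> h t" if "t \<in> {0..<1}" for t using K[OF that] by linarith
  have e0: "((\<lambda>t. exp (- H t)) \<longlongrightarrow> 0) (at_left 1)"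
    using Hinf by (intro filterlim_compose[OF exp_at_bot]) (simp add: filterlim_uminus_at_bot)
  show "AE \<omega> in M. ((\<lambda>t. X x y t \<omega>) \<longlongrightarrow> y) (at_left 1)"
    using X_formula[of x y] X00 I_converges[OF S]
  proof eventually_elim
    case (elim \<omega>)
    then obtain L where L: "((\<lambda>t. I t \<omega>) \<longlongrightarrow> L) (at_left 1)" by blast
    have ci: "continuous_on {0..<1} (\<lambda>t. I t \<omega>)" using elim by blast
    have w: "((\<lambda>t. exp (- H t) * integral {0..t} (\<lambda>s. h s * exp (H s) * (I s \<omega> - L))) \<longlongrightarrow> 0) (at_left 1)"
    proof (rule weighted_average_vanishes[OF _ _ K' _ Hinf])
      show "continuous_on {0..<1} (\<lambda>t. I t \<omega> - L)" by (intro continuous_intros ci)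
      show "((\<lambda>t. I t \<omega> - L) \<longlongrightarrow> 0) (at_left 1)" using L by (simp add: LIM_zero)
    qed auto
    have "((\<lambda>t. y + (x - y) * exp (- H t) + (I t \<omega> - L) + L * exp (- H t)
       - exp (- H t) * integral {0..t} (\<lambda>s. h s * exp (H s) * (I s \<omega> - L))) \<longlongrightarrow> y + (x - y) * 0 + (L - L) + L * 0 - 0) (at_left 1)"
      by (intro tendsto_intros L w e0)
    then have lim: "((\<lambda>t. y + (x - y) * exp (- H t) + (I t \<omega> - L) + L * exp (- H t)
       - exp (- H t) * integral {0..t} (\<lambda>s. h s * exp (H s) * (I s \<omega> - L))) \<longlongrightarrow> y) (at_left 1)" by simp
    have "\<forall>\<^sub>F t in at_left 1. t \<in> {0<..<1::real}" by (rule eventually_at_left_real) simp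
    then have "\<forall>\<^sub>F t in at_left 1. y + (x - y) * exp (- H t) + (I t \<omega> - L) + L * exp (- H t)
       - exp (- H t) * integral {0..t} (\<lambda>s. h s * exp (H s) * (I s \<omega> - L)) = X x y t \<omega>"
    proof eventually_elim
      case t: (elim t)
      have "continuous_on {0..<1} (\<lambda>s. h s * exp (H s) * I s \<omega>)" by (intro continuous_intros h H_cont ci)
      then have i: "(\<lambda>s. h s * exp (H s) * I s \<omega>) integrable_on {0..t}" "(\<lambda>s. h s * exp (H s)) integrable_on {0..t}"
        using t by (auto intro!: integrable_Ico hexp_cont)
      have "integral {0..t} (\<lambda>s. h s * exp (H s) * (I s \<omega> - L))
          = integral {0..t} (\<lambda>s. h s * exp (H s) * I s \<omega> - h s * exp (H s) * L)"
        by (simp add: right_diff_distrib)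
      also have "\<dots> = integral {0..t} (\<lambda>s. h s * exp (H s) * I s \<omega>) - (exp (H t) - 1) * L"
        using i t hexp_integral[of 0 t] by (subst Henstock_Kurzweil_Integration.integral_diff) (auto intro: integrable_on_mult_left)
      finally have "exp (- H t) * integral {0..t} (\<lambda>s. h s * exp (H s) * (I s \<omega> - L))
          = exp (- H t) * integral {0..t} (\<lambda>s. h s * exp (H s) * I s \<omega>) - L + L * exp (- H t)"
        by (simp add: exp_minus field_simps)
      moreover have "X x y t \<omega> = y + (x - y) * exp (- H t) + I t \<omega> - exp (- H t) * integral {0..t} (\<lambda>s. h s * exp (H s) * I s \<omega>)"
        using elim t by auto
      ultimately show ?case by simp
    qed
    with lim show ?case by (rule Lim_transform_eventually)
  qed
qed

end

section \<open>The Markov property of Gaussian processes\<close>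

lemma iexp_add: "iexp (x + y) = iexp x * iexp y"
  by (simp add: exp_add distrib_left)

lemma square_integrable_times:
  fixes f g :: "'a \<Rightarrow> real"
  assumes [measurable]: "f \<in> borel_measurable M" "g \<in> borel_measurable M"
    and "integrable M (\<lambda>x. (f x)\<^sup>2)" "integrable M (\<lambda>x. (g x)\<^sup>2)"
  shows "integrable M (\<lambda>x. f x * g x)"
proof (rule Bochner_Integration.integrable_bound)
  show "integrable M (\<lambda>x. (f x)\<^sup>2 + (g x)\<^sup>2)" using assms by simp
  have "\<bar>f x * g x\<bar> \<le> (f x)\<^sup>2 + (g x)\<^sup>2" for x
  proof -
    have "2 * (\<bar>f x\<bar> * \<bar>g x\<bar>) \<le> (f x)\<^sup>2 + (g x)\<^sup>2"
      using sum_squares_bound[of "\<bar>f x\<bar>" "\<bar>g x\<bar>"] by simp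
    moreover have "0 \<le> \<bar>f x\<bar> * \<bar>g x\<bar>" by simp
    ultimately show ?thesis unfolding abs_mult by linarith
  qed
  then show "AE x in M. norm (f x * g x) \<le> norm ((f x)\<^sup>2 + (g x)\<^sup>2)" by auto
qed measurable

context prob_space begin

text \<open>Written with \<open>covariance\<close>, the characteristic function has one formula for
  normal laws and for point masses.\<close>

lemma gaussian_variable_moments:
  assumes "gaussian_variable M Y"
  shows "Y \<in> borel_measurable M" "integrable M Y" "integrable M (\<lambda>\<omega>. (Y \<omega>)\<^sup>2)"
    "(\<integral>\<omega>. iexp (Y \<omega>) \<partial>M) = iexp (expectation Y) * complex_of_real (exp (- covariance M Y Y / 2))"
proof -
  show Y [measurable]: "Y \<in> borel_measurable M" using assms by (simp add: gaussian_variable_def)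
  have "integrable M Y \<and> integrable M (\<lambda>\<omega>. (Y \<omega>)\<^sup>2) \<and>
    (\<integral>\<omega>. iexp (Y \<omega>) \<partial>M) = iexp (expectation Y) * complex_of_real (exp (- covariance M Y Y / 2))"
  proof -
    from assms consider m where "AE \<omega> in M. Y \<omega> = m"
      | m v where "0 < v" "distributed M lborel Y (normal_density m (sqrt v))"
      by (auto simp: gaussian_variable_def)
    then show ?thesis
    proof cases
      case 1
      then have Ym: "AE \<omega> in M. m = Y \<omega>" "AE \<omega> in M. m\<^sup>2 = (Y \<omega>)\<^sup>2" by auto
      have int: "integrable M Y" by (rule integrable_cong_AE_imp[OF _ _ Ym(1)]) auto
      have int2: "integrable M (\<lambda>\<omega>. (Y \<omega>)\<^sup>2)" by (rule integrable_cong_AE_imp[OF _ _ Ym(2)]) auto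
      have "expectation Y = expectation (\<lambda>_. m)" using 1 by (intro integral_cong_AE) auto
      then have e: "expectation Y = m" by (simp add: prob_space)
      have "covariance M Y Y = 0"
        unfolding covariance_def mean_def e using 1 by (intro integral_eq_zero_AE) auto
      moreover have "(\<integral>\<omega>. iexp (Y \<omega>) \<partial>M) = (\<integral>\<omega>. iexp m \<partial>M)" using 1 by (intro integral_cong_AE) auto
      ultimately show ?thesis using int int2 e by (simp add: prob_space)
    next
      case 2
      note mom = normal_square_integrable[OF 2]
      have "covariance M Y Y = v"
        using mom(3,4) by (simp add: covariance_def mean_def power2_eq_square)
      moreover have "(\<integral>\<omega>. iexp (Y \<omega>) \<partial>M) = iexp m * complex_of_real (exp (- v / 2))"
      proof -
        have "distributed M lborel (\<lambda>\<omega>. (Y \<omega> - m) / sqrt v) std_normal_density"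
          using normal_standard_normal_convert[of "sqrt v" Y m] 2 by simp
        moreover have "distr M lborel (\<lambda>\<omega>. (Y \<omega> - m) / sqrt v) = distr M borel (\<lambda>\<omega>. (Y \<omega> - m) / sqrt v)"
          by (intro distr_cong) auto
        ultimately have d: "distr M borel (\<lambda>\<omega>. (Y \<omega> - m) / sqrt v) = std_normal_distribution"
          by (simp add: distributed_def)
        have "(\<integral>\<omega>. iexp (Y \<omega>) \<partial>M) = (\<integral>\<omega>. iexp m * iexp (sqrt v * ((Y \<omega> - m) / sqrt v)) \<partial>M)"
          unfolding iexp_add[symmetric] using 2(1) by simp
        also have "\<dots> = iexp m * (\<integral>\<omega>. iexp (sqrt v * ((Y \<omega> - m) / sqrt v)) \<partial>M)" by simp
        also have "(\<integral>\<omega>. iexp (sqrt v * ((Y \<omega> - m) / sqrt v)) \<partial>M) = char (distr M borel (\<lambda>\<omega>. (Y \<omega> - m) / sqrt v)) (sqrt v)"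
          unfolding char_def by (subst integral_distr) auto
        also have "\<dots> = complex_of_real (exp (- v / 2))"
          unfolding d using 2(1) by (simp add: char_std_normal_distribution)
        finally show ?thesis .
      qed
      ultimately show ?thesis using mom by simp
    qed
  qed
  then show "integrable M Y" "integrable M (\<lambda>\<omega>. (Y \<omega>)\<^sup>2)"
    "(\<integral>\<omega>. iexp (Y \<omega>) \<partial>M) = iexp (expectation Y) * complex_of_real (exp (- covariance M Y Y / 2))" by auto
qed

text \<open>Applying \<open>char_weight_factorization\<close> to the weights \<open>1 + cos (a U + c)\<close>, and then
  to indicators of events determined by \<open>V\<close>, replaces a uniqueness theorem for two-dimensional
  characteristic functions.\<close>

lemma indep_var_if_char_factor:
  fixes U V :: "'a \<Rightarrow> real"
  assumes U [measurable]: "U \<in> borel_measurable M" and V [measurable]: "V \<in> borel_measurable M"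
    and factor: "\<And>a b. (\<integral>\<omega>. iexp (a * U \<omega> + b * V \<omega>) \<partial>M) = (\<integral>\<omega>. iexp (a * U \<omega>) \<partial>M) * (\<integral>\<omega>. iexp (b * V \<omega>) \<partial>M)"
  shows "indep_var borel U borel V"
proof (rule indep_varI[OF U V])
  fix A B :: "real set" assume A [measurable]: "A \<in> sets borel" and B [measurable]: "B \<in> sets borel"
  have ie: "integrable M (\<lambda>\<omega>. iexp (f \<omega>))" if "f \<in> borel_measurable M" for f :: "'a \<Rightarrow> real"
    using integrable_scaleR_iexp[of "\<lambda>_. 1" 1 f 1] that by simp
  have ic: "integrable M (\<lambda>\<omega>. cos (a * U \<omega> + c))" for a c
    by (auto intro!: integrable_const_bound[where B=1])
  have chV: "char (distr M borel V) b = (\<integral>\<omega>. iexp (b * V \<omega>) \<partial>M)" for b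
    unfolding char_def by (subst integral_distr) auto
  \<comment> \<open>A shifted cosine is a combination of \<open>iexp x\<close> and
    \<open>iexp (- x)\<close>, so the factorisation hypothesis transfers to the nonnegative weights
    \<open>1 + cos (a * U \<omega> + c)\<close>.\<close>
  have cos_eq: "complex_of_real (cos (x + c)) = iexp c / 2 * iexp x + iexp (- c) / 2 * iexp (- x)" for x c
    by (simp add: complex_eq_iff Re_exp Im_exp cos_add field_simps)
  have lin: "(\<integral>\<omega>. f \<omega> + (p * g \<omega> + q * k \<omega>) \<partial>M) = integral\<^sup>L M f + (p * integral\<^sup>L M g + q * integral\<^sup>L M k)"
    if "integrable M f" "integrable M g" "integrable M k" for f g k :: "'a \<Rightarrow> complex" and p q
    using that by simp
  have alg: "(1 + (p * x + q * y)) * z = z + (p * (x * z) + q * (y * z))" for x y z p q :: complex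
    by (simp add: algebra_simps)
  have bounds: "0 \<le> 1 + cos x" "1 + cos x \<le> 2" for x :: real
    using cos_ge_minus_one[of x] cos_le_one[of x] by linarith+
  have ecos: "complex_of_real (expectation (\<lambda>\<omega>. cos (a * U \<omega> + c)))
      = iexp c / 2 * (\<integral>\<omega>. iexp (a * U \<omega>) \<partial>M) + iexp (- c) / 2 * (\<integral>\<omega>. iexp (- a * U \<omega>) \<partial>M)" for a c
  proof -
    have "complex_of_real (expectation (\<lambda>\<omega>. cos (a * U \<omega> + c)))
        = (\<integral>\<omega>. 0 + (iexp c / 2 * iexp (a * U \<omega>) + iexp (- c) / 2 * iexp (- a * U \<omega>)) \<partial>M)"
      unfolding integral_complex_of_real[symmetric] cos_eq by simp
    also have "\<dots> = (\<integral>\<omega>. 0 \<partial>M) + (iexp c / 2 * (\<integral>\<omega>. iexp (a * U \<omega>) \<partial>M) + iexp (- c) / 2 * (\<integral>\<omega>. iexp (- a * U \<omega>) \<partial>M))"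
      by (rule lin) (simp, (rule ie, measurable)+)
    finally show ?thesis by simp
  qed
  have wcos: "(\<integral>\<omega>. (1 + cos (a * U \<omega> + c)) * indicator B (V \<omega>) \<partial>M)
      = expectation (\<lambda>\<omega>. 1 + cos (a * U \<omega> + c)) * prob (V -` B \<inter> space M)" for a c
  proof (rule char_weight_factorization[where c=2])
    fix b
    have "(\<integral>\<omega>. (1 + cos (a * U \<omega> + c)) *\<^sub>R iexp (b * V \<omega>) \<partial>M)
      = (\<integral>\<omega>. iexp (b * V \<omega>) + (iexp c / 2 * iexp (a * U \<omega> + b * V \<omega>) + iexp (- c) / 2 * iexp (- a * U \<omega> + b * V \<omega>)) \<partial>M)"
    proof (intro Bochner_Integration.integral_cong refl)
      fix \<omega>
      have "(1 + cos (a * U \<omega> + c)) *\<^sub>R iexp (b * V \<omega>) = (1 + complex_of_real (cos (a * U \<omega> + c))) * iexp (b * V \<omega>)"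
        by (simp add: scaleR_conv_of_real)
      also have "\<dots> = iexp (b * V \<omega>) + (iexp c / 2 * iexp (a * U \<omega> + b * V \<omega>) + iexp (- c) / 2 * iexp (- a * U \<omega> + b * V \<omega>))"
        unfolding cos_eq by (simp only: iexp_add mult_minus_left alg)
      finally show "(1 + cos (a * U \<omega> + c)) *\<^sub>R iexp (b * V \<omega>) = \<dots>" .
    qed
    also have "\<dots> = (\<integral>\<omega>. iexp (b * V \<omega>) \<partial>M) + (iexp c / 2 * (\<integral>\<omega>. iexp (a * U \<omega> + b * V \<omega>) \<partial>M)
        + iexp (- c) / 2 * (\<integral>\<omega>. iexp (- a * U \<omega> + b * V \<omega>) \<partial>M))"
      by (rule lin) (rule ie, measurable)+
    also have "\<dots> = complex_of_real (expectation (\<lambda>\<omega>. 1 + cos (a * U \<omega> + c))) * char (distr M borel V) b"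
    proof -
      have "complex_of_real (expectation (\<lambda>\<omega>. 1 + cos (a * U \<omega> + c))) = 1 + complex_of_real (expectation (\<lambda>\<omega>. cos (a * U \<omega> + c)))"
        using ic by (simp add: prob_space)
      then show ?thesis unfolding factor chV ecos by (simp only: alg)
    qed
    finally show "(\<integral>\<omega>. (1 + cos (a * U \<omega> + c)) *\<^sub>R iexp (b * V \<omega>) \<partial>M)
      = complex_of_real (expectation (\<lambda>\<omega>. 1 + cos (a * U \<omega> + c))) * char (distr M borel V) b" .
  qed (auto simp: bounds)
  define C where "C = V -` B \<inter> space M"
  have [measurable]: "C \<in> events" unfolding C_def by measurable
  have iB: "integrable M (\<lambda>\<omega>. f \<omega> * indicator C \<omega>)" if "integrable M f" for f :: "'a \<Rightarrow> real"
    using integrable_real_mult_indicator[of C M f] that by simp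
  have ind: "(\<integral>\<omega>. f \<omega> * indicator B (V \<omega>) \<partial>M) = (\<integral>\<omega>. f \<omega> * indicator C \<omega> \<partial>M)" for f :: "'a \<Rightarrow> real"
    by (intro Bochner_Integration.integral_cong) (auto simp: C_def indicator_def)
  have cosC: "(\<integral>\<omega>. cos (a * U \<omega> + c) * indicator C \<omega> \<partial>M) = expectation (\<lambda>\<omega>. cos (a * U \<omega> + c)) * prob C" for a c
  proof -
    have "(\<integral>\<omega>. (1 + cos (a * U \<omega> + c)) * indicator C \<omega> \<partial>M) = prob C + (\<integral>\<omega>. cos (a * U \<omega> + c) * indicator C \<omega> \<partial>M)"
      unfolding distrib_right using iB[OF ic[of a c]] iB[of "\<lambda>_. 1"]
      by (subst Bochner_Integration.integral_add) auto
    moreover have "expectation (\<lambda>\<omega>. 1 + cos (a * U \<omega> + c)) = 1 + expectation (\<lambda>\<omega>. cos (a * U \<omega> + c))"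
      using ic by (simp add: prob_space)
    ultimately show ?thesis
      using wcos[of a c] unfolding ind C_def[symmetric] by (simp add: distrib_right)
  qed
  \<comment> \<open>Real and imaginary part are cosines with phases 0 and \<open>- pi / 2\<close>,
    which is why the weights carry a shift \<open>c\<close>.\<close>
  have iexp_split: "iexp x = complex_of_real (cos (x + 0)) + \<i> * complex_of_real (cos (x + (- pi / 2)))" for x
    by (simp add: complex_eq_iff Re_exp Im_exp cos_diff)
  have "(\<integral>\<omega>. indicat_real C \<omega> * indicator A (U \<omega>) \<partial>M) = expectation (indicator C) * prob (U -` A \<inter> space M)"
  proof (rule char_weight_factorization[where c=1])
    fix a
    let ?f = "\<lambda>c \<omega>. cos (a * U \<omega> + c)"
    have split: "(\<integral>\<omega>. complex_of_real (f \<omega>) + \<i> * complex_of_real (g \<omega>) \<partial>M)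
        = complex_of_real (\<integral>\<omega>. f \<omega> \<partial>M) + \<i> * complex_of_real (\<integral>\<omega>. g \<omega> \<partial>M)"
      if "integrable M f" "integrable M g" for f g :: "'a \<Rightarrow> real"
      using that by simp
    have "(\<integral>\<omega>. indicator C \<omega> *\<^sub>R iexp (a * U \<omega>) \<partial>M)
      = (\<integral>\<omega>. complex_of_real (?f 0 \<omega> * indicator C \<omega>) + \<i> * complex_of_real (?f (- pi / 2) \<omega> * indicator C \<omega>) \<partial>M)"
      unfolding iexp_split by (intro Bochner_Integration.integral_cong) (auto simp: indicator_def)
    also have "\<dots> = complex_of_real (\<integral>\<omega>. ?f 0 \<omega> * indicator C \<omega> \<partial>M) + \<i> * complex_of_real (\<integral>\<omega>. ?f (- pi / 2) \<omega> * indicator C \<omega> \<partial>M)"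
      by (rule split) (rule iB ic)+
    also have "\<dots> = complex_of_real (expectation (indicator C)) * (complex_of_real (expectation (?f 0)) + \<i> * complex_of_real (expectation (?f (- pi / 2))))"
      unfolding cosC by (simp add: algebra_simps)
    also have "complex_of_real (expectation (?f 0)) + \<i> * complex_of_real (expectation (?f (- pi / 2))) = (\<integral>\<omega>. iexp (a * U \<omega>) \<partial>M)"
      unfolding iexp_split by (rule split[symmetric]) (rule ic)+
    also have "\<dots> = char (distr M borel U) a"
      unfolding char_def by (subst integral_distr) auto
    finally show "(\<integral>\<omega>. indicator C \<omega> *\<^sub>R iexp (a * U \<omega>) \<partial>M) = complex_of_real (expectation (indicator C)) * char (distr M borel U) a" .
  qed (auto simp: indicator_le_1)
  moreover have "(\<integral>\<omega>. indicat_real C \<omega> * indicator A (U \<omega>) \<partial>M) = expectation (indicat_real (U -` A \<inter> space M \<inter> C))"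
    by (intro Bochner_Integration.integral_cong) (auto simp: indicator_def)
  ultimately show "prob (U -` A \<inter> space M \<inter> (V -` B \<inter> space M)) = prob (U -` A \<inter> space M) * prob (V -` B \<inter> space M)"
    unfolding C_def by simp
qed

lemma covariance_sym: "covariance M X Y = covariance M Y X"
  by (simp add: covariance_def mult.commute)

lemma covariance_add_scaled:
  assumes X: "integrable M X" "integrable M (\<lambda>\<omega>. (X \<omega>)\<^sup>2)" and Y: "integrable M Y" "integrable M (\<lambda>\<omega>. (Y \<omega>)\<^sup>2)"
    and W: "integrable M W" "integrable M (\<lambda>\<omega>. (W \<omega>)\<^sup>2)"
  shows "covariance M (\<lambda>\<omega>. a * X \<omega> + b * Y \<omega>) W = a * covariance M X W + b * covariance M Y W"
proof -
  have [measurable]: "X \<in> borel_measurable M" "Y \<in> borel_measurable M" "W \<in> borel_measurable M"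
    using X Y W by auto
  have sq: "integrable M (\<lambda>\<omega>. (f \<omega> - c)\<^sup>2)" if "integrable M f" "integrable M (\<lambda>\<omega>. (f \<omega>)\<^sup>2)" for f :: "'a \<Rightarrow> real" and c
    using that by (simp add: power2_diff)
  have i: "integrable M (\<lambda>\<omega>. (X \<omega> - mean M X) * (W \<omega> - mean M W))" "integrable M (\<lambda>\<omega>. (Y \<omega> - mean M Y) * (W \<omega> - mean M W))"
    using sq X Y W by (auto intro!: square_integrable_times)
  have m: "mean M (\<lambda>\<omega>. a * X \<omega> + b * Y \<omega>) = a * mean M X + b * mean M Y"
    using X Y by (simp add: mean_def)
  have "covariance M (\<lambda>\<omega>. a * X \<omega> + b * Y \<omega>) W
    = expectation (\<lambda>\<omega>. a * ((X \<omega> - mean M X) * (W \<omega> - mean M W)) + b * ((Y \<omega> - mean M Y) * (W \<omega> - mean M W)))"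
    unfolding covariance_def m by (intro Bochner_Integration.integral_cong) (auto simp: algebra_simps)
  also have "\<dots> = a * covariance M X W + b * covariance M Y W"
    unfolding covariance_def using i by simp
  finally show ?thesis .
qed

lemma gaussian_process_pair:
  assumes W: "gaussian_process M T W" and st: "s \<in> T" "t \<in> T" "s \<noteq> t"
  shows "gaussian_variable M (\<lambda>\<omega>. a * W s \<omega> + b * W t \<omega>)"
proof -
  have "gaussian_variable M (\<lambda>\<omega>. \<Sum>r\<in>{s, t}. (if r = s then a else b) * W r \<omega>)"
    using W[unfolded gaussian_process_def, rule_format, of "{s, t}" "\<lambda>r. if r = s then a else b"] st by simp
  then show ?thesis using st(3) not_sym[OF st(3)] by simp
qed

lemma gaussian_process_variable:
  assumes W: "gaussian_process M T W" and t: "t \<in> T"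
  shows "gaussian_variable M (W t)"
proof -
  have "gaussian_variable M (\<lambda>\<omega>. \<Sum>r\<in>{t}. 1 * W r \<omega>)"
    using W[unfolded gaussian_process_def, rule_format, of "{t}" "\<lambda>_. 1"] t by simp
  then show ?thesis by simp
qed

text \<open>All linear combinations of the pair are Gaussian, possibly degenerate; without cross
  covariance their variance splits, and the joint characteristic function factorises.\<close>

lemma gaussian_process_uncorrelated_indep:
  assumes W: "gaussian_process M T W" and sr: "s \<in> T" "r \<in> T" "s \<noteq> r"
    and unc: "covariance M (\<lambda>\<omega>. 1 * W s \<omega> + b * W r \<omega>) (W r) = 0"
  shows "indep_var borel (\<lambda>\<omega>. 1 * W s \<omega> + b * W r \<omega>) borel (W r)"
proof -
  define D where "D \<omega> = 1 * W s \<omega> + b * W r \<omega>" for \<omega>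
  have Ws: "gaussian_variable M (W s)" and Wr: "gaussian_variable M (W r)"
    using gaussian_process_variable[OF W] sr by auto
  have D: "gaussian_variable M D" unfolding D_def using W sr by (rule gaussian_process_pair)
  note mD = gaussian_variable_moments[OF D] and mW = gaussian_variable_moments[OF Wr] and mS = gaussian_variable_moments[OF Ws]
  have g: "gaussian_variable M (\<lambda>\<omega>. p * D \<omega> + q * W r \<omega>)" for p q
  proof -
    have "gaussian_variable M (\<lambda>\<omega>. p * W s \<omega> + (p * b + q) * W r \<omega>)" using W sr by (rule gaussian_process_pair)
    moreover have "p * W s \<omega> + (p * b + q) * W r \<omega> = p * D \<omega> + q * W r \<omega>" for \<omega>
      by (simp add: D_def algebra_simps)
    ultimately show ?thesis by simp
  qed
  have cov: "covariance M (\<lambda>\<omega>. p * D \<omega> + q * W r \<omega>) (\<lambda>\<omega>. p * D \<omega> + q * W r \<omega>)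
      = p\<^sup>2 * covariance M D D + q\<^sup>2 * covariance M (W r) (W r)" for p q
  proof -
    note mg = gaussian_variable_moments[OF g, of p q]
    let ?G = "\<lambda>\<omega>. p * D \<omega> + q * W r \<omega>"
    have 0: "covariance M D (W r) = 0" using unc by (simp add: D_def[abs_def])
    have "covariance M ?G ?G = p * covariance M D ?G + q * covariance M (W r) ?G"
      by (rule covariance_add_scaled[OF mD(2,3) mW(2,3) mg(2,3)])
    also have "covariance M D ?G = p * covariance M D D + q * covariance M (W r) D"
      unfolding covariance_sym[of D ?G] by (rule covariance_add_scaled[OF mD(2,3) mW(2,3) mD(2,3)])
    also have "covariance M (W r) D = 0" unfolding covariance_sym[of "W r" D] by (rule 0)
    also have "covariance M (W r) ?G = p * covariance M D (W r) + q * covariance M (W r) (W r)"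
      unfolding covariance_sym[of "W r" ?G] by (rule covariance_add_scaled[OF mD(2,3) mW(2,3) mW(2,3)])
    finally show ?thesis unfolding 0 by (simp add: power2_eq_square)
  qed
  have "indep_var borel D borel (W r)"
  proof (rule indep_var_if_char_factor[OF mD(1) mW(1)])
    fix p q
    have e: "expectation (\<lambda>\<omega>. p * D \<omega> + q * W r \<omega>) = p * expectation D + q * expectation (W r)" for p q
      using mD mW by simp
    have gc: "(\<integral>\<omega>. iexp (p * D \<omega> + q * W r \<omega>) \<partial>M) = iexp (p * expectation D + q * expectation (W r)) *
        complex_of_real (exp (- (p\<^sup>2 * covariance M D D + q\<^sup>2 * covariance M (W r) (W r)) / 2))" for p q
      unfolding gaussian_variable_moments(4)[OF g] cov e ..
    show "(\<integral>\<omega>. iexp (p * D \<omega> + q * W r \<omega>) \<partial>M) = (\<integral>\<omega>. iexp (p * D \<omega>) \<partial>M) * (\<integral>\<omega>. iexp (q * W r \<omega>) \<partial>M)"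
    proof -
      have e: "exp (- (x + y) / 2) = exp (- x / 2) * exp (- y / 2)" for x y :: real
        by (simp add: exp_add[symmetric] field_simps)
      have "(\<integral>\<omega>. iexp (p * D \<omega>) \<partial>M) = iexp (p * expectation D) * complex_of_real (exp (- (p\<^sup>2 * covariance M D D) / 2))"
        using gc[of p 0] by simp
      moreover have "(\<integral>\<omega>. iexp (q * W r \<omega>) \<partial>M) = iexp (q * expectation (W r)) * complex_of_real (exp (- (q\<^sup>2 * covariance M (W r) (W r)) / 2))"
        using gc[of 0 q] by simp
      moreover have "(\<integral>\<omega>. iexp (p * D \<omega> + q * W r \<omega>) \<partial>M)
        = (iexp (p * expectation D) * complex_of_real (exp (- (p\<^sup>2 * covariance M D D) / 2)))
         * (iexp (q * expectation (W r)) * complex_of_real (exp (- (q\<^sup>2 * covariance M (W r) (W r)) / 2)))"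
        by (rule trans[OF gc]) (simp only: e iexp_add of_real_mult mult_ac)
      ultimately show ?thesis by simp
    qed
  qed
  then show ?thesis by (simp add: D_def[abs_def])
qed

text \<open>\<open>G\<close> will be \<open>M\<close> for conditional expectations, and
  \<open>F s\<close> where independence of the past is used.\<close>

lemma natural_filtration_subalgebra:
  assumes "\<And>u. u \<in> {0..r} \<Longrightarrow> W u \<in> borel_measurable G" "space G = space M"
  shows "subalgebra G (natural_filtration M W r)"
proof -
  have f: "(\<lambda>\<omega>. \<lambda>u\<in>{0..r}. W u \<omega>) \<in> G \<rightarrow>\<^sub>M (\<Pi>\<^sub>M u\<in>{0..r}. borel)"
    using assms(1) by (intro measurable_restrict) auto
  then have "(\<lambda>\<omega>. \<lambda>u\<in>{0..r}. W u \<omega>) \<in> space M \<rightarrow> space (\<Pi>\<^sub>M u\<in>{0..r}. borel)"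
    using assms(2) by (auto simp: measurable_def)
  then have "sets (natural_filtration M W r) \<subseteq> sets G"
    unfolding natural_filtration_def using measurable_sets[OF f] assms(2) by (auto simp: sets_vimage_algebra2)
  then show ?thesis by (simp add: subalgebra_def natural_filtration_def assms(2))
qed

lemma natural_filtration_measurable:
  assumes "u \<in> {0..r}"
  shows "W u \<in> borel_measurable (natural_filtration M W r)"
proof -
  have "(\<lambda>\<omega>. \<lambda>u\<in>{0..r}. W u \<omega>) \<in> natural_filtration M W r \<rightarrow>\<^sub>M (\<Pi>\<^sub>M u\<in>{0..r}. borel)"
    unfolding natural_filtration_def by (rule measurable_vimage_algebra1) (auto simp: space_PiM)
  from measurable_compose[OF this measurable_component_singleton[OF assms]] show ?thesis
    using assms by simp
qed

text \<open>\<open>D\<close> is the residual of the regression of \<open>W s\<close> on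
  \<open>W r\<close>, hence independent of \<open>W r\<close>. It is known at time \<open>r\<close>,
  so the Markov property lets \<open>W t\<close> feel it only through \<open>W r\<close>; therefore
  \<open>D\<close> is independent of \<open>W t\<close> as well, and the vanishing of their
  covariance is the claimed identity.\<close>

lemma gaussian_markov_covariance:
  assumes P: "transition_function P" and Mk: "markov_process M P W" and W: "gaussian_process M {0..1} W"
    and rs: "0 \<le> s" "s < r" "r < t" "t \<le> 1" and pos: "covariance M (W r) (W r) > 0"
  shows "covariance M (W s) (W t) * covariance M (W r) (W r) = covariance M (W s) (W r) * covariance M (W r) (W t)"
proof -
  define b where "b = - covariance M (W s) (W r) / covariance M (W r) (W r)"
  define D where "D \<omega> = 1 * W s \<omega> + b * W r \<omega>" for \<omega>
  have gv: "gaussian_variable M (W u)" if "u \<in> {0..1}" for u using gaussian_process_variable[OF W that] .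
  note mom = gaussian_variable_moments(1-3)[OF gv]
  have D: "gaussian_variable M D" unfolding D_def using W rs by (intro gaussian_process_pair) auto
  note mD = gaussian_variable_moments(1-3)[OF D]
  have covD: "covariance M D (W u) = covariance M (W s) (W u) + b * covariance M (W r) (W u)" if "u \<in> {0..1}" for u
    unfolding D_def using covariance_add_scaled[of "W s" "W r" "W u" 1 b] mom rs that by simp
  have "covariance M D (W r) = 0" using covD[of r] rs pos by (simp add: b_def)
  then have ind: "indep_var borel D borel (W r)"
    unfolding D_def using W rs by (intro gaussian_process_uncorrelated_indep) auto
  have meas: "W u \<in> borel_measurable M" if "u \<in> {0..1}" for u using Mk that by (simp add: markov_process_def)
  have K [measurable]: "P r t \<in> borel \<rightarrow>\<^sub>M prob_algebra borel" using P rs by (auto simp: transition_function_def)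
  have sub: "subalgebra M (natural_filtration M W r)"
    using rs by (intro natural_filtration_subalgebra meas) auto
  interpret nf: finite_measure_subalgebra M "natural_filtration M W r"
    by unfold_locales (rule sub)
  have [measurable]: "D \<in> borel_measurable (natural_filtration M W r)"
    unfolding D_def[abs_def] using rs
    by (intro borel_measurable_add borel_measurable_times borel_measurable_const natural_filtration_measurable) auto
  have [measurable]: "D \<in> borel_measurable M" "W t \<in> borel_measurable M" "W r \<in> borel_measurable M"
    using mD meas rs by auto
  have step: "prob (D -` C \<inter> space M \<inter> (W t -` A \<inter> space M)) = prob (D -` C \<inter> space M) * expectation (\<lambda>\<omega>. measure (P r t (W r \<omega>)) A)"
    if C [measurable]: "C \<in> sets borel" and A [measurable]: "A \<in> sets borel" for C A
  proof -
    define k where "k z = measure (P r t z) A" for z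
    have k [measurable]: "k \<in> borel_measurable borel"
      unfolding k_def[abs_def] using measurable_compose[OF measurable_prob_algebraD[OF K] measurable_measure_subprob_algebra[OF A]] .
    have k1: "0 \<le> k z" "k z \<le> 1" for z
    proof -
      have "P r t z \<in> space (prob_algebra borel)" using measurable_space[OF K, of z] by simp
      then interpret p: prob_space "P r t z" by (simp add: space_prob_algebra)
      show "0 \<le> k z" "k z \<le> 1" by (auto simp: k_def)
    qed
    have ce: "AE \<omega> in M. real_cond_exp M (natural_filtration M W r) (\<lambda>\<omega>. indicator A (W t \<omega>)) \<omega> = k (W r \<omega>)"
      using Mk rs A by (simp add: markov_process_def k_def)
    have "prob (D -` C \<inter> space M \<inter> (W t -` A \<inter> space M)) = expectation (indicator (D -` C \<inter> space M \<inter> (W t -` A \<inter> space M)))"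
      by simp
    also have "\<dots> = expectation (\<lambda>\<omega>. indicator C (D \<omega>) * indicator A (W t \<omega>))"
      by (intro Bochner_Integration.integral_cong) (auto simp: indicator_def)
    also have "\<dots> = expectation (\<lambda>\<omega>. indicator C (D \<omega>) * real_cond_exp M (natural_filtration M W r) (\<lambda>\<omega>. indicator A (W t \<omega>)) \<omega>)"
      by (intro nf.real_cond_exp_intg(2)[symmetric] integrable_const_bound[where B=1]) (auto simp: indicator_def)
    also have "\<dots> = expectation (\<lambda>\<omega>. indicator C (D \<omega>) * k (W r \<omega>))"
      using ce by (intro integral_cong_AE) (auto elim!: eventually_mono)
    also have "\<dots> = expectation (\<lambda>\<omega>. indicator C (D \<omega>)) * expectation (\<lambda>\<omega>. k (W r \<omega>))"
    proof (rule indep_var_lebesgue_integral)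
      have "indep_var borel (indicator C \<circ> D) borel (k \<circ> W r)" by (rule indep_var_compose[OF ind]) auto
      then show "indep_var borel (\<lambda>\<omega>. indicator C (D \<omega>) :: real) borel (\<lambda>\<omega>. k (W r \<omega>))" by (simp add: o_def)
    qed (use k1 in \<open>auto intro!: integrable_const_bound[where B=1] simp: indicator_def\<close>)
    also have "expectation (\<lambda>\<omega>. indicator C (D \<omega>)) = expectation (indicator (D -` C \<inter> space M))"
      by (intro Bochner_Integration.integral_cong) (auto simp: indicator_def)
    finally show ?thesis by (simp add: k_def)
  qed
  have "indep_var borel D borel (W t)"
  proof (rule indep_varI)
    fix C A :: "real set" assume C: "C \<in> sets borel" and A: "A \<in> sets borel"
    \<comment> \<open>The choice \<open>C = UNIV\<close> identifies the second factor of
      \<open>step\<close> with the law of \<open>W t\<close>.\<close>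
    have "prob (W t -` A \<inter> space M) = expectation (\<lambda>\<omega>. measure (P r t (W r \<omega>)) A)"
      using step[of UNIV A] A by (simp add: prob_space Int_absorb1)
    then show "prob (D -` C \<inter> space M \<inter> (W t -` A \<inter> space M)) = prob (D -` C \<inter> space M) * prob (W t -` A \<inter> space M)"
      using step[OF C A] by simp
  qed auto
  then have "indep_var borel ((\<lambda>x. x - mean M D) \<circ> D) borel ((\<lambda>x. x - mean M (W t)) \<circ> W t)"
    by (rule indep_var_compose) auto
  then have "covariance M D (W t) = expectation (\<lambda>\<omega>. D \<omega> - mean M D) * expectation (\<lambda>\<omega>. W t \<omega> - mean M (W t))"
    unfolding covariance_def using mD mom(2)[of t] rs
    by (intro indep_var_lebesgue_integral) (auto simp: o_def)
  also have "\<dots> = 0" using mD by (simp add: mean_def prob_space)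
  finally show ?thesis using covD[of t] rs pos by (simp add: b_def field_simps)
qed

lemma path_law_moments:
  assumes X: "\<And>t. t \<in> {0..<1} \<Longrightarrow> X t \<in> borel_measurable M" and st: "s \<in> {0..<1}" "t \<in> {0..<1}"
  shows "mean (path_law M X) (\<lambda>w. w t) = mean M (X t)"
    "covariance (path_law M X) (\<lambda>w. w s) (\<lambda>w. w t) = covariance M (X s) (X t)"
proof -
  have f: "(\<lambda>\<omega>. \<lambda>t\<in>{0..<1}. X t \<omega>) \<in> M \<rightarrow>\<^sub>M (\<Pi>\<^sub>M t\<in>{0..<1}. borel)"
    using X by (intro measurable_restrict) auto
  have c: "(\<lambda>w. w u) \<in> borel_measurable (\<Pi>\<^sub>M t\<in>{0..<1::real}. borel)" if "u \<in> {0..<1}" for u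
    using that by (rule measurable_component_singleton)
  have m: "mean (path_law M X) (\<lambda>w. w t) = mean M (X t)" if "t \<in> {0..<1}" for t
    unfolding mean_def path_law_def using that by (subst integral_distr[OF f c[OF that]]) simp
  from m[OF st(2)] show "mean (path_law M X) (\<lambda>w. w t) = mean M (X t)" .
  show "covariance (path_law M X) (\<lambda>w. w s) (\<lambda>w. w t) = covariance M (X s) (X t)"
    unfolding covariance_def m[OF st(1)] m[OF st(2)] unfolding path_law_def
    using st c by (subst integral_distr[OF f]) auto
qed

end

text \<open>At \<open>t = 0\<close> the derivative is one-sided; it is unique because
  \<open>t\<close> is a limit point of \<open>{0..<1}\<close>.\<close>

lemma DERIV_unique_Ico:
  assumes "(f has_real_derivative a) (at t within {0..<1})" "(f has_real_derivative b) (at t within {0..<1})" "t \<in> {0..<1}"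
  shows "a = b"
proof (rule vector_derivative_unique_within)
  have "t islimpt {0..<1}" using assms(3) by simp
  then show "at t within {0..<1} \<noteq> bot" by (simp add: trivial_limit_within)
qed (use assms in \<open>simp_all add: has_real_derivative_iff_has_vector_derivative\<close>)

section \<open>Necessity: the drift forced by the bridges\<close>

context linear_sde begin

lemma X_mean: "t \<in> {0..<1} \<Longrightarrow> mean M (X x y t) = y + (x - y) * exp (- H t)"
  using X_formula_N[of x y]
  by (intro gm_affine_mean[OF N_martingale X_measurable]) (auto elim!: eventually_mono)

lemma X_covariance:
  assumes "s \<in> {0..<1}" "t \<in> {0..<1}"
  shows "covariance M (X x y s) (X x y t) = exp (- H s) * exp (- H t) * U (min s t)"
proof -
  have "AE \<omega> in M. X x y u \<omega> = (y + (x - y) * exp (- H u)) + exp (- H u) * N u \<omega>" if "u \<in> {0..<1}" for u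
    using X_formula_N[of x y] that by (auto elim!: eventually_mono)
  then show ?thesis using assms by (intro gm_affine_covariance[OF N_martingale X_measurable _ X_measurable]) auto
qed

text \<open>Solutions with the same target carry the same noise, so \<open>X 1 0 - X 0 0\<close> is
  the deterministic function \<open>exp (- H t)\<close>, and an almost sure limit of a deterministic
  function is a limit.\<close>

lemma pinned_exp_tendsto_0:
  assumes "pinned M X"
  shows "((\<lambda>t. exp (- H t)) \<longlongrightarrow> 0) (at_left 1)"
proof -
  have "AE \<omega> in M. ((\<lambda>t. X 1 0 t \<omega>) \<longlongrightarrow> 0) (at_left 1)" "AE \<omega> in M. ((\<lambda>t. X 0 0 t \<omega>) \<longlongrightarrow> 0) (at_left 1)"
    using assms by (auto simp: pinned_def)
  with X_formula[of 1 0] have "AE \<omega> in M. ((\<lambda>t. exp (- H t)) \<longlongrightarrow> 0) (at_left 1)"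
  proof eventually_elim
    case (elim \<omega>)
    have "((\<lambda>t. X 1 0 t \<omega> - X 0 0 t \<omega>) \<longlongrightarrow> 0 - 0) (at_left 1)" using elim by (intro tendsto_diff)
    moreover have "\<forall>\<^sub>F t in at_left 1. t \<in> {0<..<1::real}" by (rule eventually_at_left_real) simp
    then have "\<forall>\<^sub>F t in at_left 1. X 1 0 t \<omega> - X 0 0 t \<omega> = exp (- H t)"
      by eventually_elim (use elim in auto)
    ultimately show ?case by (simp add: Lim_transform_eventually)
  qed
  then show ?thesis by simp
qed

lemma drift_if_bridges:
  assumes Z: "nondegenerate_continuous_gaussian_markov M Z" and bridge: "corresponds_to_bridges M X Z" and pin: "pinned M X"
  shows "\<exists>S. (V \<longlongrightarrow> S) (at_left 1) \<and> (\<forall>t\<in>{0..<1}. h t = (\<sigma> t)\<^sup>2 / (S - V t))"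
proof -
  define c where "c s t = covariance M (Z 0 s) (Z 0 t)" for s t
  define m where "m t = mean M (Z 0 t)" for t
  obtain P where P: "transition_function P" "markov_process M P (Z 0)"
    using Z unfolding nondegenerate_continuous_gaussian_markov_def by blast
  have gp: "gaussian_process M {0..1} (Z 0)" and pos: "\<And>t. t \<in> {0<..1} \<Longrightarrow> c t t > 0"
    using Z unfolding nondegenerate_continuous_gaussian_markov_def c_def by auto
  have bl: "is_bridge_law M (Z 0) y (path_law M (X 0 y))" for y
    using bridge by (simp add: corresponds_to_bridges_def)
  have mean_eq: "y - y * exp (- H t) = m t + c t 1 / c 1 1 * (y - m 1)" if "t \<in> {0..<1}" for t y
  proof -
    have "mean (path_law M (X 0 y)) (\<lambda>w. w t) = m t + c t 1 / c 1 1 * (y - m 1)"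
      using bl[of y] that unfolding is_bridge_law_def Let_def c_def m_def by blast
    moreover have "mean (path_law M (X 0 y)) (\<lambda>w. w t) = mean M (X 0 y t)"
      by (rule path_law_moments(1)[OF X_measurable that that])
    ultimately show ?thesis using X_mean[OF that, of 0 y] by simp
  qed
  \<comment> \<open>Both sides of \<open>mean_eq\<close> are affine in \<open>y\<close>; comparing
    \<open>y = 0\<close> with \<open>y = 1\<close> isolates the slope
    \<open>c t 1 / c 1 1\<close>.\<close>
  have q: "c t 1 = c 1 1 * (1 - exp (- H t))" if "t \<in> {0..<1}" for t
    using mean_eq[OF that, of 0] mean_eq[OF that, of 1] pos[of 1] by (simp add: field_simps)
  have cov_eq: "exp (- H s) * exp (- H t) * U (min s t) = c s t - c s 1 * c t 1 / c 1 1"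
    if "s \<in> {0..<1}" "t \<in> {0..<1}" for s t
  proof -
    have "covariance (path_law M (X 0 0)) (\<lambda>w. w s) (\<lambda>w. w t) = c s t - c s 1 * c t 1 / c 1 1"
      using bl[of 0] that unfolding is_bridge_law_def Let_def c_def m_def by blast
    moreover have "covariance (path_law M (X 0 0)) (\<lambda>w. w s) (\<lambda>w. w t) = covariance M (X 0 0 s) (X 0 0 t)"
      by (rule path_law_moments(2)[OF X_measurable that])
    ultimately show ?thesis using X_covariance[OF that, of 0 0] by simp
  qed
  have mk: "c s 1 * c r r = c s r * c r 1" if "0 \<le> s" "s < r" "r < 1" for s r
    unfolding c_def using gaussian_markov_covariance[OF P gp that] pos[of r] that by (simp add: c_def)
  have rel: "(exp (H s) - 1) * U r = (exp (H r) - 1) * U s" if sr: "0 \<le> s" "s < r" "r < 1" for s r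
  proof -
    define C where "C = c 1 1"
    define x where "x = exp (- H s)"
    define y where "y = exp (- H r)"
    have C: "C > 0" using pos[of 1] by (simp add: C_def)
    have xy: "x > 0" "y > 0" by (simp_all add: x_def y_def)
    have c1: "c s 1 = C * (1 - x)" "c r 1 = C * (1 - y)"
      using q[of s] q[of r] sr by (auto simp: C_def x_def y_def)
    have "c r r = y * y * U r + C * (1 - y) * (1 - y)" "c s r = x * y * U s + C * (1 - x) * (1 - y)"
      using cov_eq[of r r] cov_eq[of s r] sr c1 C by (auto simp: C_def[symmetric] x_def[symmetric] y_def[symmetric] min_def)
    then have "C * (1 - x) * (y * y * U r + C * (1 - y) * (1 - y)) = (x * y * U s + C * (1 - x) * (1 - y)) * (C * (1 - y))"
      using mk[OF sr] c1 by simp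
    \<comment> \<open>The terms with \<open>C * C\<close> agree on both sides and cancel; what
      remains is proportional to \<open>C\<close>, so the unknown variance \<open>c 1 1\<close>
      drops out.\<close>
    then have "(C * y) * ((1 - x) * y * U r) = (C * y) * (x * (1 - y) * U s)" by (simp add: algebra_simps)
    then have "(1 - x) * y * U r = x * (1 - y) * U s" using C xy by simp
    then have "(1 - x) / x * U r = (1 - y) / y * U s" using xy by (simp add: field_simps)
    moreover have "(1 - x) / x = exp (H s) - 1" "(1 - y) / y = exp (H r) - 1"
      by (simp_all add: x_def y_def exp_minus field_simps)
    ultimately show ?thesis by simp
  qed
  \<comment> \<open>By \<open>rel\<close> the quotient of \<open>exp (H t) - 1\<close> and
    \<open>U t\<close> is the same at all positive times; \<open>1/2\<close> is an arbitrary one of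
    them.\<close>
  define \<kappa> where "\<kappa> = (exp (H (1/2)) - 1) / U (1/2)"
  have U2: "U (1/2) > 0" using U_strict[of 0 "1/2"] by simp
  have eH: "exp (H t) = 1 + \<kappa> * U t" if "t \<in> {0..<1}" for t
  proof -
    have "(exp (H (1/2)) - 1) * U t = (exp (H t) - 1) * U (1/2)"
    proof (cases t "1/2 :: real" rule: linorder_cases)
      case less
      then show ?thesis using rel[of t "1/2"] that by simp
    next
      case equal
      then show ?thesis by (simp only: equal)
    next
      case greater
      then show ?thesis using rel[of "1/2" t] that by simp
    qed
    then show ?thesis using U2 by (simp add: \<kappa>_def field_simps)
  qed
  have h_eq: "h t = \<kappa> * exp (H t) * (\<sigma> t)\<^sup>2" if t: "t \<in> {0..<1}" for t
  proof -
    have 1: "((\<lambda>t. exp (H t)) has_real_derivative exp (H t) * h t) (at t within {0..<1})"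
      using H_deriv[OF t] by (auto intro!: derivative_eq_intros)
    have "((\<lambda>t. 1 + \<kappa> * U t) has_real_derivative \<kappa> * ((exp (H t))\<^sup>2 * (\<sigma> t)\<^sup>2)) (at t within {0..<1})"
      using U_deriv[OF t] by (auto intro!: derivative_eq_intros)
    then have "((\<lambda>t. exp (H t)) has_real_derivative \<kappa> * ((exp (H t))\<^sup>2 * (\<sigma> t)\<^sup>2)) (at t within {0..<1})"
      by (rule has_field_derivative_transform_within[where d=1]) (use eH t in auto)
    from DERIV_unique_Ico[OF 1 this t] show ?thesis by (simp add: power2_eq_square)
  qed
  \<comment> \<open>By \<open>h_eq\<close> the derivative of \<open>exp (- H t)\<close> is
    \<open>- \<kappa> * (\<sigma> t)\<^sup>2\<close>, so \<open>U\<close> disappears in favour of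
    \<open>V\<close>.\<close>
  have eV: "exp (- H t) = 1 - \<kappa> * V t" if t: "t \<in> {0..<1}" for t
  proof -
    have "((\<lambda>t. exp (- H t) + \<kappa> * V t) has_real_derivative 0) (at t within {0..<1})" if "t \<in> {0..<1}" for t
    proof -
      have "((\<lambda>t. exp (- H t) + \<kappa> * V t) has_real_derivative exp (- H t) * - h t + \<kappa> * (\<sigma> t)\<^sup>2) (at t within {0..<1})"
        using H_deriv[OF that] V_deriv[OF that] by (auto intro!: derivative_eq_intros)
      moreover have "exp (- H t) * - h t + \<kappa> * (\<sigma> t)\<^sup>2 = 0"
        unfolding h_eq[OF that] by (simp add: exp_minus field_simps)
      ultimately show ?thesis by simp
    qed
    from constant_if_DERIV_zero_Ico[OF this t] show ?thesis by simp
  qed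
  have ev: "\<forall>\<^sub>F t in at_left 1. t \<in> {0<..<1::real}" by (rule eventually_at_left_real) simp
  have "((\<lambda>t. 1 - exp (- H t)) \<longlongrightarrow> 1 - 0) (at_left 1)" by (intro tendsto_intros pinned_exp_tendsto_0 pin)
  moreover have "\<forall>\<^sub>F t in at_left 1. 1 - exp (- H t) = \<kappa> * V t" using ev by eventually_elim (simp add: eV)
  ultimately have kV: "((\<lambda>t. \<kappa> * V t) \<longlongrightarrow> 1) (at_left 1)" by (simp add: Lim_transform_eventually)
  \<comment> \<open>Pinning excludes the driftless case, in which the zero function would have to
    tend to 1.\<close>
  have \<kappa>: "\<kappa> \<noteq> 0"
  proof
    assume "\<kappa> = 0"
    with kV have "((\<lambda>t. 0::real) \<longlongrightarrow> 1) (at_left (1::real))" by simp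
    then show False by (simp add: tendsto_const_iff)
  qed
  have "((\<lambda>t. (\<kappa> * V t) / \<kappa>) \<longlongrightarrow> 1 / \<kappa>) (at_left 1)" using \<kappa> by (intro tendsto_divide kV tendsto_const)
  then have lim: "(V \<longlongrightarrow> 1 / \<kappa>) (at_left 1)" using \<kappa> by simp
  moreover have "h t = (\<sigma> t)\<^sup>2 / (1 / \<kappa> - V t)" if t: "t \<in> {0..<1}" for t
  proof -
    have "1 - \<kappa> * V t > 0" unfolding eV[OF t, symmetric] by simp
    moreover have "exp (H t) = 1 / (1 - \<kappa> * V t)" by (simp add: eV[OF t, symmetric] exp_minus inverse_eq_divide)
    moreover have "1 / \<kappa> - V t = (1 - \<kappa> * V t) / \<kappa>" using \<kappa> by (simp add: field_simps)
    ultimately show ?thesis unfolding h_eq[OF t] by simp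
  qed
  ultimately show ?thesis by blast
qed

end

section \<open>Construction of the underlying Markov process\<close>

context prob_space begin

text \<open>Freezing \<open>W\<close> and averaging over an independent copy of \<open>Y\<close>:
  this identity yields both Chapman-Kolmogorov and the Markov property below.\<close>

lemma indep_gaussian_nn_integral_pair:
  assumes G: "subalgebra M G" and Y: "indep_gaussian M G Y v" and W: "W \<in> G \<rightarrow>\<^sub>M L"
    and f [measurable]: "f \<in> borel_measurable (L \<Otimes>\<^sub>M borel)"
  shows "(\<integral>\<^sup>+\<omega>. f (W \<omega>, Y \<omega>) \<partial>M) = (\<integral>\<^sup>+\<omega>. (\<integral>\<^sup>+\<omega>'. f (W \<omega>, Y \<omega>') \<partial>M) \<partial>M)"
proof -
  have [measurable]: "Y \<in> borel_measurable M" using Y by (rule indep_gaussianD)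
  have [measurable]: "W \<in> M \<rightarrow>\<^sub>M L" using W G by (rule measurable_from_subalg[rotated])
  interpret Y: prob_space "distr M borel Y" by (rule prob_space_distr) simp
  have "(\<integral>\<^sup>+\<omega>. f (W \<omega>, Y \<omega>) \<partial>M) = (\<integral>\<^sup>+p. f p \<partial>distr M (L \<Otimes>\<^sub>M borel) (\<lambda>\<omega>. (W \<omega>, Y \<omega>)))"
    by (subst nn_integral_distr) auto
  also have "\<dots> = (\<integral>\<^sup>+p. f p \<partial>(distr M L W \<Otimes>\<^sub>M distr M borel Y))"
    unfolding indep_gaussian_pair_distr[OF G Y W] ..
  also have "\<dots> = (\<integral>\<^sup>+w. (\<integral>\<^sup>+y. f (w, y) \<partial>distr M borel Y) \<partial>distr M L W)"
    by (rule Y.nn_integral_fst[symmetric]) measurable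
  also have "\<dots> = (\<integral>\<^sup>+w. (\<integral>\<^sup>+\<omega>'. f (w, Y \<omega>') \<partial>M) \<partial>distr M L W)"
    by (intro nn_integral_cong) (simp add: nn_integral_distr)
  also have "\<dots> = (\<integral>\<^sup>+\<omega>. (\<integral>\<^sup>+\<omega>'. f (W \<omega>, Y \<omega>') \<partial>M) \<partial>M)"
    by (subst nn_integral_distr) auto
  finally show ?thesis .
qed

lemma gaussian_variable_distr:
  assumes f [measurable]: "f \<in> M \<rightarrow>\<^sub>M L" and g [measurable]: "g \<in> borel_measurable L" and gv: "gaussian_variable M (\<lambda>\<omega>. g (f \<omega>))"
  shows "gaussian_variable (distr M L f) g"
proof -
  have "distr (distr M L f) lborel g = distr M lborel (\<lambda>\<omega>. g (f \<omega>))"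
    by (subst distr_distr) (auto simp: o_def)
  then show ?thesis
    using gv by (auto simp: gaussian_variable_def distributed_def AE_distr_iff)
qed

end

section \<open>Markov kernels of processes with independent increments\<close>

context filtered_prob_space begin

text \<open>An image measure instead of a Gaussian density, so that increments of variance 0 are
  included.\<close>

definition increment_kernel :: "(real \<Rightarrow> 'w \<Rightarrow> real) \<Rightarrow> real \<Rightarrow> real \<Rightarrow> real \<Rightarrow> real measure" where
  "increment_kernel N s t u = distr M borel (\<lambda>\<omega>. u + (N t \<omega> - N s \<omega>))"

context
  fixes N U assumes N: "gaussian_martingale {0..1} N U"
begin

lemma increment_kernel_emeasure:
  assumes st: "0 \<le> s" "s \<le> t" "t \<le> 1" and A [measurable]: "A \<in> sets borel"
  shows "emeasure (increment_kernel N s t u) A = (\<integral>\<^sup>+\<omega>. indicator A (u + (N t \<omega> - N s \<omega>)) \<partial>M)"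
proof -
  have [measurable]: "N t \<in> borel_measurable M" "N s \<in> borel_measurable M"
    using gm_measurable[OF N] st by auto
  have "(\<integral>\<^sup>+\<omega>. indicator A (u + (N t \<omega> - N s \<omega>)) \<partial>M) = (\<integral>\<^sup>+z. indicator A z \<partial>increment_kernel N s t u)"
    unfolding increment_kernel_def by (subst nn_integral_distr) auto
  also have "\<dots> = emeasure (increment_kernel N s t u) A"
    using A by (intro nn_integral_indicator) (simp add: increment_kernel_def)
  finally show ?thesis ..
qed

lemma increment_kernel_measurable:
  assumes st: "0 \<le> s" "s \<le> t" "t \<le> 1"
  shows "increment_kernel N s t \<in> borel \<rightarrow>\<^sub>M prob_algebra borel"
proof (rule measurable_prob_algebraI)
  have [measurable]: "N t \<in> borel_measurable M" "N s \<in> borel_measurable M"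
    using gm_measurable[OF N] st by auto
  show "prob_space (increment_kernel N s t u)" for u
    unfolding increment_kernel_def by (rule prob_space_distr) measurable
  have "M \<in> space (subprob_algebra M)" by (simp add: space_subprob_algebra prob_space_imp_subprob_space prob_space_axioms)
  then show "increment_kernel N s t \<in> borel \<rightarrow>\<^sub>M subprob_algebra borel"
    unfolding increment_kernel_def[abs_def] by (intro measurable_distr2[where M=M]) auto
qed

text \<open>Chapman-Kolmogorov holds because the increment from \<open>s\<close> to \<open>t\<close>
  is the sum of the independent increments from \<open>s\<close> to \<open>r\<close> and from
  \<open>r\<close> to \<open>t\<close>.\<close>

lemma transition_function_increment_kernel: "transition_function (increment_kernel N)"
  unfolding transition_function_def
proof (intro conjI allI impI)
  fix s t :: real assume "0 \<le> s \<and> s < t \<and> t \<le> 1"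
  then show "increment_kernel N s t \<in> borel \<rightarrow>\<^sub>M prob_algebra borel" by (intro increment_kernel_measurable) auto
next
  fix s r t u :: real assume st: "0 \<le> s \<and> s < r \<and> r < t \<and> t \<le> 1"
  have [measurable]: "N t \<in> borel_measurable M" "N s \<in> borel_measurable M" "N r \<in> borel_measurable M"
    using gm_measurable[OF N] st by auto
  have K: "increment_kernel N r t \<in> borel \<rightarrow>\<^sub>M subprob_algebra borel"
    using st by (intro measurable_prob_algebraD increment_kernel_measurable) auto
  have sub: "subalgebra M (F r)" using subalg st by auto
  have inc: "indep_gaussian M (F r) (\<lambda>\<omega>. N t \<omega> - N r \<omega>) (U t - U r)"
    using gm_increment[OF N, of r t] st by auto
  have W: "(\<lambda>\<omega>. N r \<omega> - N s \<omega>) \<in> borel_measurable (F r)"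
    using st by (intro borel_measurable_diff F_measurable_mono[OF gm_adapted[OF N]]) auto
  have [simp]: "sets (increment_kernel N s r u) = sets borel" "space (increment_kernel N s r u) = UNIV"
    by (simp_all add: increment_kernel_def)
  show "increment_kernel N s t u = increment_kernel N s r u \<bind> increment_kernel N r t"
  proof (rule measure_eqI)
    have K': "increment_kernel N r t \<in> increment_kernel N s r u \<rightarrow>\<^sub>M subprob_algebra borel"
      using K by (simp cong: measurable_cong_sets)
    show "sets (increment_kernel N s t u) = sets (increment_kernel N s r u \<bind> increment_kernel N r t)"
      using sets_bind[of "increment_kernel N s r u" "increment_kernel N r t" borel] K'
      by (simp add: increment_kernel_def)
    fix A assume "A \<in> sets (increment_kernel N s t u)"
    then have A [measurable]: "A \<in> sets borel" by (simp add: increment_kernel_def)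
    have "emeasure (increment_kernel N s r u \<bind> increment_kernel N r t) A
        = (\<integral>\<^sup>+z. emeasure (increment_kernel N r t z) A \<partial>increment_kernel N s r u)"
      by (rule emeasure_bind[OF _ K' A]) simp
    also have "\<dots> = (\<integral>\<^sup>+\<omega>. emeasure (increment_kernel N r t (u + (N r \<omega> - N s \<omega>))) A \<partial>M)"
      unfolding increment_kernel_def[of N s r]
      using measurable_emeasure_kernel[OF K A] by (subst nn_integral_distr) auto
    also have "\<dots> = (\<integral>\<^sup>+\<omega>. (\<integral>\<^sup>+\<omega>'. indicator A (u + (N r \<omega> - N s \<omega>) + (N t \<omega>' - N r \<omega>')) \<partial>M) \<partial>M)"
      using st by (simp add: increment_kernel_emeasure)
    also have "\<dots> = (\<integral>\<^sup>+\<omega>. indicator A (u + (N r \<omega> - N s \<omega>) + (N t \<omega> - N r \<omega>)) \<partial>M)"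
      using indep_gaussian_nn_integral_pair[OF sub inc W, of "\<lambda>p. indicator A (u + fst p + snd p)"] by simp
    also have "\<dots> = emeasure (increment_kernel N s t u) A"
      using st by (subst increment_kernel_emeasure) (auto simp: algebra_simps)
    finally show "emeasure (increment_kernel N s t u) A = emeasure (increment_kernel N s r u \<bind> increment_kernel N r t) A" ..
  qed
qed

text \<open>The natural filtration lies inside \<open>F s\<close>, and the increment after
  \<open>s\<close> is independent of \<open>F s\<close>; averaging over that increment gives the
  kernel.\<close>

lemma markov_process_increment_kernel: "markov_process M (increment_kernel N) (\<lambda>t \<omega>. x + N t \<omega>)"
  unfolding markov_process_def
proof (intro conjI ballI allI impI)
  show "(\<lambda>\<omega>. x + N t \<omega>) \<in> borel_measurable M" if "t \<in> {0..1}" for t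
    using gm_measurable[OF N that] by simp
  fix s t :: real and A :: "real set"
  assume st: "0 \<le> s \<and> s < t \<and> t \<le> 1" and A [measurable]: "A \<in> sets borel"
  let ?G = "natural_filtration M (\<lambda>t \<omega>. x + N t \<omega>) s"
  have NM [measurable]: "N t \<in> borel_measurable M" "N s \<in> borel_measurable M"
    using gm_measurable[OF N] st by auto
  have "subalgebra (F s) ?G"
    using st F_space[of s]
    by (intro natural_filtration_subalgebra borel_measurable_add borel_measurable_const F_measurable_mono[OF gm_adapted[OF N]]) auto
  moreover have subs: "subalgebra M (F s)" using subalg st by auto
  ultimately have GF: "sets ?G \<subseteq> sets (F s)" and sub: "subalgebra M ?G" by (auto simp: subalgebra_def)
  interpret nf: finite_measure_subalgebra M ?G by unfold_locales (rule sub)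
  have inc: "indep_gaussian M (F s) (\<lambda>\<omega>. N t \<omega> - N s \<omega>) (U t - U s)"
    using gm_increment[OF N, of s t] st by auto
  define k where "k z = measure (increment_kernel N s t z) A" for z
  have K: "increment_kernel N s t \<in> borel \<rightarrow>\<^sub>M prob_algebra borel"
    using st by (intro increment_kernel_measurable) auto
  have k [measurable]: "k \<in> borel_measurable borel"
    unfolding k_def[abs_def] using measurable_compose[OF measurable_prob_algebraD[OF K] measurable_measure_subprob_algebra[OF A]] .
  have ek: "emeasure (increment_kernel N s t z) A = ennreal (k z)" and k01: "0 \<le> k z" "k z \<le> 1" for z
  proof -
    interpret p: prob_space "increment_kernel N s t z"
      unfolding increment_kernel_def by (rule prob_space_distr) measurable
    show "emeasure (increment_kernel N s t z) A = ennreal (k z)" "0 \<le> k z" "k z \<le> 1"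
      by (auto simp: k_def p.emeasure_eq_measure)
  qed
  show "AE \<omega> in M. real_cond_exp M ?G (\<lambda>\<omega>. indicator A (x + N t \<omega>)) \<omega> = measure (increment_kernel N s t (x + N s \<omega>)) A"
    unfolding k_def[symmetric]
  proof (rule nf.real_cond_exp_charact)
    have G: "(\<lambda>\<omega>. x + N s \<omega>) \<in> borel_measurable ?G"
      using st by (intro natural_filtration_measurable) auto
    then show "(\<lambda>\<omega>. k (x + N s \<omega>)) \<in> borel_measurable ?G" by measurable
    show "integrable M (\<lambda>\<omega>. indicat_real A (x + N t \<omega>))"
      by (intro integrable_const_bound[where B=1]) (auto simp: indicator_def)
    show "integrable M (\<lambda>\<omega>. k (x + N s \<omega>))"
      using k01 by (intro integrable_const_bound[where B=1]) auto
    fix C assume C: "C \<in> sets ?G"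
    then have CF: "C \<in> sets (F s)" and [measurable]: "C \<in> events" using GF subs by (auto simp: subalgebra_def)
    have Ns: "N s \<in> borel_measurable (F s)" using gm_adapted[OF N] st by auto
    \<comment> \<open>The conditioning event and the current value are frozen together, since the
      increment is independent of the pair.\<close>
    have W: "(\<lambda>\<omega>. (indicat_real C \<omega>, N s \<omega>)) \<in> F s \<rightarrow>\<^sub>M borel \<Otimes>\<^sub>M borel"
      using CF Ns by measurable
    have "(\<integral>\<^sup>+\<omega>. ennreal (indicator C \<omega>) * indicator A (x + N s \<omega> + (N t \<omega> - N s \<omega>)) \<partial>M)
       = (\<integral>\<^sup>+\<omega>. (\<integral>\<^sup>+\<omega>'. ennreal (indicator C \<omega>) * indicator A (x + N s \<omega> + (N t \<omega>' - N s \<omega>')) \<partial>M) \<partial>M)"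
      using indep_gaussian_nn_integral_pair[OF subs inc W,
          of "\<lambda>p. ennreal (fst (fst p)) * indicator A (x + snd (fst p) + snd p)"] by simp
    also have "\<dots> = (\<integral>\<^sup>+\<omega>. ennreal (indicator C \<omega>) * emeasure (increment_kernel N s t (x + N s \<omega>)) A \<partial>M)"
      using st by (simp add: nn_integral_cmult increment_kernel_emeasure)
    finally have eq: "(\<integral>\<^sup>+\<omega>. ennreal (indicator C \<omega> * indicator A (x + N t \<omega>)) \<partial>M)
       = (\<integral>\<^sup>+\<omega>. ennreal (indicator C \<omega> * k (x + N s \<omega>)) \<partial>M)"
      using k01 by (simp add: ek ennreal_mult ennreal_indicator)
    show "(\<integral>\<omega>\<in>C. indicat_real A (x + N t \<omega>) \<partial>M) = (\<integral>\<omega>\<in>C. k (x + N s \<omega>) \<partial>M)"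
      unfolding set_lebesgue_integral_def real_scaleR_def
      using eq k01 by (subst (1 2) integral_eq_nn_integral) (auto intro!: AE_I2)
  qed
qed

end

end

lemma continuous_on_Icc_left_limit:
  fixes f :: "real \<Rightarrow> real"
  assumes f: "continuous_on {0..<1} f" and L: "(f \<longlongrightarrow> L) (at_left 1)"
  shows "continuous_on {0..1} (\<lambda>t. if t < 1 then f t else L)"
  unfolding continuous_on_def
proof
  fix t :: real assume t: "t \<in> {0..1}"
  show "((\<lambda>t. if t < 1 then f t else L) \<longlongrightarrow> (if t < 1 then f t else L)) (at t within {0..1})"
  proof (cases "t < 1")
    case True
    have "(f \<longlongrightarrow> f t) (at t within {0..<1})" using f t True by (auto simp: continuous_on_def)
    moreover have "at t within {0..<1} = at t within {0..1}"
      using True by (intro at_within_nhd[of _ "{..<1}"]) auto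
    moreover have "\<forall>\<^sub>F u in at t within {0..1}. u < 1"
      using True by (auto simp: eventually_at intro!: exI[of _ "1 - t"] simp: dist_real_def)
    then have "\<forall>\<^sub>F u in at t within {0..1}. f u = (if u < 1 then f u else L)"
      by eventually_elim simp
    ultimately show ?thesis using True by (auto intro: Lim_transform_eventually)
  next
    case False
    then have [simp]: "t = 1" using t by simp
    have "\<forall>\<^sub>F u in at_left (1::real). u \<in> {0<..<1}" by (rule eventually_at_left_real) simp
    then have "\<forall>\<^sub>F u in at_left 1. f u = (if u < 1 then f u else L)" by eventually_elim simp
    with L have "((\<lambda>t. if t < 1 then f t else L) \<longlongrightarrow> L) (at_left 1)" by (rule Lim_transform_eventually)
    then show ?thesis by (simp add: at_within_Icc_at_left)
  qed
qed

section \<open>Extension of the noise to the closed interval\<close>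

context linear_sde begin

text \<open>\<open>lim\<close> along a fixed sequence gives the terminal value on every outcome;
  \<open>I1_limit\<close> identifies it almost surely with the limit from the left.\<close>

definition I1 :: "real \<Rightarrow> 'w \<Rightarrow> real" where
  "I1 t \<omega> = (if t < 1 then I t \<omega> else lim (\<lambda>n. I (approach n) \<omega>))"

context
  fixes S assumes S: "(V \<longlongrightarrow> S) (at_left 1)"
begin

lemma I1_limit: "AE \<omega> in M. ((\<lambda>t. I t \<omega>) \<longlongrightarrow> I1 1 \<omega>) (at_left 1)"
  using I_converges[OF S]
proof eventually_elim
  case (elim \<omega>)
  then obtain L where L: "((\<lambda>t. I t \<omega>) \<longlongrightarrow> L) (at_left 1)" by blast
  have "(\<lambda>n. I (approach n) \<omega>) \<longlonglongrightarrow> L" by (rule filterlim_compose[OF L approach(3)])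
  then show ?case using L by (simp add: I1_def limI)
qed

definition V1 :: "real \<Rightarrow> real" where "V1 t = (if t < 1 then V t else S)"

text \<open>At time 1 both properties pass to the almost sure limit: adaptedness by completeness,
  the law of increments by \<open>indep_gaussian_AE_limit\<close>, since \<open>V\<close> converges
  to \<open>S\<close>.\<close>

lemma I1_martingale: "gaussian_martingale {0..1} I1 V1"
proof -
  have adapted: "I1 t \<in> borel_measurable (F t)" if t: "t \<in> {0..1}" for t
  proof (cases "t < 1")
    case True
    then have "I1 t = I t" by (auto simp: I1_def)
    then show ?thesis using gm_adapted[OF I_martingale, of t] True t by simp
  next
    case False
    then have [simp]: "t = 1" using t by simp
    show ?thesis
    proof (rule F_measurable_AE_limit)
      show "I (approach n) \<in> borel_measurable (F t)" for n
        using approach(1)[of n] F_measurable_mono[OF gm_adapted[OF I_martingale approach(1)], of n t] by simp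
      show "AE \<omega> in M. (\<lambda>n. I (approach n) \<omega>) \<longlonglongrightarrow> I1 t \<omega>"
        using I1_limit
      proof eventually_elim
        case (elim \<omega>)
        then have "(\<lambda>n. I (approach n) \<omega>) \<longlonglongrightarrow> I1 1 \<omega>" by (rule filterlim_compose[OF _ approach(3)])
        then show ?case by simp
      qed
    qed auto
  qed
  have inc: "indep_gaussian M (F s) (\<lambda>\<omega>. I1 t \<omega> - I1 s \<omega>) (V1 t - V1 s)" if st: "s \<in> {0..1}" "t \<in> {0..1}" "s \<le> t" for s t
  proof -
    consider "t < 1" | "s < 1" "t = 1" | "s = 1" "t = 1" using st by force
    then show ?thesis
    proof cases
      case 1
      then show ?thesis using gm_increment[OF I_martingale, of s t] st by (simp add: I1_def V1_def)
    next
      case 2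
      \<comment> \<open>The maximum keeps the approximating times from falling below
        \<open>s\<close>.\<close>
      define a where "a n = max s (approach n)" for n
      have a: "a n \<in> {0..<1}" "s \<le> a n" for n using approach(1)[of n] 2 st by (auto simp: a_def)
      have "a \<longlonglongrightarrow> max s 1" unfolding a_def[abs_def] by (intro tendsto_max tendsto_const approach)
      then have "filterlim a (at_left 1) sequentially"
        unfolding filterlim_at using a 2 by (auto intro!: always_eventually simp: max_def less_le)
      note a' = this
      have lim: "AE \<omega> in M. (\<lambda>n. I (a n) \<omega> - I s \<omega>) \<longlonglongrightarrow> I1 t \<omega> - I1 s \<omega>"
        using I1_limit
      proof eventually_elim
        case (elim \<omega>)
        then have "(\<lambda>n. I (a n) \<omega>) \<longlonglongrightarrow> I1 1 \<omega>" by (rule filterlim_compose[OF _ a'])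
        then have "(\<lambda>n. I (a n) \<omega> - I s \<omega>) \<longlonglongrightarrow> I1 1 \<omega> - I s \<omega>" by (intro tendsto_intros)
        then show ?case using 2 by (simp add: I1_def)
      qed
      have vlim: "(\<lambda>n. V (a n) - V s) \<longlonglongrightarrow> V1 t - V1 s"
        using 2 by (auto simp: V1_def intro!: tendsto_intros filterlim_compose[OF S a'])
      have inc: "indep_gaussian M (F s) (\<lambda>\<omega>. I (a n) \<omega> - I s \<omega>) (V (a n) - V s)" for n
        using a[of n] st 2 by (intro gm_increment[OF I_martingale]) auto
      have meas: "(\<lambda>\<omega>. I1 t \<omega> - I1 s \<omega>) \<in> borel_measurable M"
        using st F_measurable_M[OF adapted] by (intro borel_measurable_diff) auto
      show ?thesis
        by (rule indep_gaussian_AE_limit[OF subalg inc lim meas vlim]) (use st in simp)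
    next
      case 3
      then show ?thesis using indep_gaussian_0[OF subalg[of 1]] by simp
    qed
  qed
  have "AE \<omega> in M. I1 0 \<omega> = 0"
    using I_martingale by (simp add: gaussian_martingale_def I1_def)
  then show ?thesis
    unfolding gaussian_martingale_def using adapted inc by (auto simp: V1_def)
qed

definition Z :: "real \<Rightarrow> real \<Rightarrow> 'w \<Rightarrow> real" where "Z x t \<omega> = x + I1 t \<omega>"

lemma Z_measurable: "t \<in> {0..1} \<Longrightarrow> Z x t \<in> borel_measurable M"
  unfolding Z_def[abs_def] using gm_measurable[OF I1_martingale] by auto

lemma Z_continuous: "continuous_paths_on {0..1} M (Z x)"
  unfolding continuous_paths_on_def using I_cont I1_limit
proof eventually_elim
  case (elim \<omega>)
  have "continuous_on {0..1} (\<lambda>t. if t < 1 then I t \<omega> else I1 1 \<omega>)"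
    by (rule continuous_on_Icc_left_limit) (use elim in auto)
  then have "continuous_on {0..1} (\<lambda>t. x + (if t < 1 then I t \<omega> else I1 1 \<omega>))" by (intro continuous_intros)
  moreover have "x + (if t < 1 then I t \<omega> else I1 1 \<omega>) = Z x t \<omega>" for t by (simp add: Z_def I1_def)
  ultimately show ?case by simp
qed

lemma Z_mean: "t \<in> {0..1} \<Longrightarrow> mean M (Z x t) = x"
  by (rule gm_affine_mean[OF I1_martingale Z_measurable, where c=1]) (auto simp: Z_def)

lemma Z_covariance: "s \<in> {0..1} \<Longrightarrow> t \<in> {0..1} \<Longrightarrow> covariance M (Z x s) (Z x t) = V1 (min s t)"
  using gm_affine_covariance[OF I1_martingale Z_measurable _ Z_measurable, of s x x 1 s t x x 1 t] by (auto simp: Z_def)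

lemma Z_nondegenerate: "nondegenerate_continuous_gaussian_markov M Z"
  unfolding nondegenerate_continuous_gaussian_markov_def
proof (intro conjI allI ballI exI)
  show "transition_function (increment_kernel I1)" by (rule transition_function_increment_kernel[OF I1_martingale])
  show "markov_process M (increment_kernel I1) (Z x)" for x
    unfolding Z_def[abs_def] by (rule markov_process_increment_kernel[OF I1_martingale])
  show "AE \<omega> in M. Z x 0 \<omega> = x" for x
    using I1_martingale unfolding gaussian_martingale_def Z_def by (auto elim!: eventually_mono)
  show "continuous_paths_on {0..1} M (Z x)" for x by (rule Z_continuous)
  show "gaussian_process M {0..1} (Z x)" for x
    by (rule gm_affine_gaussian[OF I1_martingale Z_measurable, where c="\<lambda>_. 1" and m="\<lambda>_. x"]) (auto simp: Z_def)
  show "covariance M (Z x t) (Z x t) > 0" if "t \<in> {0<..1}" for x t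
    using that V_strict[of 0 t] V_less_limit[OF S, of 0] by (auto simp: Z_covariance V1_def)
qed

text \<open>\<open>sde_solution\<close> concerns \<open>{0..<1}\<close>, where \<open>I1\<close> is
  \<open>I\<close>, so the integral process is already at hand.\<close>

lemma Z_sde: "sde_solution M F B (\<lambda>t z. 0) \<sigma> x (Z x)"
  unfolding sde_solution_def
proof (intro conjI exI ballI)
  show "adapted_on {0..<1} F (Z x)"
    unfolding adapted_on_def Z_def[abs_def] using gm_adapted[OF I1_martingale] by auto
  show "continuous_paths_on {0..<1} M (Z x)"
    using Z_continuous[of x] unfolding continuous_paths_on_def
    by eventually_elim (auto intro: continuous_on_subset)
  show "is_ito_integral M F B \<sigma> t (I t)" if "t \<in> {0..<1}" for t using I that .
qed (auto simp: Z_def I1_def)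

section \<open>Sufficiency: matching the bridge moments\<close>

context
  assumes drift: "\<And>t. t \<in> {0..<1} \<Longrightarrow> h t = (\<sigma> t)\<^sup>2 / (S - V t)"
begin

text \<open>\<open>h\<close> is the logarithmic derivative of \<open>1 / (S - V t)\<close>, so the
  product has derivative zero and keeps its value at 0.\<close>

lemma exp_H: "t \<in> {0..<1} \<Longrightarrow> (S - V t) * exp (H t) = S"
proof -
  assume t: "t \<in> {0..<1}"
  have "((\<lambda>t. (S - V t) * exp (H t)) has_real_derivative 0) (at t within {0..<1})" if t: "t \<in> {0..<1}" for t
  proof -
    have *: "(S - V t) * h t = (\<sigma> t)\<^sup>2"
      using drift[OF t] V_less_limit[OF S, of t] t by simp
    have "((\<lambda>t. (S - V t) * exp (H t)) has_real_derivative
        (S - V t) * (exp (H t) * h t) + (0 - (\<sigma> t)\<^sup>2) * exp (H t)) (at t within {0..<1})"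
      using H_deriv[OF t] V_deriv[OF t] by (auto intro!: derivative_eq_intros)
    moreover have "(S - V t) * (exp (H t) * h t) + (0 - (\<sigma> t)\<^sup>2) * exp (H t) = 0"
      unfolding mult.left_commute[of "S - V t"] * by simp
    ultimately show ?thesis by (simp only:)
  qed
  from constant_if_DERIV_zero_Ico[OF this t] show ?thesis by simp
qed

text \<open>This is the relation \<open>exp (H t) = 1 + \<kappa> * U t\<close> of the necessity
  proof with \<open>\<kappa> = 1 / S\<close>; \<open>exp_H\<close> makes the derivatives of both
  sides agree.\<close>

lemma U_eq: "t \<in> {0..<1} \<Longrightarrow> U t = S * (exp (H t) - 1)"
proof -
  assume t: "t \<in> {0..<1}"
  have "((\<lambda>t. U t - S * exp (H t)) has_real_derivative 0) (at t within {0..<1})" if t: "t \<in> {0..<1}" for t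
  proof -
    have "((\<lambda>t. U t - S * exp (H t)) has_real_derivative
        (exp (H t))\<^sup>2 * (\<sigma> t)\<^sup>2 - S * (exp (H t) * h t)) (at t within {0..<1})"
      using H_deriv[OF t] U_deriv[OF t] by (auto intro!: derivative_eq_intros)
    moreover have "S * h t = exp (H t) * (\<sigma> t)\<^sup>2"
    proof -
      have "S * h t = ((S - V t) * exp (H t)) * ((\<sigma> t)\<^sup>2 / (S - V t))"
        unfolding exp_H[OF t] drift[OF t] ..
      also have "\<dots> = exp (H t) * (\<sigma> t)\<^sup>2" using V_less_limit[OF S, of t] t by simp
      finally show ?thesis .
    qed
    then have "(exp (H t))\<^sup>2 * (\<sigma> t)\<^sup>2 - S * (exp (H t) * h t) = 0"
      by (simp add: power2_eq_square algebra_simps)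
    ultimately show ?thesis by simp
  qed
  from constant_if_DERIV_zero_Ico[OF this t] show ?thesis by (simp add: algebra_simps)
qed

lemma exp_minus_H: "t \<in> {0..<1} \<Longrightarrow> exp (- H t) = 1 - V t / S"
  using exp_H[of t] V_less_limit[OF S, of 0] by (simp add: exp_minus field_simps)

text \<open>\<open>Z\<close> has the moments of Brownian motion run with the clock \<open>V\<close>,
  so its bridge has mean \<open>x + V t / S * (y - x)\<close> and covariance
  \<open>V (min s t) - V s * V t / S\<close>. By \<open>exp_minus_H\<close> and \<open>U_eq\<close>
  the Gaussian process \<open>X x y\<close> has the same moments.\<close>

lemma Z_bridges: "corresponds_to_bridges M X Z"
  unfolding corresponds_to_bridges_def is_bridge_law_def Let_def
proof (intro allI conjI ballI)
  fix x y
  have S0: "S > 0" using V_less_limit[OF S, of 0] by simp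
  have V1: "V1 1 = S" "\<And>t. t \<in> {0..<1} \<Longrightarrow> V1 t = V t" by (auto simp: V1_def)
  have f: "(\<lambda>\<omega>. \<lambda>t\<in>{0..<1}. X x y t \<omega>) \<in> M \<rightarrow>\<^sub>M (\<Pi>\<^sub>M t\<in>{0..<1}. borel)"
    using X_measurable by (intro measurable_restrict) auto
  show "prob_space (path_law M (X x y))" unfolding path_law_def by (rule prob_space_distr[OF f])
  show "sets (path_law M (X x y)) = sets (\<Pi>\<^sub>M t\<in>{0..<1}. borel)" by (simp add: path_law_def)
  have gp: "gaussian_process M {0..<1} (X x y)"
  proof (rule gm_affine_gaussian[OF N_martingale X_measurable])
    show "AE \<omega> in M. X x y t \<omega> = (y + (x - y) * exp (- H t)) + exp (- H t) * N t \<omega>" if "t \<in> {0..<1}" for t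
      using X_formula_N[of x y] that by (auto elim!: eventually_mono)
  qed
  show "gaussian_process (path_law M (X x y)) {0..<1} (\<lambda>t w. w t)"
    unfolding gaussian_process_def path_law_def
  proof (intro allI impI)
    fix J and a :: "real \<Rightarrow> real" assume J: "finite J \<and> J \<subseteq> {0..<1::real}"
    show "gaussian_variable (distr M (\<Pi>\<^sub>M t\<in>{0..<1}. borel) (\<lambda>\<omega>. \<lambda>t\<in>{0..<1}. X x y t \<omega>)) (\<lambda>w. \<Sum>t\<in>J. a t * w t)"
    proof (rule gaussian_variable_distr[OF f])
      show "(\<lambda>w. \<Sum>t\<in>J. a t * w t) \<in> borel_measurable (\<Pi>\<^sub>M t\<in>{0..<1}. borel)"
        using J by (intro borel_measurable_sum borel_measurable_times borel_measurable_const measurable_component_singleton) auto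
      have "(\<Sum>t\<in>J. a t * (\<lambda>t\<in>{0..<1}. X x y t \<omega>) t) = (\<Sum>t\<in>J. a t * X x y t \<omega>)" for \<omega>
        using J by (intro sum.cong) auto
      then show "gaussian_variable M (\<lambda>\<omega>. \<Sum>t\<in>J. a t * (\<lambda>t\<in>{0..<1}. X x y t \<omega>) t)"
        using gp J by (simp add: gaussian_process_def)
    qed
  qed
  show "mean (path_law M (X x y)) (\<lambda>w. w t)
      = mean M (Z x t) + covariance M (Z x t) (Z x 1) / covariance M (Z x 1) (Z x 1) * (y - mean M (Z x 1))"
    if t: "t \<in> {0..<1}" for t
  proof -
    have "mean (path_law M (X x y)) (\<lambda>w. w t) = y + (x - y) * (1 - V t / S)"
      using path_law_moments(1)[OF X_measurable t t] X_mean[OF t] exp_minus_H[OF t] by simp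
    also have "\<dots> = x + V t / S * (y - x)" by (simp add: algebra_simps diff_divide_distrib)
    finally show ?thesis using t by (simp add: Z_mean Z_covariance V1 min_def)
  qed
  show "covariance (path_law M (X x y)) (\<lambda>w. w s) (\<lambda>w. w t)
      = covariance M (Z x s) (Z x t) - covariance M (Z x s) (Z x 1) * covariance M (Z x t) (Z x 1) / covariance M (Z x 1) (Z x 1)"
    if st: "s \<in> {0..<1}" "t \<in> {0..<1}" for s t
  proof -
    have *: "exp (- H u) * exp (- H v) * U u = V u - V u * V v / S" if "u \<in> {0..<1}" "v \<in> {0..<1}" for u v
    proof -
      have "exp (- H u) * exp (- H v) * U u = exp (- H v) * (S * (1 - exp (- H u)))"
        unfolding U_eq[OF that(1)] by (simp add: exp_minus field_simps)
      also have "\<dots> = V u - V u * V v / S"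
        unfolding exp_minus_H[OF that(1)] exp_minus_H[OF that(2)] using S0 by (simp add: field_simps)
      finally show ?thesis .
    qed
    have "covariance (path_law M (X x y)) (\<lambda>w. w s) (\<lambda>w. w t) = exp (- H s) * exp (- H t) * U (min s t)"
      using path_law_moments(2)[OF X_measurable st] X_covariance[OF st] by simp
    also have "\<dots> = V (min s t) - V s * V t / S"
      using *[of s t] *[of t s] st by (cases "s \<le> t") (auto simp: min_def mult_ac)
    finally show ?thesis using st by (simp add: Z_covariance V1 min_def)
  qed
qed

end

end

end

theorem theorem3p1:
  fixes M :: "'w measure" and F :: "real \<Rightarrow> 'w measure" and B :: "real \<Rightarrow> 'w \<Rightarrow> real"
    and h \<sigma> :: "real \<Rightarrow> real" and X :: "real \<Rightarrow> real \<Rightarrow> real \<Rightarrow> 'w \<Rightarrow> real"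
  assumes "filtered_prob_space M F"
    and "brownian_motion M F B"
    and "continuous_on {0..<1} h"
    and "continuous_on {0..<1} \<sigma>"
    and "\<And>t. t \<in> {0..<1} \<Longrightarrow> \<sigma> t > 0"
    and "\<And>x y. sde_solution M F B (\<lambda>t z. h t * (y - z)) \<sigma> x (X x y)"
  shows
    "((\<exists>K. \<forall>t\<in>{0..<1}. K \<le> h t) \<and>
      filterlim (\<lambda>t. integral {0..t} h) at_top (at_left 1) \<and>
      (\<exists>S. ((\<lambda>t. integral {0..t} (\<lambda>r. (\<sigma> r)\<^sup>2)) \<longlongrightarrow> S) (at_left 1))
      \<longrightarrow> pinned M X) \<and>
     (pinned M X \<longrightarrow>
      ((\<exists>Z. nondegenerate_continuous_gaussian_markov M Z \<and> corresponds_to_bridges M X Z) \<longleftrightarrow>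
       (\<exists>S. ((\<lambda>t. integral {0..t} (\<lambda>r. (\<sigma> r)\<^sup>2)) \<longlongrightarrow> S) (at_left 1) \<and>
            (\<forall>t\<in>{0..<1}. h t = (\<sigma> t)\<^sup>2 / (S - integral {0..t} (\<lambda>r. (\<sigma> r)\<^sup>2)))))) \<and>
     (pinned M X \<and>
      (\<exists>S. ((\<lambda>t. integral {0..t} (\<lambda>r. (\<sigma> r)\<^sup>2)) \<longlongrightarrow> S) (at_left 1) \<and>
           (\<forall>t\<in>{0..<1}. h t = (\<sigma> t)\<^sup>2 / (S - integral {0..t} (\<lambda>r. (\<sigma> r)\<^sup>2))))
      \<longrightarrow> (\<exists>Z. nondegenerate_continuous_gaussian_markov M Z \<and> corresponds_to_bridges M X Z \<and>
               (\<forall>x. sde_solution M F B (\<lambda>t z. 0) \<sigma> x (Z x))))"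
proof -
  interpret linear_sde M F B h \<sigma> X
    using assms by (simp add: linear_sde_def filtered_brownian_motion_def filtered_brownian_motion_axioms_def linear_sde_axioms_def)
  \<comment> \<open>The same process serves the converse of the equivalence and the statement on the
    dynamics.\<close>
  have construct: "\<exists>Z. nondegenerate_continuous_gaussian_markov M Z \<and> corresponds_to_bridges M X Z \<and>
      (\<forall>x. sde_solution M F B (\<lambda>t z. 0) \<sigma> x (Z x))"
    if "\<exists>S. (V \<longlongrightarrow> S) (at_left 1) \<and> (\<forall>t\<in>{0..<1}. h t = (\<sigma> t)\<^sup>2 / (S - V t))"
  proof -
    from that obtain S where S: "(V \<longlongrightarrow> S) (at_left 1)" "\<And>t. t \<in> {0..<1} \<Longrightarrow> h t = (\<sigma> t)\<^sup>2 / (S - V t)" by blast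
    show ?thesis using Z_nondegenerate[OF S(1)] Z_bridges[OF S] Z_sde[OF S(1)] by blast
  qed
  show ?thesis
    unfolding V_def[symmetric] H_def[symmetric]
    using pinned_if_bounded_below drift_if_bridges construct by blast
qed

end
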